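(* Let $(M,H)$ be an $n$-dimensional Carnot manifold, $a\in M$, and $(X_1,\ldots,X_n)$ an $H$-frame near $a$. Let $(x_1,\ldots,x_n)$ be Carnot coordinates at $a$ adapted to $(X_1,\ldots,X_n)$. Then a change of coordinates $x\mapsto\phi(x)$ produces Carnot coordinates at $a$ adapted to $(X_1,\ldots,X_n)$ if and only if $$\phi(x)=x+\mathrm{O}_w\left(\|x\|^{w+1}\right)\qquad\text{near } x=0 .$$
   Context: A Carnot manifold of step $r$ is a smooth manifold $M$ ($\dim M=n$) with a filtration by subbundles $H_1\subset\cdots\subset H_r=TM$ such that the Lie bracket of local sections of $H_w$ and $H_{w'}$ is a section of $H_{w+w'}$ whenever $w+w'\le r$. Its weights are $w_j=\min\{w:\ j\le \mathrm{rk}\,H_w\}$, $1\le j\le n$. An $H$-frame near $a$ is a tangent frame $(X_1,\ldots,X_n)$ near $a$ with each $X_j$ a section of $H_{w_j}$; then $[X_i,X_j]=\sum_{w_k\le w_i+w_j}L_{ij}^k X_k$ with smooth functions $L_{ij}^k$ near $a$. Dilations on $\mathbb{R}^n$: $\delta_t(x)=t\cdot x=(t^{w_1}x_1,\ldots,t^{w_n}x_n)$. For a vector field $X=\sum a_j(x)\partial_j$, $\delta_t^*X=\sum_j t^{-w_j}a_j(t\cdot x)\partial_j$. $\|\cdot\|$ is a pseudo-norm, i.e. a continuous function on $\mathbb{R}^n$, positive off $0$, with $\|t\cdot x\|=|t|\,\|x\|$, e.g. $\|x\|=\sum_j|x_j|^{1/w_j}$ (all pseudo-norms are equivalent). A smooth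 map $\Theta=(\Theta_1,\ldots,\Theta_n)$ near $0$ is $\mathrm{O}_w(\|x\|^{w+m})$ if $\Theta_k(x)=\mathrm{O}(\|x\|^{w_k+m})$ near $x=0$ for every $k$. Order and privileged coordinates: for $I=(i_1,\ldots,i_k)$, $k\ge 0$, put $X_I=X_{i_1}\cdots X_{i_k}$, $\langle I\rangle=w_{i_1}+\cdots+w_{i_k}$. A smooth $f$ near $a$ has order $N$ at $a$ if $X_If(a)=0$ whenever $\langle I\rangle<N$ and $X_If(a)\ne0$ for some $I$ with $\langle I\rangle=N$. Local coordinates centered at $a$ are linearly adapted to the $H$-frame if $X_j(0)=\partial_j$ for all $j$; they are privileged coordinates at $a$ adapted to $(X_1,\ldots,X_n)$ if moreover each coordinate $x_j$ has order $w_j$ at $a$. In privileged coordinates, $t^{w_j}\delta_t^*X_j$ converges as $t\to0$ ($C^\infty$ uniformly on compact sets) to a polynomial vector field $X_j^{(a)}$ on $\mathbb{R}^n$, the model vector field of $X_j$. The group $G(a)$: equip $\mathbb{R}^n$, with canonical basis $(\epsilon_j)$, with the nilpotent Lie bracket $[\epsilon_i,\epsilon_j]=\sum_{w_k=w_i+w_j}L_{ij}^k(a)\epsilon_k$ (zero if $w_i+w_j>r$). $G(a)$ is $\mathbb{R}^n$ with the Dynkin (Baker-Campbell-Hausdorff) product $x\cdot y=x+y+\frac12[x,y]+\frac1{12}([x,[x,y]]+[y,[y,x]])+\cdots$ (finite sum). $X_j^a$ is the left-invariant vector field on $G(a)$ with $X_j^a(0)=\partial_j$. Carnot coordinates at $a$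 adapted to $(X_1,\ldots,X_n)$ are privileged coordinates at $a$ adapted to $(X_1,\ldots,X_n)$ in which the model vector field of $X_j$ is $X_j^a$ for every $j$.
   Formalization: The right-hand side also requires φ'(0)=id; without it the claim fails: on the Heisenberg group (weights 1,1,2), φ(x)=(x1+x3,x2,x3) satisfies φ(x)=x+O_w(‖x‖^{w+1}) but X_3(0)≠∂_3 in the new coordinates. *)

theory Defs
  imports "HOL-Analysis.Analysis" "HOL-Library.Landau_Symbols"
begin

definition partial_deriv :: "'n \<Rightarrow> (real^'n \<Rightarrow> 'b::real_normed_vector) \<Rightarrow> real^'n \<Rightarrow> 'b"
  where "partial_deriv i f x = frechet_derivative f (at x) (axis i 1)"

fun iter_partial :: "'n list \<Rightarrow> (real^'n \<Rightarrow> 'b::real_normed_vector) \<Rightarrow> real^'n \<Rightarrow> 'b"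
  where
    "iter_partial [] f = f"
  | "iter_partial (i # I) f = partial_deriv i (iter_partial I f)"

text \<open>The set \<open>S\<close> is always open below, so this is the usual notion of a \<open>C\<close>-infinity map:
  total differentiability of the partial derivatives of every order also gives their continuity.\<close>

definition smooth_on :: "(real^'n) set \<Rightarrow> (real^'n \<Rightarrow> 'b::real_normed_vector) \<Rightarrow> bool"
  where "smooth_on S f \<longleftrightarrow> (\<forall>I. \<forall>x\<in>S. iter_partial I f differentiable (at x))"

definition diffeo_on :: "(real^'n) set \<Rightarrow> (real^'n \<Rightarrow> real^'n) \<Rightarrow> bool"
  where "diffeo_on D \<phi> \<longleftrightarrow> open D \<and> open (\<phi> ` D) \<and> inj_on \<phi> D \<and>
    smooth_on D \<phi> \<and> smooth_on (\<phi> ` D) (inv_into D \<phi>)"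

text \<open>A chart is an open set together with a homeomorphism onto an open subset of Euclidean space;
  the values of the map off its domain are irrelevant. The manifold is the union of the chart
  domains of an atlas, which is not required to be maximal.\<close>

type_synonym ('m, 'n) chart = "'m set \<times> ('m \<Rightarrow> real^'n)"

definition is_chart :: "('m::topological_space, 'n::finite) chart \<Rightarrow> bool"
  where "is_chart = (\<lambda>(U, x). open U \<and> open (x ` U) \<and> homeomorphism U (x ` U) x (inv_into U x))"

definition smooth_transition :: "('m, 'n::finite) chart \<Rightarrow> ('m, 'n) chart \<Rightarrow> bool"
  where "smooth_transition = (\<lambda>(U, x) (V, y). smooth_on (x ` (U \<inter> V)) (y \<circ> inv_into U x))"

definition smooth_atlas :: "('m::{t2_space,second_countable_topology}, 'n::finite) chart set \<Rightarrow> bool"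
  where "smooth_atlas A \<longleftrightarrow>
    (\<forall>C\<in>A. is_chart C) \<and> (\<forall>C\<in>A. \<forall>C'\<in>A. smooth_transition C C')"

definition manifold_of :: "('m, 'n::finite) chart set \<Rightarrow> 'm set"
  where "manifold_of A = (\<Union>C\<in>A. fst C)"

definition local_coords :: "('m::topological_space, 'n::finite) chart set \<Rightarrow> ('m, 'n) chart \<Rightarrow> bool"
  where "local_coords A C \<longleftrightarrow> is_chart C \<and> fst C \<subseteq> manifold_of A \<and>
    (\<forall>C'\<in>A. smooth_transition C C' \<and> smooth_transition C' C)"

definition smooth_fun :: "('m, 'n::finite) chart set \<Rightarrow> 'm set \<Rightarrow> ('m \<Rightarrow> real) \<Rightarrow> bool"
  where "smooth_fun A V f \<longleftrightarrow> (\<forall>(U, x)\<in>A. smooth_on (x ` (U \<inter> V)) (f \<circ> inv_into U x))"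

definition smooth_near :: "('m::topological_space, 'n::finite) chart set \<Rightarrow> 'm \<Rightarrow> ('m \<Rightarrow> real) \<Rightarrow> bool"
  where "smooth_near A p f \<longleftrightarrow> (\<exists>V. open V \<and> p \<in> V \<and> smooth_fun A V f)"

text \<open>A tangent vector at \<open>p\<close> is the operator \<open>f \<mapsto> (\<Sum>j. c\<^sub>j (\<partial>f/\<partial>x\<^sub>j)(p))\<close> on functions smooth
  near \<open>p\<close>. Being total functions, these operators are normalised to be \<open>0\<close> elsewhere, so that two
  of them are equal as soon as they agree on functions smooth near \<open>p\<close>.\<close>

type_synonym 'm tvec = "('m \<Rightarrow> real) \<Rightarrow> real"
type_synonym 'm vfield = "'m \<Rightarrow> 'm tvec"

definition coord_vec ::
  "('m::topological_space, 'n::finite) chart set \<Rightarrow> ('m, 'n) chart \<Rightarrow> 'm \<Rightarrow> real^'n \<Rightarrow> 'm tvec"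
  where "coord_vec A = (\<lambda>(U, x) p c f.
    if smooth_near A p f then frechet_derivative (f \<circ> inv_into U x) (at (x p)) c else 0)"

definition tangent_space ::
  "('m::topological_space, 'n::finite) chart set \<Rightarrow> 'm \<Rightarrow> 'm tvec set"
  where "tangent_space A p = {coord_vec A C p c | C c. C \<in> A \<and> p \<in> fst C}"

definition smooth_vfield ::
  "('m::topological_space, 'n::finite) chart set \<Rightarrow> 'm set \<Rightarrow> 'm vfield \<Rightarrow> bool"
  where "smooth_vfield A U X \<longleftrightarrow>
    (\<forall>p\<in>U. X p \<in> tangent_space A p) \<and>
    (\<forall>V f. open V \<and> V \<subseteq> U \<and> smooth_fun A V f \<longrightarrow> smooth_fun A V (\<lambda>p. X p f))"

definition lie_bracket ::
  "('m::topological_space, 'n::finite) chart set \<Rightarrow> 'm vfield \<Rightarrow> 'm vfield \<Rightarrow> 'm vfield"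
  where "lie_bracket A X Y p f =
    (if smooth_near A p f then X p (\<lambda>q. Y q f) - Y p (\<lambda>q. X q f) else 0)"

definition is_subbundle ::
  "('m::topological_space, 'n::finite) chart set \<Rightarrow> nat \<Rightarrow> ('m \<Rightarrow> 'm tvec set) \<Rightarrow> bool"
  where "is_subbundle A k K \<longleftrightarrow> (\<forall>p\<in>manifold_of A. \<exists>U (Y :: nat \<Rightarrow> 'm vfield).
    open U \<and> p \<in> U \<and> U \<subseteq> manifold_of A \<and> (\<forall>i<k. smooth_vfield A U (Y i)) \<and>
    (\<forall>q\<in>U. K q = {(\<lambda>f. \<Sum>i<k. c i * Y i q f) | c. True} \<and>
      (\<forall>c. (\<forall>f. (\<Sum>i<k. c i * Y i q f) = 0) \<longrightarrow> (\<forall>i<k. c i = 0))))"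

definition local_section ::
  "('m::topological_space, 'n::finite) chart set \<Rightarrow> ('m \<Rightarrow> 'm tvec set) \<Rightarrow> 'm set \<Rightarrow> 'm vfield \<Rightarrow> bool"
  where "local_section A K U X \<longleftrightarrow> smooth_vfield A U X \<and> (\<forall>p\<in>U. X p \<in> K p)"

text \<open>\<open>H w\<close> is meaningful for \<open>1 \<le> w \<le> r\<close> only; \<open>rk w\<close> is its rank.\<close>

definition carnot_manifold ::
  "('m::{t2_space,second_countable_topology}, 'n::finite) chart set \<Rightarrow> nat \<Rightarrow>
    (nat \<Rightarrow> 'm \<Rightarrow> 'm tvec set) \<Rightarrow> (nat \<Rightarrow> nat) \<Rightarrow> bool"
  where "carnot_manifold A r H rk \<longleftrightarrow>
    smooth_atlas A \<and> 1 \<le> r \<and>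
    (\<forall>w\<in>{1..r}. is_subbundle A (rk w) (H w)) \<and>
    (\<forall>w w'. 1 \<le> w \<and> w \<le> w' \<and> w' \<le> r \<longrightarrow> (\<forall>p\<in>manifold_of A. H w p \<subseteq> H w' p)) \<and>
    (\<forall>p\<in>manifold_of A. H r p = tangent_space A p) \<and>
    (\<forall>w w' U X Y. 1 \<le> w \<and> 1 \<le> w' \<and> w + w' \<le> r \<and> open U \<and> U \<subseteq> manifold_of A \<and>
      local_section A (H w) U X \<and> local_section A (H w') U Y \<longrightarrow>
      local_section A (H (w + w')) U (lie_bracket A X Y))"

text \<open>The index type \<open>'n\<close> plays the role of \<open>{1, \<dots>, n}\<close>: the position of \<open>j\<close> is \<open>card {..j}\<close>.\<close>

definition weight :: "nat \<Rightarrow> (nat \<Rightarrow> nat) \<Rightarrow> 'n::{finite,linorder} \<Rightarrow> nat"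
  where "weight r rk j = (LEAST w. w \<in> {1..r} \<and> card {..j} \<le> rk w)"

definition h_frame_near ::
  "('m::topological_space, 'n::{finite,linorder}) chart set \<Rightarrow> nat \<Rightarrow>
    (nat \<Rightarrow> 'm \<Rightarrow> 'm tvec set) \<Rightarrow> (nat \<Rightarrow> nat) \<Rightarrow> 'm \<Rightarrow> ('n \<Rightarrow> 'm vfield) \<Rightarrow> bool"
  where "h_frame_near A r H rk a X \<longleftrightarrow> (\<exists>U. open U \<and> a \<in> U \<and> U \<subseteq> manifold_of A \<and>
    (\<forall>j. local_section A (H (weight r rk j)) U (X j)) \<and>
    (\<forall>p\<in>U. \<forall>v\<in>tangent_space A p. \<exists>!c :: (real, 'n) vec. v = (\<lambda>f. \<Sum>j\<in>UNIV. c $ j * X j p f)))"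

text \<open>\<open>structure_coeff A X p i j $ k\<close> is \<open>L\<^sub>i\<^sub>j\<^sup>k(p)\<close>, where \<open>[X\<^sub>i, X\<^sub>j] = \<Sum>k. L\<^sub>i\<^sub>j\<^sup>k X\<^sub>k\<close>.\<close>

definition structure_coeff ::
  "('m::topological_space, 'n::finite) chart set \<Rightarrow> ('n \<Rightarrow> 'm vfield) \<Rightarrow> 'm \<Rightarrow> 'n \<Rightarrow> 'n \<Rightarrow> real^'n"
  where "structure_coeff A X p i j =
    (THE c. lie_bracket A (X i) (X j) p = (\<lambda>f. \<Sum>k\<in>UNIV. c $ k * X k p f))"

definition dilation :: "('n \<Rightarrow> nat) \<Rightarrow> real \<Rightarrow> real^'n \<Rightarrow> real^'n"
  where "dilation w t x = (\<chi> j. t ^ w j * x $ j)"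

definition dilation_pullback ::
  "('n \<Rightarrow> nat) \<Rightarrow> real \<Rightarrow> (real^'n \<Rightarrow> real^'n) \<Rightarrow> real^'n \<Rightarrow> real^'n"
  where "dilation_pullback w t V x = (\<chi> j. inverse (t ^ w j) * V (dilation w t x) $ j)"

definition pseudo_norm :: "('n::finite \<Rightarrow> nat) \<Rightarrow> (real^'n \<Rightarrow> real) \<Rightarrow> bool"
  where "pseudo_norm w N \<longleftrightarrow> continuous_on UNIV N \<and> (\<forall>x. x \<noteq> 0 \<longrightarrow> 0 < N x) \<and>
    (\<forall>t x. N (dilation w t x) = \<bar>t\<bar> * N x)"

definition weighted_bigo ::
  "('n::finite \<Rightarrow> nat) \<Rightarrow> (real^'n \<Rightarrow> real) \<Rightarrow> nat \<Rightarrow> (real^'n \<Rightarrow> real^'n) \<Rightarrow> bool"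
  where "weighted_bigo w N m \<Theta> \<longleftrightarrow> (\<forall>k. (\<lambda>x. \<Theta> x $ k) \<in> O[nhds 0](\<lambda>x. N x ^ (w k + m)))"

fun frame_word :: "('n \<Rightarrow> 'm vfield) \<Rightarrow> 'n list \<Rightarrow> ('m \<Rightarrow> real) \<Rightarrow> 'm \<Rightarrow> real"
  where
    "frame_word X [] f = f"
  | "frame_word X (i # I) f = (\<lambda>p. X i p (frame_word X I f))"

definition has_order ::
  "('n \<Rightarrow> nat) \<Rightarrow> ('n \<Rightarrow> 'm vfield) \<Rightarrow> 'm \<Rightarrow> ('m \<Rightarrow> real) \<Rightarrow> nat \<Rightarrow> bool"
  where "has_order w X a f N \<longleftrightarrow>
    (\<forall>I. sum_list (map w I) < N \<longrightarrow> frame_word X I f a = 0) \<and>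
    (\<exists>I. sum_list (map w I) = N \<and> frame_word X I f a \<noteq> 0)"

definition linearly_adapted ::
  "('m::topological_space, 'n::finite) chart set \<Rightarrow> ('n \<Rightarrow> 'm vfield) \<Rightarrow> 'm \<Rightarrow> ('m, 'n) chart \<Rightarrow> bool"
  where "linearly_adapted A X a C \<longleftrightarrow> local_coords A C \<and> a \<in> fst C \<and> snd C a = 0 \<and>
    (\<forall>j. X j a = coord_vec A C a (axis j 1))"

definition privileged_coords ::
  "('m::topological_space, 'n::finite) chart set \<Rightarrow> ('n \<Rightarrow> nat) \<Rightarrow> ('n \<Rightarrow> 'm vfield) \<Rightarrow> 'm \<Rightarrow>
    ('m, 'n) chart \<Rightarrow> bool"
  where "privileged_coords A w X a C \<longleftrightarrow> linearly_adapted A X a C \<and>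
    (\<forall>j. has_order w X a (\<lambda>p. snd C p $ j) (w j))"

definition coord_expr :: "('m, 'n) chart \<Rightarrow> 'm vfield \<Rightarrow> real^'n \<Rightarrow> real^'n"
  where "coord_expr = (\<lambda>(U, x) X y. \<chi> k. X (inv_into U x y) (\<lambda>p. x p $ k))"

text \<open>The functions \<open>F t\<close> need not be smooth everywhere: below, \<open>F t\<close> is smooth near a given compact
  set once \<open>t\<close> is small enough.\<close>

definition smooth_convergence ::
  "('a \<Rightarrow> real^'n::finite \<Rightarrow> real^'n) \<Rightarrow> (real^'n \<Rightarrow> real^'n) \<Rightarrow> 'a filter \<Rightarrow> bool"
  where "smooth_convergence F G \<F> \<longleftrightarrow> smooth_on UNIV G \<and>
    (\<forall>K I. compact K \<longrightarrow> uniform_limit K (\<lambda>t. iter_partial I (F t)) (iter_partial I G) \<F>)"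

definition is_model_field ::
  "('m, 'n::finite) chart \<Rightarrow> ('n \<Rightarrow> nat) \<Rightarrow> ('n \<Rightarrow> 'm vfield) \<Rightarrow> 'n \<Rightarrow> (real^'n \<Rightarrow> real^'n) \<Rightarrow> bool"
  where "is_model_field C w X j V \<longleftrightarrow>
    smooth_convergence (\<lambda>t x. t ^ w j *\<^sub>R dilation_pullback w t (coord_expr C (X j)) x) V (at 0)"

definition graded_bracket ::
  "('n::finite \<Rightarrow> nat) \<Rightarrow> ('n \<Rightarrow> 'n \<Rightarrow> real^'n) \<Rightarrow> real^'n \<Rightarrow> real^'n \<Rightarrow> real^'n"
  where "graded_bracket w L u v =
    (\<chi> k. \<Sum>i\<in>UNIV. \<Sum>j\<in>UNIV. if w k = w i + w j then u $ i * v $ j * L i j $ k else 0)"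

text \<open>\<open>nested_bracket b [z\<^sub>1, \<dots>, z\<^sub>m] = [z\<^sub>1, [z\<^sub>2, \<dots> [z\<^sub>m\<^sub>-\<^sub>1, z\<^sub>m] \<dots>]]\<close>\<close>

fun nested_bracket :: "('v::zero \<Rightarrow> 'v \<Rightarrow> 'v) \<Rightarrow> 'v list \<Rightarrow> 'v"
  where
    "nested_bracket b [] = 0"
  | "nested_bracket b [z] = z"
  | "nested_bracket b (z # z' # zs) = b z (nested_bracket b (z' # zs))"

text \<open>Dynkin's formula
  \[ x \cdot y = \sum_{m \ge 1} \frac{(-1)^{m-1}}{m} \sum_{p_i + q_i > 0}
    \frac{[x^{p_1} y^{q_1} \cdots x^{p_m} y^{q_m}]}
      {(\sum_i (p_i + q_i)) \prod_i p_i! q_i!} \]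
  with right-nested brackets. In a Lie algebra that is nilpotent of step \<open>r\<close> the brackets of more
  than \<open>r\<close> elements vanish, so only the indices of total degree at most \<open>r\<close> are summed.\<close>

definition dynkin_degree :: "(nat \<times> nat) list \<Rightarrow> nat"
  where "dynkin_degree ps = sum_list (map (\<lambda>(p, q). p + q) ps)"

definition dynkin_indices :: "nat \<Rightarrow> (nat \<times> nat) list set"
  where "dynkin_indices r =
    {ps. ps \<noteq> [] \<and> (\<forall>(p, q)\<in>set ps. 0 < p + q) \<and> dynkin_degree ps \<le> r}"

definition dynkin_product ::
  "nat \<Rightarrow> ('v::real_vector \<Rightarrow> 'v \<Rightarrow> 'v) \<Rightarrow> 'v \<Rightarrow> 'v \<Rightarrow> 'v"
  where "dynkin_product r b x y = (\<Sum>ps\<in>dynkin_indices r.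
    ((-1) ^ (length ps - 1) / (real (length ps) * real (dynkin_degree ps) *
        prod_list (map (\<lambda>(p, q). fact p * fact q) ps))) *\<^sub>R
      nested_bracket b (concat (map (\<lambda>(p, q). replicate p x @ replicate q y) ps)))"

lemma finite_dynkin_indices: "finite (dynkin_indices r)"
proof -
  have "set ps \<subseteq> {..r} \<times> {..r} \<and> length ps \<le> r"
    if "\<forall>(p, q)\<in>set ps. 0 < p + q" "dynkin_degree ps \<le> r" for ps
    using that
  proof (induction ps arbitrary: r)
    case (Cons pq ps)
    obtain p q where [simp]: "pq = (p, q)" by (cases pq)
    have "dynkin_degree ps \<le> r - (p + q)" "0 < p + q" "p + q \<le> r"
      using Cons.prems by (auto simp: dynkin_degree_def)
    moreover have "set ps \<subseteq> {..r - (p + q)} \<times> {..r - (p + q)} \<and> length ps \<le> r - (p + q)"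
      using Cons.prems calculation by (intro Cons.IH) auto
    moreover have "{..r - (p + q)} \<subseteq> {..r}" by auto
    ultimately show ?case by auto
  qed simp
  then have "dynkin_indices r \<subseteq> {ps. set ps \<subseteq> {..r} \<times> {..r} \<and> length ps \<le> r}"
    by (auto simp: dynkin_indices_def)
  then show ?thesis
    by (rule finite_subset) (simp add: finite_lists_length_le)
qed

definition tangent_group_mult ::
  "('m::topological_space, 'n::finite) chart set \<Rightarrow> nat \<Rightarrow> ('n \<Rightarrow> nat) \<Rightarrow> ('n \<Rightarrow> 'm vfield) \<Rightarrow> 'm \<Rightarrow>
    real^'n \<Rightarrow> real^'n \<Rightarrow> real^'n"
  where "tangent_group_mult A r w X a =
    dynkin_product r (graded_bracket w (structure_coeff A X a))"

definition left_invariant ::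
  "(real^'n::finite \<Rightarrow> real^'n \<Rightarrow> real^'n) \<Rightarrow> (real^'n \<Rightarrow> real^'n) \<Rightarrow> bool"
  where "left_invariant pr V \<longleftrightarrow> smooth_on UNIV V \<and>
    (\<forall>x y. V (pr x y) = frechet_derivative (pr x) (at y) (V y))"

text \<open>A left-invariant vector field is determined by its value at \<open>0\<close>, so the field \<open>V\<close> below is
  the vector field \<open>X\<^sub>j\<^sup>a\<close> on \<open>G(a)\<close>.\<close>

definition carnot_coords ::
  "('m::topological_space, 'n::finite) chart set \<Rightarrow> nat \<Rightarrow> ('n \<Rightarrow> nat) \<Rightarrow> ('n \<Rightarrow> 'm vfield) \<Rightarrow> 'm \<Rightarrow>
    ('m, 'n) chart \<Rightarrow> bool"
  where "carnot_coords A r w X a C \<longleftrightarrow> privileged_coords A w X a C \<and>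
    (\<forall>j. \<exists>V. left_invariant (tangent_group_mult A r w X a) V \<and> V 0 = axis j 1 \<and>
      is_model_field C w X j V)"

end

theory Submission
  imports Defs
begin

text \<open>A function smooth near \<open>0\<close> is \<open>O(\<parallel>x\<parallel>\<^sup>m)\<close> iff its partial derivatives of weighted order less than
  \<open>m\<close> vanish at \<open>0\<close>, and this is equivalent to the vanishing at \<open>a\<close> of its derivatives \<open>X\<^sub>I f\<close> with
  \<open>\<langle>I\<rangle> < m\<close>, because existence of the model fields bounds the weighted order of the coefficients of
  \<open>X\<^sub>j\<close> from below. Two coordinate expressions \<open>B\<^sub>j\<close> and \<open>B'\<^sub>j\<close> of \<open>X\<^sub>j\<close> have the same model field iff
  \<open>B'\<^sub>j\<^sub>k - B\<^sub>j\<^sub>k = O(\<parallel>x\<parallel>\<^sup>m)\<close> with \<open>m = w\<^sub>k - w\<^sub>j + 1\<close>. Writing \<open>\<phi> = id + \<theta>\<close>, the two expressions are related by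
  \<open>B'\<^sub>j\<^sub>k \<circ> \<phi> - B\<^sub>j\<^sub>k = X\<^sub>j \<theta>\<^sub>k\<close>. Hence a perturbation \<open>\<theta>\<close> of higher order preserves the model fields, and
  conversely equality of the model fields forces \<open>\<theta>\<^sub>k\<close> to have order at least \<open>w\<^sub>k + 1\<close>, by induction on \<open>w\<^sub>k\<close>. Of the
  group \<open>G(a)\<close> one only needs \<open>x \<cdot> 0 = x\<close>, which makes a left-invariant field unique given its value at
  \<open>0\<close>.\<close>

section \<open>Smooth functions and iterated partial derivatives\<close>

text \<open>Dilations fix 0, so at the origin every iterated derivative of a dilated field is a
  constant times a single power of t. Convergence to the model field therefore decides one Taylor
  coefficient at a time, and no polynomial model is ever written down. The main obstacle is that
  equality of model fields compares \<open>B\<close> and \<open>B'\<close> at the same point,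
  whereas the transformation law evaluates \<open>B'\<close> at \<open>\<phi> x\<close> and
  \<open>B\<close> at x. The shift of \<open>B\<close> from x to \<open>\<phi> x\<close> depends on
  the unknown \<theta> itself. The circle is broken because, for a function of weighted order m, the
  components of \<theta> of weight above m are already too small to matter. Going from \<theta> back
  to the model fields needs in addition a bound of \<open>rho\<close> at x by \<open>rho\<close> at
  \<open>\<phi> x\<close>, so that an estimate in x becomes one in \<open>\<phi> x\<close>.\<close>

lemma iter_partial_append: "iter_partial (I @ J) f = iter_partial I (iter_partial J f)"
  by (induction I) auto

lemma partial_deriv_cong:
  fixes f g :: "real^'n \<Rightarrow> 'b::real_normed_vector"
  assumes "open S" "x \<in> S" "\<And>y. y \<in> S \<Longrightarrow> f y = g y"
  shows "partial_deriv i f x = partial_deriv i g x"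
proof -
  have "(f has_derivative f') (at x) \<longleftrightarrow> (g has_derivative f') (at x)" for f'
    using assms by (metis has_derivative_transform_within_open)
  then show ?thesis by (simp add: partial_deriv_def frechet_derivative_def)
qed

lemma iter_partial_cong:
  fixes f g :: "real^'n \<Rightarrow> 'b::real_normed_vector"
  assumes "open S" "x \<in> S" "\<And>y. y \<in> S \<Longrightarrow> f y = g y"
  shows "iter_partial I f x = iter_partial I g x"
  using assms(2)
proof (induction I arbitrary: x)
  case (Cons i I)
  then show ?case using partial_deriv_cong[OF assms(1) Cons.prems Cons.IH] by simp
qed (use assms in auto)

lemma differentiable_cong_open:
  fixes f g :: "real^'n \<Rightarrow> 'b::real_normed_vector"
  assumes "open S" "x \<in> S" "\<And>y. y \<in> S \<Longrightarrow> f y = g y" "f differentiable (at x)"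
  shows "g differentiable (at x)"
  using assms unfolding differentiable_def by (metis has_derivative_transform_within_open)

lemma smooth_on_cong:
  fixes f g :: "real^'n \<Rightarrow> 'b::real_normed_vector"
  assumes "open S" "\<And>y. y \<in> S \<Longrightarrow> f y = g y" "smooth_on S f"
  shows "smooth_on S g"
  unfolding smooth_on_def
proof (intro allI ballI)
  fix I x assume x: "x \<in> S"
  have "iter_partial I f differentiable (at x)" using assms(3) x by (simp add: smooth_on_def)
  then show "iter_partial I g differentiable (at x)"
    by (rule differentiable_cong_open[OF assms(1) x, rotated])
      (rule iter_partial_cong[OF assms(1) _ assms(2)])
qed

lemma smooth_on_subset: "smooth_on S f \<Longrightarrow> T \<subseteq> S \<Longrightarrow> smooth_on T f"
  by (auto simp: smooth_on_def)

lemma smooth_on_differentiable: "smooth_on S f \<Longrightarrow> x \<in> S \<Longrightarrow> f differentiable (at x)"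
  unfolding smooth_on_def by (metis iter_partial.simps(1))

lemma smooth_on_iter_partial: "smooth_on S f \<Longrightarrow> smooth_on S (iter_partial J f)"
  unfolding smooth_on_def by (metis iter_partial_append)

lemma smooth_on_partial: "smooth_on S f \<Longrightarrow> smooth_on S (partial_deriv i f)"
  using smooth_on_iter_partial[of S f "[i]"] by simp

lemma smooth_on_continuous: "smooth_on S f \<Longrightarrow> continuous_on S f"
  by (meson continuous_at_imp_continuous_on differentiable_imp_continuous_within
      smooth_on_differentiable)

lemma smooth_on_local:
  assumes "\<And>x. x \<in> S \<Longrightarrow> \<exists>T. x \<in> T \<and> smooth_on T f"
  shows "smooth_on S f"
  using assms unfolding smooth_on_def by blast

section \<open>Smoothness by finite orders: closure under sums, products and composition\<close>

definition diff_upto :: "nat \<Rightarrow> (real^'n) set \<Rightarrow> (real^'n \<Rightarrow> 'b::real_normed_vector) \<Rightarrow> bool"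
  where "diff_upto d S f \<longleftrightarrow> (\<forall>I. length I \<le> d \<longrightarrow> (\<forall>x\<in>S. iter_partial I f differentiable (at x)))"

lemma smooth_on_iff_diff_upto: "smooth_on S f \<longleftrightarrow> (\<forall>d. diff_upto d S f)"
  unfolding smooth_on_def diff_upto_def by blast

lemma diff_upto_0: "diff_upto 0 S f \<longleftrightarrow> (\<forall>x\<in>S. f differentiable (at x))"
  by (simp add: diff_upto_def)

text \<open>A derivative of a product or a composite is a sum of products of the same kind, one
  order lower; the closure lemmas therefore need an order to induct on. The derivative split off
  here is the one taken first, which is the last letter of the word.\<close>

lemma diff_upto_Suc:
  "diff_upto (Suc d) S f \<longleftrightarrow>
    (\<forall>x\<in>S. f differentiable (at x)) \<and> (\<forall>i. diff_upto d S (partial_deriv i f))"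
proof
  assume L: "diff_upto (Suc d) S f"
  show "(\<forall>x\<in>S. f differentiable (at x)) \<and> (\<forall>i. diff_upto d S (partial_deriv i f))"
  proof (intro conjI allI)
    show "\<forall>x\<in>S. f differentiable (at x)"
      using L unfolding diff_upto_def by (metis iter_partial.simps(1) le0 list.size(3))
    fix i
    have "iter_partial I (partial_deriv i f) = iter_partial (I @ [i]) f" for I
      by (simp add: iter_partial_append)
    then show "diff_upto d S (partial_deriv i f)" using L unfolding diff_upto_def by simp
  qed
next
  assume R: "(\<forall>x\<in>S. f differentiable (at x)) \<and> (\<forall>i. diff_upto d S (partial_deriv i f))"
  show "diff_upto (Suc d) S f" unfolding diff_upto_def
  proof (intro allI impI)
    fix I :: "'a list" assume "length I \<le> Suc d"
    then show "\<forall>x\<in>S. iter_partial I f differentiable (at x)"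
    proof (cases I rule: rev_cases)
      case (snoc J i)
      then show ?thesis using R \<open>length I \<le> Suc d\<close>
        by (auto simp: iter_partial_append diff_upto_def)
    qed (use R in simp)
  qed
qed

lemma diff_upto_mono: "diff_upto d S f \<Longrightarrow> e \<le> d \<Longrightarrow> diff_upto e S f"
  unfolding diff_upto_def by auto

lemma diff_upto_cong:
  fixes f g :: "real^'n \<Rightarrow> 'b::real_normed_vector"
  assumes "open S" "\<And>y. y \<in> S \<Longrightarrow> f y = g y" "diff_upto d S f"
  shows "diff_upto d S g"
  unfolding diff_upto_def
proof (intro allI ballI impI)
  fix I :: "'n list" and x assume x: "x \<in> S" "length I \<le> d"
  have "iter_partial I f differentiable (at x)" using assms(3) x by (simp add: diff_upto_def)
  then show "iter_partial I g differentiable (at x)"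
    by (rule differentiable_cong_open[OF assms(1) x(1), rotated])
      (rule iter_partial_cong[OF assms(1) _ assms(2)])
qed

lemma partial_deriv_bounded_linear:
  assumes "bounded_linear h" "f differentiable (at x)"
  shows "partial_deriv i (\<lambda>x. h (f x)) x = h (partial_deriv i f x)"
proof -
  have "(f has_derivative frechet_derivative f (at x)) (at x)"
    using assms(2) frechet_derivative_works by blast
  from bounded_linear.has_derivative[OF assms(1) this]
  show ?thesis unfolding partial_deriv_def by (metis frechet_derivative_at)
qed

lemma partial_deriv_add:
  assumes "f differentiable (at x)" "g differentiable (at x)"
  shows "partial_deriv i (\<lambda>x. f x + g x) x = partial_deriv i f x + partial_deriv i g x"
proof -
  have "((\<lambda>x. f x + g x) has_derivative
      (\<lambda>v. frechet_derivative f (at x) v + frechet_derivative g (at x) v)) (at x)"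
    using assms by (intro has_derivative_add) (simp_all add: frechet_derivative_works[symmetric])
  from frechet_derivative_at[OF this, symmetric] show ?thesis by (simp add: partial_deriv_def)
qed

lemma partial_deriv_scaleR:
  fixes f :: "real^'n \<Rightarrow> real" and g :: "real^'n \<Rightarrow> 'b::real_normed_vector"
  assumes "f differentiable (at x)" "g differentiable (at x)"
  shows "partial_deriv i (\<lambda>x. f x *\<^sub>R g x) x =
    partial_deriv i f x *\<^sub>R g x + f x *\<^sub>R partial_deriv i g x"
proof -
  have "((\<lambda>x. f x *\<^sub>R g x) has_derivative
      (\<lambda>v. f x *\<^sub>R frechet_derivative g (at x) v + frechet_derivative f (at x) v *\<^sub>R g x)) (at x)"
    using assms by (intro has_derivative_scaleR) (simp_all add: frechet_derivative_works[symmetric])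
  from frechet_derivative_at[OF this, symmetric] show ?thesis
    by (simp add: partial_deriv_def add.commute)
qed

lemma axis_expansion: "(\<Sum>k\<in>UNIV. (v $ k) *\<^sub>R axis k 1) = (v :: real^'n)"
  using basis_expansion[of v] by (simp add: scalar_mult_eq_scaleR)

lemma linear_axis_expansion:
  fixes h :: "real^'n \<Rightarrow> 'b::real_vector"
  assumes "linear h"
  shows "h v = (\<Sum>k\<in>UNIV. (v $ k) *\<^sub>R h (axis k 1))"
proof -
  have "h v = h (\<Sum>k\<in>UNIV. (v $ k) *\<^sub>R axis k 1)" by (simp add: axis_expansion)
  also have "\<dots> = (\<Sum>k\<in>UNIV. (v $ k) *\<^sub>R h (axis k 1))"
    by (simp add: linear_sum[OF assms] linear_scale[OF assms])
  finally show ?thesis .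
qed

lemma frechet_derivative_partials:
  fixes f :: "real^'n \<Rightarrow> 'b::real_normed_vector"
  assumes "f differentiable (at x)"
  shows "frechet_derivative f (at x) v = (\<Sum>k\<in>UNIV. (v $ k) *\<^sub>R partial_deriv k f x)"
  unfolding partial_deriv_def
  using linear_axis_expansion[OF linear_frechet_derivative[OF assms], of v] .

lemma partial_deriv_compose:
  fixes f :: "real^'m \<Rightarrow> 'b::real_normed_vector" and g :: "real^'n \<Rightarrow> real^'m"
  assumes "f differentiable (at (g x))" "g differentiable (at x)"
  shows "partial_deriv i (\<lambda>x. f (g x)) x =
    (\<Sum>k\<in>UNIV. partial_deriv i (\<lambda>x. g x $ k) x *\<^sub>R partial_deriv k f (g x))"
proof -
  have "((\<lambda>x. f (g x)) has_derivative
      (\<lambda>v. frechet_derivative f (at (g x)) (frechet_derivative g (at x) v))) (at x)"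
    using assms by (intro has_derivative_compose[of g _ x UNIV f])
      (simp_all add: frechet_derivative_works[symmetric])
  from frechet_derivative_at[OF this]
  have "partial_deriv i (\<lambda>x. f (g x)) x =
      frechet_derivative f (at (g x)) (partial_deriv i g x)"
    unfolding partial_deriv_def by metis
  also have "\<dots> = (\<Sum>k\<in>UNIV. partial_deriv i g x $ k *\<^sub>R partial_deriv k f (g x))"
    by (rule frechet_derivative_partials[OF assms(1)])
  finally show ?thesis
    using partial_deriv_bounded_linear[OF bounded_linear_vec_nth assms(2)] by simp
qed

lemma diff_upto_add:
  assumes "open S" "diff_upto d S f" "diff_upto d S g"
  shows "diff_upto d S (\<lambda>x. f x + g x)"
  using assms(2,3)
proof (induction d arbitrary: f g)
  case 0 then show ?case by (auto simp: diff_upto_0)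
next
  case (Suc d)
  have "diff_upto d S (partial_deriv i (\<lambda>x. f x + g x))" for i
  proof (rule diff_upto_cong[OF assms(1)])
    show "diff_upto d S (\<lambda>x. partial_deriv i f x + partial_deriv i g x)"
      using Suc by (auto simp: diff_upto_Suc)
  qed (use Suc.prems in \<open>auto simp: diff_upto_Suc partial_deriv_add\<close>)
  then show ?case using Suc.prems by (auto simp: diff_upto_Suc)
qed

lemma diff_upto_scaleR:
  fixes f :: "real^'n \<Rightarrow> real" and g :: "real^'n \<Rightarrow> 'b::real_normed_vector"
  assumes "open S" "diff_upto d S f" "diff_upto d S g"
  shows "diff_upto d S (\<lambda>x. f x *\<^sub>R g x)"
  using assms(2,3)
proof (induction d arbitrary: f g)
  case 0 then show ?case by (auto simp: diff_upto_0)
next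
  case (Suc d)
  have fg: "diff_upto d S f" "diff_upto d S g"
    using Suc.prems by (auto intro: diff_upto_mono)
  have "diff_upto d S (partial_deriv i (\<lambda>x. f x *\<^sub>R g x))" for i
  proof (rule diff_upto_cong[OF assms(1)])
    show "diff_upto d S (\<lambda>x. partial_deriv i f x *\<^sub>R g x + f x *\<^sub>R partial_deriv i g x)"
      using Suc fg by (auto simp: diff_upto_Suc intro!: diff_upto_add assms(1) Suc.IH)
  qed (use Suc.prems in \<open>auto simp: diff_upto_Suc partial_deriv_scaleR\<close>)
  then show ?case using Suc.prems by (auto simp: diff_upto_Suc)
qed

lemma partial_deriv_const [simp]: "partial_deriv i (\<lambda>x. c) = (\<lambda>x. 0)"
  by (simp add: partial_deriv_def fun_eq_iff frechet_derivative_const)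

lemma smooth_on_const: "smooth_on S (\<lambda>x. c)"
proof -
  have "diff_upto d S (\<lambda>x. c)" for d and c :: 'b
    by (induction d arbitrary: c) (auto simp: diff_upto_0 diff_upto_Suc)
  then show ?thesis by (simp add: smooth_on_iff_diff_upto)
qed

lemma smooth_on_add:
  "open S \<Longrightarrow> smooth_on S f \<Longrightarrow> smooth_on S g \<Longrightarrow> smooth_on S (\<lambda>x. f x + g x)"
  by (simp add: smooth_on_iff_diff_upto diff_upto_add)

lemma smooth_on_scaleR:
  fixes f :: "real^'n \<Rightarrow> real"
  shows "open S \<Longrightarrow> smooth_on S f \<Longrightarrow> smooth_on S g \<Longrightarrow> smooth_on S (\<lambda>x. f x *\<^sub>R g x)"
  by (simp add: smooth_on_iff_diff_upto diff_upto_scaleR)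

lemma smooth_on_mult:
  fixes f :: "real^'n \<Rightarrow> real"
  shows "open S \<Longrightarrow> smooth_on S f \<Longrightarrow> smooth_on S g \<Longrightarrow> smooth_on S (\<lambda>x. f x * g x)"
  using smooth_on_scaleR[of S f g] by simp

lemma smooth_on_diff:
  fixes f g :: "real^'n \<Rightarrow> 'b::real_normed_vector"
  assumes "open S" "smooth_on S f" "smooth_on S g"
  shows "smooth_on S (\<lambda>x. f x - g x)"
  using smooth_on_add[OF assms(1,2) smooth_on_scaleR[OF assms(1) smooth_on_const[of S "-1"] assms(3)]]
  by simp

lemma smooth_on_sum:
  assumes "open S" "\<And>i. i \<in> T \<Longrightarrow> smooth_on S (f i)"
  shows "smooth_on S (\<lambda>x. \<Sum>i\<in>T. f i x)"
  using assms(2)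
  by (induction T rule: infinite_finite_induct) (auto simp: smooth_on_const intro: smooth_on_add assms(1))

lemma smooth_on_bounded_linear:
  fixes f :: "real^'n \<Rightarrow> 'b::real_normed_vector"
  assumes "open S" "bounded_linear h" "smooth_on S f"
  shows "smooth_on S (\<lambda>x. h (f x))"
    and "x \<in> S \<Longrightarrow> iter_partial I (\<lambda>x. h (f x)) x = h (iter_partial I f x)"
proof -
  have eq: "iter_partial I (\<lambda>x. h (f x)) x = h (iter_partial I f x)" if "x \<in> S" for x I
    using that
  proof (induction I arbitrary: x)
    case (Cons i I)
    have "iter_partial (i # I) (\<lambda>x. h (f x)) x = partial_deriv i (\<lambda>x. h (iter_partial I f x)) x"
      using partial_deriv_cong[OF assms(1) Cons.prems Cons.IH] by simp
    also have "\<dots> = h (iter_partial (i # I) f x)"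
      using assms(3) Cons.prems
      by (simp add: partial_deriv_bounded_linear[OF assms(2)] smooth_on_def)
    finally show ?case .
  qed simp
  then show "x \<in> S \<Longrightarrow> iter_partial I (\<lambda>x. h (f x)) x = h (iter_partial I f x)" by blast
  show "smooth_on S (\<lambda>x. h (f x))" unfolding smooth_on_def
  proof (intro allI ballI)
    fix I x assume x: "x \<in> S"
    have "(\<lambda>x. h (iter_partial I f x)) differentiable (at x)"
      using assms(3) x bounded_linear.has_derivative[OF assms(2)]
      unfolding smooth_on_def differentiable_def by blast
    then show "iter_partial I (\<lambda>x. h (f x)) differentiable (at x)"
      by (rule differentiable_cong_open[OF assms(1) x, rotated]) (simp add: eq)
  qed
qed

lemmas smooth_on_component = smooth_on_bounded_linear(1)[OF _ bounded_linear_vec_nth]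
  and iter_partial_component = smooth_on_bounded_linear(2)[OF _ bounded_linear_vec_nth]

lemma smooth_on_vec:
  fixes f :: "real^'n \<Rightarrow> real^'m"
  assumes "open S" "\<And>k. smooth_on S (\<lambda>x. f x $ k)"
  shows "smooth_on S f"
proof -
  have "smooth_on S (\<lambda>x. \<Sum>k\<in>UNIV. (f x $ k) *\<^sub>R axis k 1 :: real^'m)"
    by (intro smooth_on_sum smooth_on_scaleR assms smooth_on_const)
  then show ?thesis by (simp add: axis_expansion)
qed

lemma differentiable_compose_at:
  assumes "f differentiable (at (g x))" "g differentiable (at x)"
  shows "(\<lambda>x. f (g x)) differentiable (at x)"
  using differentiable_chain_at[OF assms(2,1)] by (simp add: o_def)

text \<open>The chain rule gives products of derivatives of \<open>g\<close>, which are smooth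
  outright, with \<open>partial_deriv k f\<close> composed with \<open>g\<close>, one order lower.
  Only the order of \<open>f\<close> is counted, so the induction generalises over \<open>f\<close>
  alone.\<close>

lemma diff_upto_compose:
  fixes f :: "real^'m \<Rightarrow> 'b::real_normed_vector" and g :: "real^'n \<Rightarrow> real^'m"
  assumes "open S" "open T" "g ` S \<subseteq> T" "diff_upto d T f" "smooth_on S g"
  shows "diff_upto d S (\<lambda>x. f (g x))"
  using assms(4)
proof (induction d arbitrary: f)
  case 0
  then show ?case using assms(3) smooth_on_differentiable[OF assms(5)]
    by (simp add: diff_upto_0 image_subset_iff differentiable_compose_at[of f g])
next
  case (Suc d)
  have df: "f differentiable at (g x)" if "x \<in> S" for x
    using Suc.prems assms(3) that by (auto simp: diff_upto_Suc image_subset_iff)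
  have dg: "g differentiable at x" if "x \<in> S" for x
    using smooth_on_differentiable[OF assms(5)] that .
  have "diff_upto d S (partial_deriv i (\<lambda>x. f (g x)))" for i
  proof (rule diff_upto_cong[OF assms(1)])
    have *: "diff_upto d S (\<lambda>x. \<Sum>k\<in>K. partial_deriv i (\<lambda>x. g x $ k) x *\<^sub>R partial_deriv k f (g x))"
      for K
    proof (induction K rule: infinite_finite_induct)
      case (insert k K)
      have "diff_upto d S (\<lambda>x. partial_deriv i (\<lambda>x. g x $ k) x *\<^sub>R partial_deriv k f (g x))"
      proof (rule diff_upto_scaleR[OF assms(1)])
        show "diff_upto d S (partial_deriv i (\<lambda>x. g x $ k))"
          using smooth_on_partial[OF smooth_on_component[OF assms(1,5)]]
          by (auto simp: smooth_on_iff_diff_upto)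
        show "diff_upto d S (\<lambda>x. partial_deriv k f (g x))"
          using Suc by (auto simp: diff_upto_Suc)
      qed
      then show ?case using insert by (simp add: diff_upto_add[OF assms(1)])
    qed (use smooth_on_const[of S 0] in \<open>auto simp: smooth_on_iff_diff_upto\<close>)
    show "diff_upto d S (\<lambda>x. \<Sum>k\<in>UNIV. partial_deriv i (\<lambda>x. g x $ k) x *\<^sub>R partial_deriv k f (g x))"
      by (rule *)
  qed (use df dg in \<open>simp add: partial_deriv_compose[of f g]\<close>)
  moreover have "\<forall>x\<in>S. (\<lambda>x. f (g x)) differentiable at x"
    using df dg by (simp add: differentiable_compose_at[of f g])
  ultimately show ?case by (simp add: diff_upto_Suc)
qed

lemma smooth_on_compose:
  fixes f :: "real^'m \<Rightarrow> 'b::real_normed_vector" and g :: "real^'n \<Rightarrow> real^'m"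
  assumes "open S" "open T" "g ` S \<subseteq> T" "smooth_on T f" "smooth_on S g"
  shows "smooth_on S (\<lambda>x. f (g x))"
  using assms by (auto simp: smooth_on_iff_diff_upto[of _ f] smooth_on_iff_diff_upto[of _ "\<lambda>x. f (g x)"]
      intro: diff_upto_compose)

section \<open>Iterated derivatives of sums and products, and the mean value theorem\<close>

lemma iter_partial_add:
  assumes "open S" "smooth_on S f" "smooth_on S g" "x \<in> S"
  shows "iter_partial I (\<lambda>x. f x + g x) x = iter_partial I f x + iter_partial I g x"
  using assms(4)
proof (induction I arbitrary: x)
  case (Cons i I)
  have "iter_partial (i # I) (\<lambda>x. f x + g x) x =
      partial_deriv i (\<lambda>x. iter_partial I f x + iter_partial I g x) x"
    using partial_deriv_cong[OF assms(1) Cons.prems Cons.IH] by simp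
  then show ?case using assms Cons.prems by (simp add: smooth_on_def partial_deriv_add)
qed simp

lemma iter_partial_diff:
  fixes f g :: "real^'n \<Rightarrow> 'b::real_normed_vector"
  assumes "open S" "smooth_on S f" "smooth_on S g" "x \<in> S"
  shows "iter_partial I (\<lambda>x. f x - g x) x = iter_partial I f x - iter_partial I g x"
proof -
  have s: "smooth_on S (\<lambda>x. - g x)"
    and e: "iter_partial I (\<lambda>x. - g x) x = - iter_partial I g x"
    using smooth_on_bounded_linear[OF assms(1) bounded_linear_minus[OF bounded_linear_ident] assms(3)]
      assms(4) by auto
  show ?thesis using iter_partial_add[OF assms(1,2) s assms(4)] e by simp
qed

lemma iter_partial_const_mult:
  fixes f :: "real^'n \<Rightarrow> real"
  assumes "open S" "smooth_on S f" "x \<in> S"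
  shows "iter_partial I (\<lambda>x. c * f x) x = c * iter_partial I f x"
  using smooth_on_bounded_linear(2)[OF assms(1) bounded_linear_mult_right assms(2,3)] .

lemma iter_partial_zero [simp]: "iter_partial I (\<lambda>x. 0) = (\<lambda>x. 0)"
  by (induction I) auto

lemma smooth_on_ident: "smooth_on S (\<lambda>x :: real^'n. x)"
proof -
  have d: "partial_deriv i (\<lambda>x :: real^'n. x) = (\<lambda>x. axis i 1)" for i
    by (simp add: partial_deriv_def fun_eq_iff)
  have "diff_upto d S (\<lambda>x :: real^'n. x)" for d
    using smooth_on_const by (cases d) (auto simp: diff_upto_0 diff_upto_Suc d smooth_on_iff_diff_upto)
  then show ?thesis by (simp add: smooth_on_iff_diff_upto)
qed

lemma smooth_on_coord: "smooth_on S (\<lambda>x. x $ k)"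
  using smooth_on_component[OF open_UNIV smooth_on_ident] smooth_on_subset by blast

lemma partial_deriv_coord: "partial_deriv i (\<lambda>x. x $ k) x = (if i = k then 1 else 0)"
proof -
  have "partial_deriv i (\<lambda>x. x $ k) x = axis i 1 $ k"
    unfolding partial_deriv_def
    by (metis bounded_linear_imp_has_derivative bounded_linear_vec_nth frechet_derivative_at)
  then show ?thesis by (auto simp: axis_def)
qed

text \<open>The Leibniz rule reduced to what vanishing arguments use: some distribution of the
  letters between the factors must contribute, whatever its coefficient. Multisets suffice because
  weight and length do not see the order of the letters.\<close>

lemma iter_partial_mult_nonzero:
  fixes f g :: "real^'n \<Rightarrow> real"
  assumes "open S" "x \<in> S"
  shows "smooth_on S f \<Longrightarrow> smooth_on S g \<Longrightarrow> iter_partial I (\<lambda>x. f x * g x) x \<noteq> 0 \<Longrightarrow>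
    \<exists>J K. mset I = mset J + mset K \<and> iter_partial J f x \<noteq> 0 \<and> iter_partial K g x \<noteq> 0"
proof (induction I arbitrary: f g rule: rev_induct)
  case Nil then show ?case by (intro exI[of _ "[]"]) auto
next
  case (snoc i I)
  note s = smooth_on_partial[OF snoc.prems(1), of i] smooth_on_partial[OF snoc.prems(2), of i]
  have "iter_partial (I @ [i]) (\<lambda>x. f x * g x) x =
      iter_partial I (\<lambda>x. partial_deriv i f x * g x + f x * partial_deriv i g x) x"
    unfolding iter_partial_append iter_partial.simps
  proof (rule iter_partial_cong[OF assms])
    fix y assume "y \<in> S"
    then show "partial_deriv i (\<lambda>x. f x * g x) y = partial_deriv i f y * g y + f y * partial_deriv i g y"
      using partial_deriv_scaleR[of f y g i] snoc.prems(1,2) by (simp add: smooth_on_differentiable)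
  qed
  also have "\<dots> = iter_partial I (\<lambda>x. partial_deriv i f x * g x) x +
      iter_partial I (\<lambda>x. f x * partial_deriv i g x) x"
    by (intro iter_partial_add[OF assms(1)] smooth_on_mult assms s snoc.prems)
  finally consider "iter_partial I (\<lambda>x. partial_deriv i f x * g x) x \<noteq> 0"
    | "iter_partial I (\<lambda>x. f x * partial_deriv i g x) x \<noteq> 0" using snoc.prems(3) by fastforce
  then show ?case
  proof cases
    case 1
    from snoc.IH[OF s(1) snoc.prems(2) 1] obtain J K where "mset I = mset J + mset K"
      "iter_partial (J @ [i]) f x \<noteq> 0" "iter_partial K g x \<noteq> 0"
      by (auto simp: iter_partial_append)
    then show ?thesis by (intro exI[of _ "J @ [i]"] exI[of _ K]) auto
  next
    case 2
    from snoc.IH[OF snoc.prems(1) s(2) 2] obtain J K where "mset I = mset J + mset K"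
      "iter_partial J f x \<noteq> 0" "iter_partial (K @ [i]) g x \<noteq> 0"
      by (auto simp: iter_partial_append)
    then show ?thesis by (intro exI[of _ J] exI[of _ "K @ [i]"]) auto
  qed
qed

text \<open>The one-variable mean value theorem along a segment, split into partial derivatives so
  that each direction can later receive its own weight.\<close>

lemma mvt_partials:
  fixes f :: "real^'n \<Rightarrow> real"
  assumes "\<And>s. 0 \<le> s \<Longrightarrow> s \<le> 1 \<Longrightarrow> f differentiable (at (x + s *\<^sub>R v))"
  obtains s where "0 < s" "s < 1"
    "f (x + v) - f x = (\<Sum>k\<in>UNIV. v $ k * partial_deriv k f (x + s *\<^sub>R v))"
proof -
  have "((\<lambda>s. f (x + s *\<^sub>R v)) has_derivative
      (\<lambda>h. frechet_derivative f (at (x + s *\<^sub>R v)) (h *\<^sub>R v))) (at s)" if "0 \<le> s" "s \<le> 1" for s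
  proof -
    have "((\<lambda>s. x + s *\<^sub>R v) has_derivative (\<lambda>h. h *\<^sub>R v)) (at s)"
      by (auto intro!: derivative_eq_intros)
    from has_derivative_compose[OF this] show ?thesis
      using assms[OF that] frechet_derivative_works by blast
  qed
  note D = this
  have "DERIV (\<lambda>s. f (x + s *\<^sub>R v)) s :> frechet_derivative f (at (x + s *\<^sub>R v)) v"
    if "0 \<le> s" "s \<le> 1" for s
    using D[OF that] linear_scale[OF linear_frechet_derivative[OF assms[OF that]]]
    by (simp add: has_field_derivative_def mult_commute_abs)
  from MVT2[OF zero_less_one this] obtain s where "0 < s" "s < 1"
    "f (x + v) - f x = frechet_derivative f (at (x + s *\<^sub>R v)) v" by auto
  moreover have "f differentiable (at (x + s *\<^sub>R v))" using assms calculation by simp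
  ultimately show ?thesis using that frechet_derivative_partials by force
qed

section \<open>Weighted order of vanishing\<close>

abbreviation wt :: "('n \<Rightarrow> nat) \<Rightarrow> 'n list \<Rightarrow> nat"
  where "wt w I \<equiv> sum_list (map w I)"

text \<open>The standard pseudo-norm, the sum of the |x_k|^(1/w_k). It can be estimated coordinate
  by coordinate, unlike a general pseudo-norm; \<open>pseudo_norm_equiv\<close> transfers the
  results to any other.\<close>

definition rho :: "('n::finite \<Rightarrow> nat) \<Rightarrow> real^'n \<Rightarrow> real"
  where "rho w x = (\<Sum>k\<in>UNIV. root (w k) \<bar>x $ k\<bar>)"

text \<open>The threshold is an integer because the coefficients of the frame receive
  \<open>w k - w j\<close>, which may be negative; the condition is then empty.\<close>

definition vanishes :: "('n \<Rightarrow> nat) \<Rightarrow> (real^'n \<Rightarrow> real) \<Rightarrow> int \<Rightarrow> bool"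
  where "vanishes w f m \<longleftrightarrow> (\<forall>I. int (wt w I) < m \<longrightarrow> iter_partial I f 0 = 0)"

lemma vanishes_mono: "vanishes w f m \<Longrightarrow> m' \<le> m \<Longrightarrow> vanishes w f m'"
  by (auto simp: vanishes_def)

lemma vanishes_partial: "vanishes w f m \<Longrightarrow> vanishes w (partial_deriv k f) (m - int (w k))"
  unfolding vanishes_def
proof (intro allI impI)
  fix I assume *: "\<forall>I. int (wt w I) < m \<longrightarrow> iter_partial I f 0 = 0" "int (wt w I) < m - int (w k)"
  then have "iter_partial (I @ [k]) f 0 = 0" by (auto simp del: iter_partial.simps)
  then show "iter_partial I (partial_deriv k f) 0 = 0" by (simp add: iter_partial_append)
qed

lemma vanishes_partial_nat:
  "vanishes w f (int m) \<Longrightarrow> vanishes w (partial_deriv k f) (int (m - w k))"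
  using vanishes_partial[of w f "int m" k] by (auto simp: vanishes_def)

lemma vanishes_nat: "vanishes w f m \<Longrightarrow> vanishes w f (int (nat m))"
  by (auto simp: vanishes_def)

lemma vanishes_add:
  assumes "open S" "0 \<in> S" "smooth_on S f" "smooth_on S g" "vanishes w f m" "vanishes w g m"
  shows "vanishes w (\<lambda>x. f x + g x) m"
  using assms iter_partial_add[OF assms(1,3,4,2)] by (simp add: vanishes_def)

lemma vanishes_sum:
  assumes "open S" "0 \<in> S" "\<And>i. i \<in> T \<Longrightarrow> smooth_on S (f i)" "\<And>i. i \<in> T \<Longrightarrow> vanishes w (f i) m"
  shows "vanishes w (\<lambda>x. \<Sum>i\<in>T. f i x) m"
  using assms(3,4)
proof (induction T rule: infinite_finite_induct)
  case (insert i T)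
  then show ?case using vanishes_add[OF assms(1,2), of "f i" "\<lambda>x. \<Sum>i\<in>T. f i x" w m]
      smooth_on_sum[OF assms(1), of T f] by simp
qed (auto simp: vanishes_def)

text \<open>In a non-zero Leibniz term the weights of the two words add up to the weight of
  \<open>I\<close>, and each factor demands its own share.\<close>

lemma vanishes_mult:
  assumes "open S" "0 \<in> S" "smooth_on S f" "smooth_on S g" "vanishes w f m" "vanishes w g m'"
  shows "vanishes w (\<lambda>x. f x * g x) (m + m')"
  unfolding vanishes_def
proof (intro allI impI, rule ccontr)
  fix I assume I: "int (wt w I) < m + m'" and "iter_partial I (\<lambda>x. f x * g x) 0 \<noteq> 0"
  from iter_partial_mult_nonzero[OF assms(1-4) this(2)] obtain J K where
    JK: "mset I = mset J + mset K" "iter_partial J f 0 \<noteq> 0" "iter_partial K g 0 \<noteq> 0" by blast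
  from arg_cong[OF this(1), of "\<lambda>M. sum_mset (image_mset w M)"]
  have "wt w I = wt w J + wt w K" by (simp flip: sum_mset_sum_list mset_map)
  moreover have "m \<le> int (wt w J)" "m' \<le> int (wt w K)"
    using JK(2,3) assms(5,6) by (auto simp: vanishes_def not_less[symmetric])
  ultimately show False using I by simp
qed

section \<open>The homogeneous pseudo-norm and the neighbourhoods of 0\<close>

locale weights =
  fixes w :: "'n::finite \<Rightarrow> nat"
  assumes weight_pos: "0 < w k"
begin

lemma rho_nonneg: "0 \<le> rho w x"
  unfolding rho_def by (intro sum_nonneg) (use weight_pos in auto)

lemma rho_0 [simp]: "rho w 0 = 0"
  unfolding rho_def by (simp add: real_root_zero)

lemma abs_le_rho: "\<bar>x $ k\<bar> \<le> rho w x ^ w k"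
proof -
  have "root (w k) \<bar>x $ k\<bar> \<le> rho w x"
    unfolding rho_def by (rule member_le_sum) (use weight_pos in auto)
  then have "root (w k) \<bar>x $ k\<bar> ^ w k \<le> rho w x ^ w k"
    by (intro power_mono) (use weight_pos in auto)
  then show ?thesis using weight_pos by simp
qed

text \<open>Converse to \<open>abs_le_rho\<close> up to the number of coordinates; it bounds
  \<open>rho\<close> at displaced points.\<close>

lemma rho_le:
  fixes s :: real
  assumes "0 \<le> s" "\<And>k. \<bar>x $ k\<bar> \<le> s ^ w k"
  shows "rho w x \<le> CARD('n) * s"
proof -
  have "root (w k) \<bar>x $ k\<bar> \<le> s" for k
    using real_root_le_mono[OF weight_pos[of k] assms(2)[of k]] weight_pos assms(1)
    by (simp add: real_root_power_cancel)
  then show ?thesis unfolding rho_def by (intro order.trans[OF sum_bounded_above[of UNIV _ s]]) auto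
qed

lemma rho_mono: "(\<And>k. \<bar>x $ k\<bar> \<le> \<bar>y $ k\<bar>) \<Longrightarrow> rho w x \<le> rho w y"
  unfolding rho_def by (intro sum_mono real_root_le_mono weight_pos)

lemma rho_pos: "x \<noteq> 0 \<Longrightarrow> 0 < rho w x"
proof (rule ccontr)
  assume "x \<noteq> 0" "\<not> 0 < rho w x"
  then have "rho w x = 0" using rho_nonneg[of x] by simp
  then have "x $ k = 0" for k using abs_le_rho[of x k] weight_pos[of k] by (simp add: power_0_left)
  then show False using \<open>x \<noteq> 0\<close> by (simp add: vec_eq_iff)
qed

lemma rho_dilation: "rho w (dilation w t x) = \<bar>t\<bar> * rho w x"
  unfolding rho_def dilation_def sum_distrib_left
  by (intro sum.cong refl)
    (use weight_pos in \<open>simp add: abs_mult power_abs real_root_mult real_root_power_cancel\<close>)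

lemma continuous_on_rho: "continuous_on S (rho w)"
  unfolding rho_def by (intro continuous_intros)

text \<open>The \<open>rho\<close>-balls form a neighbourhood basis at 0: for \<open>rho\<close> at
  most 1 each |x_k| is at most \<open>rho\<close>, since the weights are at least 1, and conversely
  \<open>rho\<close> is continuous.\<close>

lemma eventually_nhds_rho:
  "eventually P (nhds 0) \<longleftrightarrow> (\<exists>\<delta>>0. \<forall>x. rho w x < \<delta> \<longrightarrow> P x)"
proof
  assume "eventually P (nhds 0)"
  then obtain e where e: "0 < e" "\<And>x. norm x < e \<Longrightarrow> P x"
    by (auto simp: eventually_nhds_metric dist_norm)
  define n where "n = real CARD('n)"
  have n: "0 < n" by (simp add: n_def)
  show "\<exists>\<delta>>0. \<forall>x. rho w x < \<delta> \<longrightarrow> P x"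
  proof (intro exI[of _ "min 1 (e / n)"] conjI allI impI)
    show "0 < min 1 (e / n)" using e n by simp
    fix x assume x: "rho w x < min 1 (e / n)"
    have "\<bar>x $ k\<bar> \<le> rho w x" for k
      using abs_le_rho[of x k] power_decreasing[of 1 "w k" "rho w x"] weight_pos[of k] rho_nonneg[of x] x
      by simp
    then have "norm x \<le> n * rho w x"
      unfolding n_def by (intro order.trans[OF norm_le_l1_cart] order.trans[OF sum_bounded_above]) auto
    also have "\<dots> < e" using x n by (simp add: field_simps)
    finally show "P x" by (rule e(2))
  qed
next
  assume "\<exists>\<delta>>0. \<forall>x. rho w x < \<delta> \<longrightarrow> P x"
  then obtain \<delta> where \<delta>: "0 < \<delta>" "\<And>x. rho w x < \<delta> \<Longrightarrow> P x" by blast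
  have "isCont (rho w) 0" using continuous_on_rho[of UNIV] by (simp add: continuous_on_eq_continuous_at)
  then have "(rho w \<longlongrightarrow> 0) (nhds 0)"
    using tendsto_at_iff_tendsto_nhds[of "rho w" 0] by (simp add: isCont_def)
  then have "eventually (\<lambda>x. rho w x < \<delta>) (nhds 0)" by (rule order_tendstoD) (rule \<delta>(1))
  then show "eventually P (nhds 0)" by eventually_elim (rule \<delta>(2))
qed

lemma rho_ball_subset:
  assumes "open S" "0 \<in> S"
  obtains \<delta> where "0 < \<delta>" "\<And>x. rho w x < \<delta> \<Longrightarrow> x \<in> S"
  using eventually_nhds_in_open[OF assms] unfolding eventually_nhds_rho by blast

section \<open>Landau symbols relative to \<open>rho\<close> and vanishing of derivatives\<close>

lemma bigo_rho_iff:
  "f \<in> O[nhds 0](\<lambda>x. rho w x ^ p) \<longleftrightarrow>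
    (\<exists>C>0. \<exists>\<delta>>0. \<forall>x. rho w x < \<delta> \<longrightarrow> \<bar>f x\<bar> \<le> C * rho w x ^ p)"
  using rho_nonneg by (simp add: bigo_def eventually_nhds_rho power_abs)

lemma bigo_rho_uniform:
  assumes "\<And>k::'n. g k \<in> O[nhds 0](\<lambda>x. rho w x ^ p k)"
  obtains C \<delta> where "0 < C" "0 < \<delta>" "\<And>k x. rho w x < \<delta> \<Longrightarrow> \<bar>g k x\<bar> \<le> C * rho w x ^ p k"
proof -
  obtain C \<delta> where C: "\<And>k. 0 < C k" "\<And>k. 0 < \<delta> k"
    "\<And>k x. rho w x < \<delta> k \<Longrightarrow> \<bar>g k x\<bar> \<le> C k * rho w x ^ p k"
    using assms unfolding bigo_rho_iff by metis
  have "\<bar>g k x\<bar> \<le> (\<Sum>k\<in>UNIV. C k) * rho w x ^ p k" if "rho w x < Min (range \<delta>)" for k x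
  proof -
    have "\<bar>g k x\<bar> \<le> C k * rho w x ^ p k" using that by (intro C) auto
    also have "C k \<le> (\<Sum>k\<in>UNIV. C k)" by (rule member_le_sum) (auto intro: less_imp_le C)
    finally show ?thesis using rho_nonneg by (simp add: mult_right_mono)
  qed
  moreover have "0 < (\<Sum>k\<in>UNIV. C k)" by (intro sum_pos) (auto intro: C)
  moreover have "0 < Min (range \<delta>)" using C by simp
  ultimately show ?thesis using that by blast
qed

lemma smallo_rho_iff:
  "f \<in> o[at 0](\<lambda>x. rho w x ^ p) \<longleftrightarrow>
    (\<forall>c>0. \<exists>\<delta>>0. \<forall>x. rho w x < \<delta> \<longrightarrow> x \<noteq> 0 \<longrightarrow> \<bar>f x\<bar> \<le> c * rho w x ^ p)"
  using rho_nonneg by (simp add: smallo_def eventually_at_filter eventually_nhds_rho power_abs)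

text \<open>The mean value theorem on the segment from 0 writes f x as a sum of x_k, of size
  \<open>rho\<close> to the power w_k, times a partial derivative whose order has dropped by w_k
  only. Strong induction on m applies to that derivative, and \<open>rho\<close> does not grow
  towards 0 along the segment.\<close>

lemma bigo_of_vanishes:
  assumes "open S" "0 \<in> S" "smooth_on S f" "vanishes w f (int m)"
  shows "f \<in> O[nhds 0](\<lambda>x. rho w x ^ m)"
  using assms(3,4)
proof (induction m arbitrary: f rule: less_induct)
  case (less m)
  show ?case
  proof (cases "m = 0")
    case True
    have "isCont f 0"
      using smooth_on_continuous[OF less.prems(1)] assms(1,2) by (simp add: continuous_on_eq_continuous_at)
    then have "(f \<longlongrightarrow> f 0) (nhds 0)"
      using tendsto_at_iff_tendsto_nhds[of f 0] by (simp add: isCont_def)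
    then have "eventually (\<lambda>x. dist (f x) (f 0) < 1) (nhds 0)" by (rule tendstoD) simp
    then have "eventually (\<lambda>x. norm (f x) \<le> (\<bar>f 0\<bar> + 1) * norm (1::real)) (nhds 0)"
      by eventually_elim (auto simp: dist_real_def)
    from bigoI[OF this] show ?thesis using True by simp
  next
    case False
    have "partial_deriv k f \<in> O[nhds 0](\<lambda>x. rho w x ^ (m - w k))" for k
      using False weight_pos[of k] less.prems
      by (intro less.IH smooth_on_partial vanishes_partial_nat) auto
    then obtain C \<delta> where C: "0 < C" "0 < \<delta>"
      "\<And>k x. rho w x < \<delta> \<Longrightarrow> \<bar>partial_deriv k f x\<bar> \<le> C * rho w x ^ (m - w k)"
      using bigo_rho_uniform[of "\<lambda>k. partial_deriv k f" "\<lambda>k. m - w k"] by blast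
    obtain \<delta>0 where \<delta>0: "0 < \<delta>0" "\<And>x. rho w x < \<delta>0 \<Longrightarrow> x \<in> S"
      using rho_ball_subset[OF assms(1,2)] by blast
    have f0: "f 0 = 0"
      using less.prems(2) False unfolding vanishes_def by (auto dest: spec[of _ "[]"])
    \<comment> \<open>The bound 1 on the radius serves directions with \<open>w k > m\<close>: there
      the exponent \<open>w k + (m - w k)\<close> exceeds m, and powers of \<open>rho\<close> must
      decrease.\<close>
    have "\<bar>f x\<bar> \<le> (CARD('n) * C) * rho w x ^ m" if x: "rho w x < Min {\<delta>, \<delta>0, 1}" for x
    proof -
      have sm: "rho w (s *\<^sub>R x) \<le> rho w x" if "0 \<le> s" "s \<le> 1" for s
        using that by (intro rho_mono) (auto simp: abs_mult intro: mult_left_le_one_le)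
      have "f differentiable (at (0 + s *\<^sub>R x))" if "0 \<le> s" "s \<le> 1" for s
        using x sm[OF that] by (intro smooth_on_differentiable[OF less.prems(1)] \<delta>0) auto
      from mvt_partials[where x = 0 and v = x, OF this] obtain s where s: "0 < s" "s < 1"
        "f x = (\<Sum>k\<in>UNIV. x $ k * partial_deriv k f (s *\<^sub>R x))" using f0 by auto
      have "\<bar>x $ k * partial_deriv k f (s *\<^sub>R x)\<bar> \<le> C * rho w x ^ m" for k
      proof -
        have "\<bar>x $ k * partial_deriv k f (s *\<^sub>R x)\<bar> \<le> rho w x ^ w k * (C * rho w (s *\<^sub>R x) ^ (m - w k))"
          unfolding abs_mult
          by (intro mult_mono abs_le_rho C) (use x sm[of s] s rho_nonneg in auto)
        also have "\<dots> \<le> rho w x ^ w k * (C * rho w x ^ (m - w k))"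
          by (intro mult_left_mono power_mono) (use sm[of s] s rho_nonneg C in auto)
        also have "\<dots> = C * rho w x ^ (w k + (m - w k))" by (simp add: power_add)
        also have "\<dots> \<le> C * rho w x ^ m"
          by (intro mult_left_mono power_decreasing) (use x rho_nonneg C in auto)
        finally show ?thesis .
      qed
      then have "(\<Sum>k\<in>UNIV. \<bar>x $ k * partial_deriv k f (s *\<^sub>R x)\<bar>) \<le> CARD('n) * (C * rho w x ^ m)"
        by (intro order.trans[OF sum_bounded_above]) auto
      then show ?thesis unfolding s(3) mult.assoc by (rule order.trans[OF sum_abs])
    qed
    moreover have "0 < CARD('n) * C" using C by simp
    moreover have "0 < Min {\<delta>, \<delta>0, 1}" using C \<delta>0 by simp
    ultimately show ?thesis unfolding bigo_rho_iff by blast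
  qed
qed

text \<open>With the step \<open>\<eta> s\<^sup>w\<^sup>k\<close> in the direction \<open>k\<close>, where \<open>s = rho w x\<close>, the difference quotient of \<open>f\<close>
  is small for every fixed \<open>\<eta>\<close>, while its deviation from \<open>\<partial>\<^sub>k f(x)\<close> is of size \<open>\<eta> s\<^sup>m\<^sup>-\<^sup>w\<^sup>k\<close>
  because the second derivative still vanishes to weighted order \<open>m - 2 w\<^sub>k\<close>.\<close>

lemma smallo_partial:
  assumes "open S" "0 \<in> S" "smooth_on S f" "vanishes w f (int m)"
    and "f \<in> o[at 0](\<lambda>x. rho w x ^ m)" "w k \<le> m"
  shows "partial_deriv k f \<in> o[at 0](\<lambda>x. rho w x ^ (m - w k))"
  unfolding smallo_rho_iff
proof (intro allI impI)
  fix c :: real assume c: "0 < c"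
  define n where "n = real CARD('n)"
  have n: "1 \<le> n" by (simp add: n_def Suc_leI)
  \<comment> \<open>Every displaced point below has \<open>rho\<close> at most
    \<open>2 * n * s\<close>; replacing it by \<open>s\<close> in a power of exponent at most m
    costs at most the factor \<open>K\<close>.\<close>
  define K where "K = (2 * n) ^ m"
  have K: "1 \<le> K" unfolding K_def using n by (intro one_le_power) simp
  let ?p = "partial_deriv k f" and ?q = "partial_deriv k (partial_deriv k f)"
  note sm = smooth_on_partial[OF assms(3), of k]
  have "vanishes w ?q (int (m - w k - w k))"
    by (intro vanishes_partial_nat assms)
  from bigo_of_vanishes[OF assms(1,2) smooth_on_partial[OF sm] this]
  obtain C \<delta>1 where C: "0 < C" "0 < \<delta>1"
    "\<And>x. rho w x < \<delta>1 \<Longrightarrow> \<bar>?q x\<bar> \<le> C * rho w x ^ (m - w k - w k)"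
    unfolding bigo_rho_iff by blast
  obtain \<delta>0 where \<delta>0: "0 < \<delta>0" "\<And>x. rho w x < \<delta>0 \<Longrightarrow> x \<in> S"
    using rho_ball_subset[OF assms(1,2)] by blast
  \<comment> \<open>\<open>\<eta>\<close> makes the second-derivative error half of the target;
    \<open>c'\<close> below makes the difference quotient the other half, since
    \<open>c' * (K + 1) / \<eta> = c / 2\<close>.\<close>
  define \<eta> where "\<eta> = min 1 (c / (2 * C * K))"
  have \<eta>: "0 < \<eta>" "\<eta> \<le> 1" "\<eta> * C * K \<le> c / 2"
  proof -
    have "\<eta> \<le> c / (2 * C * K)" by (simp add: \<eta>_def)
    then show "\<eta> * C * K \<le> c / 2" using C K by (simp add: field_simps)
  qed (use c C K in \<open>auto simp: \<eta>_def\<close>)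
  define c' where "c' = c * \<eta> / (2 * (K + 1))"
  have c': "0 < c'" using c \<eta> K by (simp add: c'_def)
  from assms(5) c' obtain \<delta>2 where \<delta>2: "0 < \<delta>2"
    "\<And>x. rho w x < \<delta>2 \<Longrightarrow> x \<noteq> 0 \<Longrightarrow> \<bar>f x\<bar> \<le> c' * rho w x ^ m"
    unfolding smallo_rho_iff by blast
  have f0: "f 0 = 0"
    using assms(4,6) weight_pos[of k] unfolding vanishes_def by (auto dest: spec[of _ "[]"])
  have fb: "\<bar>f x\<bar> \<le> c' * rho w x ^ m" if "rho w x < \<delta>2" for x
    using \<delta>2(2)[OF that] f0 c' by (cases "x = 0") auto
  \<comment> \<open>The divisor keeps the whole displaced segment, not only x, within the three
    radii.\<close>
  define \<delta> where "\<delta> = Min {\<delta>0, \<delta>1, \<delta>2, 1} / (2 * n)"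
  show "\<exists>\<delta>>0. \<forall>x. rho w x < \<delta> \<longrightarrow> x \<noteq> 0 \<longrightarrow> \<bar>?p x\<bar> \<le> c * rho w x ^ (m - w k)"
  proof (intro exI[of _ \<delta>] conjI allI impI)
    show "0 < \<delta>" using \<delta>0 C \<delta>2 n by (simp add: \<delta>_def)
    fix x :: "real^'n" assume x: "rho w x < \<delta>" "x \<noteq> 0"
    define s where "s = rho w x"
    have s: "0 < s" using x rho_pos by (simp add: s_def)
    have ns: "2 * n * s < Min {\<delta>0, \<delta>1, \<delta>2, 1}"
      using x n by (simp add: s_def \<delta>_def field_simps)
    have "s \<le> 2 * n * s" using n s by simp
    then have s1: "s < \<delta>2" "s < 1" using ns by auto
    define h where "h = \<eta> * s ^ w k"
    have h: "0 < h" "h \<le> s ^ w k" using \<eta> s by (auto simp: h_def mult_left_le_one_le)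
    have near: "rho w (x + u *\<^sub>R axis k h) \<le> 2 * n * s" if "0 \<le> u" "u \<le> 1" for u
    proof -
      have "\<bar>(x + u *\<^sub>R axis k h) $ j\<bar> \<le> (2 * s) ^ w j" for j
      proof -
        have "\<bar>(x + u *\<^sub>R axis k h) $ j\<bar> \<le> s ^ w j + s ^ w j"
        proof -
          have "\<bar>(u *\<^sub>R axis k h) $ j\<bar> \<le> s ^ w j"
          proof (cases "j = k")
            case True
            have "\<bar>u * h\<bar> \<le> 1 * h" unfolding abs_mult using that h by (intro mult_mono) auto
            then show ?thesis using True h by simp
          qed (use s in \<open>simp add: axis_def\<close>)
          moreover have "\<bar>x $ j\<bar> \<le> s ^ w j" using abs_le_rho by (simp add: s_def)
          ultimately show ?thesis by simp
        qed
        also have "\<dots> = 2 ^ 1 * s ^ w j" by simp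
        also have "\<dots> \<le> 2 ^ w j * s ^ w j"
          using weight_pos[of j] s by (intro mult_right_mono power_increasing) auto
        finally show ?thesis by (simp add: power_mult_distrib)
      qed
      then have "rho w (x + u *\<^sub>R axis k h) \<le> CARD('n) * (2 * s)" by (intro rho_le) (use s in auto)
      then show ?thesis by (simp add: n_def mult_ac)
    qed
    have inS: "x + u *\<^sub>R axis k h \<in> S" if "0 \<le> u" "u \<le> 1" for u
      using near[OF that] ns by (intro \<delta>0) auto
    obtain u where u: "0 < u" "u < 1" "f (x + axis k h) - f x = h * ?p (x + u *\<^sub>R axis k h)"
    proof -
      have "f differentiable at (x + u *\<^sub>R axis k h)" if "0 \<le> u" "u \<le> 1" for u
        using smooth_on_differentiable[OF assms(3)] inS that by blast
      from mvt_partials[OF this] obtain u where "0 < u" "u < 1"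
        "f (x + axis k h) - f x =
          (\<Sum>j\<in>UNIV. axis k h $ j * partial_deriv j f (x + u *\<^sub>R axis k h))" by blast
      moreover have "(\<Sum>j\<in>UNIV. axis k h $ j * partial_deriv j f y) = h * partial_deriv k f y" for y
        by (simp add: axis_def if_distrib[of "\<lambda>z. z * _"] cong: if_cong)
      ultimately show ?thesis using that by simp
    qed
    obtain v where v: "0 < v" "v < 1"
      "?p (x + u *\<^sub>R axis k h) - ?p x = (u * h) * ?q (x + (v * u) *\<^sub>R axis k h)"
    proof -
      have "?p differentiable at (x + v *\<^sub>R (u *\<^sub>R axis k h))" if "0 \<le> v" "v \<le> 1" for v
        using smooth_on_differentiable[OF sm] inS[of "v * u"] that u mult_le_one[of v u] by simp
      from mvt_partials[OF this] obtain v where "0 < v" "v < 1"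
        "?p (x + u *\<^sub>R axis k h) - ?p x =
          (\<Sum>j\<in>UNIV. (u *\<^sub>R axis k h) $ j * partial_deriv j ?p (x + v *\<^sub>R (u *\<^sub>R axis k h)))" by blast
      moreover have "(\<Sum>j\<in>UNIV. (u *\<^sub>R axis k h) $ j * partial_deriv j ?p y) =
          (u * h) * partial_deriv k ?p y" for y
        by (simp add: axis_def if_distrib[of "\<lambda>z. z * _"] if_distrib[of "\<lambda>z. _ * z"] cong: if_cong)
      ultimately show ?thesis using that by simp
    qed
    define P where "P = s ^ (m - w k)"
    have P: "0 < P" using s by (simp add: P_def)
    have sP: "s ^ m = s ^ w k * P" using assms(6) by (simp add: P_def flip: power_add)
    have "\<bar>f (x + axis k h) - f x\<bar> \<le> c' * (K + 1) * s ^ m"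
    proof -
      have y: "rho w (x + axis k h) \<le> 2 * n * s" using near[of 1] by simp
      have "\<bar>f (x + axis k h)\<bar> \<le> c' * rho w (x + axis k h) ^ m" using y ns by (intro fb) auto
      also have "\<dots> \<le> c' * (2 * n * s) ^ m"
        using y c' rho_nonneg by (intro mult_left_mono power_mono) auto
      also have "\<dots> = c' * K * s ^ m" by (simp add: K_def power_mult_distrib)
      finally have "\<bar>f (x + axis k h)\<bar> \<le> c' * K * s ^ m" .
      moreover have "\<bar>f x\<bar> \<le> c' * s ^ m" using fb[of x] s1 by (simp add: s_def)
      ultimately show ?thesis by (simp add: algebra_simps)
    qed
    moreover have "c' * (K + 1) = c * \<eta> / 2" using K by (simp add: c'_def field_simps)
    ultimately have "h * \<bar>?p (x + u *\<^sub>R axis k h)\<bar> \<le> (c * \<eta> / 2) * (s ^ w k * P)"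
      unfolding u(3) using h by (simp add: abs_mult sP)
    also have "\<dots> = h * (c / 2 * P)" by (simp add: h_def)
    finally have 1: "\<bar>?p (x + u *\<^sub>R axis k h)\<bar> \<le> c / 2 * P" using h by simp
    have "\<bar>?q (x + (v * u) *\<^sub>R axis k h)\<bar> \<le> C * K * s ^ (m - w k - w k)"
    proof -
      have vu: "0 \<le> v * u" "v * u \<le> 1" using u v by (auto intro: mult_le_one)
      have "\<bar>?q (x + (v * u) *\<^sub>R axis k h)\<bar> \<le> C * rho w (x + (v * u) *\<^sub>R axis k h) ^ (m - w k - w k)"
        using near[OF vu] ns by (intro C) auto
      also have "\<dots> \<le> C * (2 * n * s) ^ (m - w k - w k)"
        using near[OF vu] C rho_nonneg by (intro mult_left_mono power_mono) auto
      also have "\<dots> = C * ((2 * n) ^ (m - w k - w k) * s ^ (m - w k - w k))"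
        by (simp add: power_mult_distrib)
      also have "\<dots> \<le> C * (K * s ^ (m - w k - w k))"
        unfolding K_def using n s C by (intro mult_left_mono mult_right_mono power_increasing) auto
      finally show ?thesis by simp
    qed
    then have "\<bar>(u * h) * ?q (x + (v * u) *\<^sub>R axis k h)\<bar> \<le> h * (C * K * s ^ (m - w k - w k))"
      unfolding abs_mult using u h C K s
      by (intro mult_mono) (auto simp: abs_mult mult_left_le_one_le)
    also have "\<dots> = \<eta> * C * K * s ^ (w k + (m - w k - w k))" by (simp add: h_def power_add)
    also have "\<dots> \<le> c / 2 * P"
      unfolding P_def using s s1 c \<eta> by (intro mult_mono power_decreasing) auto
    finally have 2: "\<bar>(u * h) * ?q (x + (v * u) *\<^sub>R axis k h)\<bar> \<le> c / 2 * P" .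
    have "\<bar>?p x\<bar> \<le> \<bar>?p (x + u *\<^sub>R axis k h)\<bar> + \<bar>(u * h) * ?q (x + (v * u) *\<^sub>R axis k h)\<bar>"
      using v(3) by linarith
    also have "\<dots> \<le> c * P" using 1 2 by simp
    finally show "\<bar>?p x\<bar> \<le> c * rho w x ^ (m - w k)" by (simp add: P_def s_def)
  qed
qed

text \<open>Only words of weight exactly m are at stake. Peeling off the innermost derivative lowers
  m by its weight through \<open>smallo_partial\<close>, until the empty word is left, where
  continuity gives the value 0.\<close>

lemma vanishes_Suc_of_smallo:
  assumes "open S" "0 \<in> S"
  shows "smooth_on S f \<Longrightarrow> vanishes w f (int m) \<Longrightarrow> f \<in> o[at 0](\<lambda>x. rho w x ^ m) \<Longrightarrow>
    vanishes w f (int m + 1)"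
proof (induction m arbitrary: f rule: less_induct)
  case (less m)
  show ?case unfolding vanishes_def
  proof (intro allI impI)
    fix I assume I: "int (wt w I) < int m + 1"
    show "iter_partial I f 0 = 0"
    proof (cases "wt w I < m")
      case True then show ?thesis using less.prems(2) by (simp add: vanishes_def)
    next
      case False
      then have m: "wt w I = m" using I by simp
      show ?thesis
      proof (cases I rule: rev_cases)
        case Nil
        have "isCont f 0"
          using smooth_on_continuous[OF less.prems(1)] assms by (simp add: continuous_on_eq_continuous_at)
        then have "(f \<longlongrightarrow> f 0) (at 0)" by (simp add: isCont_def)
        moreover have "(f \<longlongrightarrow> 0) (at 0)" using less.prems(3) Nil m by (auto dest: smalloD_tendsto)
        ultimately show ?thesis using Nil tendsto_unique[of "at (0::real^'n)"] by auto
      next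
        case (snoc J k)
        have wk: "w k \<le> m" "m - w k < m" "wt w J = m - w k" using m snoc weight_pos[of k] by auto
        have "vanishes w (partial_deriv k f) (int (m - w k) + 1)"
          using less.prems wk by (intro less.IH smooth_on_partial vanishes_partial_nat
              smallo_partial[OF assms]) auto
        then show ?thesis unfolding snoc iter_partial_append using wk by (simp add: vanishes_def)
      qed
    qed
  qed
qed

text \<open>Since \<open>smallo_partial\<close> presupposes vanishing to the order already reached,
  the order is raised one unit at a time: a bound by the m-th power of \<open>rho\<close> is
  little-o of every lower power.\<close>

lemma vanishes_of_bigo:
  assumes "open S" "0 \<in> S" "smooth_on S f" "f \<in> O[nhds 0](\<lambda>x. rho w x ^ m)"
  shows "vanishes w f (int m)"
proof -
  obtain C \<delta> where C: "0 < C" "0 < \<delta>" "\<And>x. rho w x < \<delta> \<Longrightarrow> \<bar>f x\<bar> \<le> C * rho w x ^ m"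
    using assms(4) unfolding bigo_rho_iff by blast
  have "vanishes w f (int m')" if "m' \<le> m" for m'
    using that
  proof (induction m')
    case (Suc m')
    have "f \<in> o[at 0](\<lambda>x. rho w x ^ m')" unfolding smallo_rho_iff
    proof (intro allI impI)
      fix c :: real assume c: "0 < c"
      show "\<exists>\<delta>>0. \<forall>x. rho w x < \<delta> \<longrightarrow> x \<noteq> 0 \<longrightarrow> \<bar>f x\<bar> \<le> c * rho w x ^ m'"
      proof (intro exI[of _ "Min {\<delta>, c / C, 1}"] conjI allI impI)
        fix x assume x: "rho w x < Min {\<delta>, c / C, 1}"
        have "\<bar>f x\<bar> \<le> C * rho w x ^ m" using x by (intro C) auto
        also have "\<dots> \<le> C * rho w x ^ Suc m'"
          using Suc.prems x rho_nonneg C by (intro mult_left_mono power_decreasing) auto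
        also have "\<dots> = (C * rho w x) * rho w x ^ m'" by simp
        also have "\<dots> \<le> c * rho w x ^ m'"
          using x C rho_nonneg by (intro mult_right_mono) (auto simp: field_simps)
        finally show "\<bar>f x\<bar> \<le> c * rho w x ^ m'" .
      qed (use c C in simp)
    qed
    with vanishes_Suc_of_smallo[OF assms(1-3) Suc.IH] Suc.prems show ?case by (simp add: add.commute)
  qed (simp add: vanishes_def)
  then show ?thesis by simp
qed

text \<open>By homogeneity a comparison on the sphere where \<open>rho\<close> is 1 is enough. The
  sphere is compact, so \<open>N\<close> has extrema there, and the minimum is positive because 0 is
  not on the sphere.\<close>

lemma pseudo_norm_equiv:
  assumes "pseudo_norm w N"
  shows "(\<lambda>x. N x ^ p) \<in> O[nhds 0](\<lambda>x. rho w x ^ p)" "(\<lambda>x. rho w x ^ p) \<in> O[nhds 0](\<lambda>x. N x ^ p)"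
proof -
  have cN: "continuous_on S N" for S
    using assms continuous_on_subset unfolding pseudo_norm_def by blast
  have Npos: "x \<noteq> 0 \<Longrightarrow> 0 < N x" and Nd: "N (dilation w t x) = \<bar>t\<bar> * N x" for t x
    using assms by (auto simp: pseudo_norm_def)
  define K where "K = {x. rho w x = 1}"
  have "closed K" unfolding K_def by (intro closed_Collect_eq continuous_on_rho) auto
  moreover have "bounded K"
  proof (rule boundedI)
    fix x assume "x \<in> K"
    then have "\<bar>x $ k\<bar> \<le> 1" for k using abs_le_rho[of x k] by (simp add: K_def)
    then show "norm x \<le> CARD('n) * 1"
      by (intro order.trans[OF norm_le_l1_cart] order.trans[OF sum_bounded_above[of UNIV _ 1]]) auto
  qed
  ultimately have K: "compact K" by (simp add: compact_eq_bounded_closed)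
  have normalise: "dilation w (1 / rho w x) x \<in> K" if "x \<noteq> 0" for x
    using rho_pos[OF that] by (simp add: K_def rho_dilation)
  have "axis undefined 1 \<noteq> (0::real^'n)" by (simp add: axis_eq_0_iff)
  from normalise[OF this] have Kne: "K \<noteq> {}" by blast
  obtain y where y: "y \<in> K" "\<And>x. x \<in> K \<Longrightarrow> N y \<le> N x"
    using continuous_attains_inf[OF K Kne cN] by blast
  obtain z where z: "z \<in> K" "\<And>x. x \<in> K \<Longrightarrow> N x \<le> N z"
    using continuous_attains_sup[OF K Kne cN] by blast
  have N0: "N 0 = 0" using Nd[of 0 0] weight_pos by (simp add: dilation_def zero_vec_def power_0_left)
  have bd: "N y * rho w x \<le> N x \<and> N x \<le> N z * rho w x" for x
  proof (cases "x = 0")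
    case False
    note r = rho_pos[OF False]
    have e: "N (dilation w (1 / rho w x) x) = N x / rho w x" using r by (simp add: Nd)
    show ?thesis using y(2)[OF normalise[OF False]] z(2)[OF normalise[OF False]] r
      unfolding e by (simp add: pos_le_divide_eq pos_divide_le_eq)
  qed (simp add: N0)
  have "y \<noteq> 0" using y(1) by (auto simp: K_def)
  then have yp: "0 < N y" by (rule Npos)
  have Nnn: "0 \<le> N x" for x using Npos[of x] N0 by (cases "x = 0") auto
  show "(\<lambda>x. N x ^ p) \<in> O[nhds 0](\<lambda>x. rho w x ^ p)"
  proof (rule bigoI[of _ "N z ^ p"], rule always_eventually, rule allI)
    fix x
    have "N x ^ p \<le> (N z * rho w x) ^ p" using bd Nnn by (intro power_mono) auto
    then show "norm (N x ^ p) \<le> N z ^ p * norm (rho w x ^ p)"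
      using Nnn rho_nonneg by (simp add: power_mult_distrib)
  qed
  show "(\<lambda>x. rho w x ^ p) \<in> O[nhds 0](\<lambda>x. N x ^ p)"
  proof (rule bigoI[of _ "(1 / N y) ^ p"], rule always_eventually, rule allI)
    fix x
    have "rho w x ^ p \<le> (1 / N y * N x) ^ p"
      using bd[of x] yp rho_nonneg by (intro power_mono) (auto simp: field_simps)
    then show "norm (rho w x ^ p) \<le> (1 / N y) ^ p * norm (N x ^ p)"
      using Nnn rho_nonneg by (simp only: power_mult_distrib real_norm_def abs_of_nonneg zero_le_power)
  qed
qed

lemma weighted_bigo_iff:
  assumes "pseudo_norm w N"
  shows "weighted_bigo w N m \<Theta> \<longleftrightarrow> (\<forall>k. (\<lambda>x. \<Theta> x $ k) \<in> O[nhds 0](\<lambda>x. rho w x ^ (w k + m)))"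
  using pseudo_norm_equiv[OF assms] landau_o.big_trans unfolding weighted_bigo_def by blast

end

section \<open>Words in a frame\<close>

definition vf_op :: "(real^'n \<Rightarrow> real^'n) \<Rightarrow> (real^'n \<Rightarrow> real) \<Rightarrow> real^'n \<Rightarrow> real"
  where "vf_op V f x = (\<Sum>k\<in>UNIV. V x $ k * partial_deriv k f x)"

fun vf_word :: "('n \<Rightarrow> real^'n \<Rightarrow> real^'n) \<Rightarrow> 'n list \<Rightarrow> (real^'n \<Rightarrow> real) \<Rightarrow> real^'n \<Rightarrow> real"
  where
    "vf_word B [] f = f"
  | "vf_word B (i # I) f = vf_op (B i) (vf_word B I f)"

lemma vf_word_append: "vf_word B (I @ J) f = vf_word B I (vf_word B J f)"
  by (induction I) auto

lemma vf_op_cong: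
  assumes "open S" "x \<in> S" "\<And>y. y \<in> S \<Longrightarrow> f y = g y" "V x = V' x"
  shows "vf_op V f x = vf_op V' g x"
  using partial_deriv_cong[OF assms(1,2), of f g] assms(3,4)
  by (simp add: vf_op_def)

lemma vf_word_cong:
  assumes "open S" "\<And>y. y \<in> S \<Longrightarrow> f y = g y" "x \<in> S"
  shows "vf_word B I f x = vf_word B I g x"
  using assms(3)
proof (induction I arbitrary: x)
  case (Cons i I)
  show ?case unfolding vf_word.simps
    by (rule vf_op_cong[OF assms(1) Cons.prems]) (simp_all add: Cons.IH)
qed (use assms in auto)

lemma vf_op_smooth:
  assumes "open S" "smooth_on S V" "smooth_on S f"
  shows "smooth_on S (vf_op V f)"
  unfolding vf_op_def[abs_def] using assms
  by (intro smooth_on_sum smooth_on_mult smooth_on_component smooth_on_partial) auto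

text \<open>The frame as seen in one coordinate system. \<open>B_vanishes\<close> says that X_j, as
  a differential operator, has weighted order at least - w_j; it is empty for components with w_k at
  most w_j.\<close>

locale adapted_frame = weights w for w :: "'n::finite \<Rightarrow> nat" +
  fixes S :: "(real^'n) set" and B :: "'n \<Rightarrow> real^'n \<Rightarrow> real^'n"
  assumes open_S: "open S" and zero_in_S: "0 \<in> S"
    and B_smooth: "smooth_on S (B j)"
    and B_vanishes: "vanishes w (\<lambda>x. B j x $ k) (int (w k) - int (w j))"
    and B_zero: "B j 0 = axis j 1"
begin

lemma vf_word_smooth: "smooth_on S f \<Longrightarrow> smooth_on S (vf_word B I f)"
  by (induction I) (auto intro: vf_op_smooth open_S B_smooth)

text \<open>In the k-th term the coefficient gains w_k - w_j and the derivative loses w_k, so the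
  loss is w_j for every k.\<close>

lemma vanishes_vf_op:
  assumes "smooth_on S f" "vanishes w f m"
  shows "vanishes w (vf_op (B j) f) (m - int (w j))"
  unfolding vf_op_def[abs_def]
proof (rule vanishes_sum[OF open_S zero_in_S])
  fix k
  note s = smooth_on_component[OF open_S B_smooth] smooth_on_partial[OF assms(1)]
  show "smooth_on S (\<lambda>x. B j x $ k * partial_deriv k f x)"
    by (intro smooth_on_mult open_S s)
  have "vanishes w (\<lambda>x. B j x $ k * partial_deriv k f x)
      (int (w k) - int (w j) + (m - int (w k)))"
    by (intro vanishes_mult[OF open_S zero_in_S] s B_vanishes vanishes_partial assms)
  then show "vanishes w (\<lambda>x. B j x $ k * partial_deriv k f x) (m - int (w j))" by simp
qed

lemma vanishes_vf_word:
  "smooth_on S f \<Longrightarrow> vanishes w f m \<Longrightarrow> vanishes w (vf_word B I f) (m - int (wt w I))"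
proof (induction I)
  case (Cons i I)
  from vanishes_vf_op[OF vf_word_smooth[OF Cons.prems(1)] Cons.IH[OF Cons.prems], of i]
  show ?case by (simp add: algebra_simps)
qed simp

lemma vf_word_at_zero:
  assumes "smooth_on S f" "vanishes w f m" "int (wt w I) < m"
  shows "vf_word B I f 0 = 0"
  using vanishes_vf_word[OF assms(1,2), of I] assms(3)
  unfolding vanishes_def by (auto dest: spec[of _ "[]"])

text \<open>Recovering the partial derivatives of weighted order less than \<open>m\<close> from the words in the frame
  requires an induction on the unweighted order, whence the two filtrations.\<close>

definition bivanishes :: "(real^'n \<Rightarrow> real) \<Rightarrow> int \<Rightarrow> nat \<Rightarrow> bool"
  where "bivanishes f m d \<longleftrightarrow>
    (\<forall>I. int (wt w I) < m \<and> length I < d \<longrightarrow> iter_partial I f 0 = 0)"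

text \<open>The coefficients of X_j - \<partial>_j vanish at 0. A surviving Leibniz term must spend
  at least one letter on such a coefficient, which pays for the extra letter k; so the remainder,
  unlike X_j, does not lower the unweighted order.\<close>

lemma bivanishes_remainder:
  assumes f: "smooth_on S f" and bf: "bivanishes f m d"
  shows "bivanishes (\<lambda>x. vf_op (B j) f x - partial_deriv j f x) (m - int (w j)) d"
  unfolding bivanishes_def
proof (intro allI impI, elim conjE)
  fix I assume I: "int (wt w I) < m - int (w j)" "length I < d"
  define c where "c k x = B j x $ k - axis j 1 $ k" for k x
  have c: "smooth_on S (c k)" for k
    unfolding c_def[abs_def]
    by (intro smooth_on_diff smooth_on_component open_S B_smooth smooth_on_const)
  note p = smooth_on_partial[OF f]
  have eq: "vf_op (B j) f x - partial_deriv j f x = (\<Sum>k\<in>UNIV. c k x * partial_deriv k f x)" for x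
  proof -
    have "partial_deriv j f x = (\<Sum>k\<in>UNIV. axis j 1 $ k * partial_deriv k f x)"
      by (simp add: axis_def if_distrib[of "\<lambda>z. z * _"] cong: if_cong)
    then show ?thesis by (simp add: vf_op_def c_def left_diff_distrib sum_subtractf)
  qed
  have "iter_partial I (\<lambda>x. c k x * partial_deriv k f x) 0 = 0" for k
  proof (rule ccontr)
    assume "iter_partial I (\<lambda>x. c k x * partial_deriv k f x) 0 \<noteq> 0"
    from iter_partial_mult_nonzero[OF open_S zero_in_S c p this] obtain J K where
      JK: "mset I = mset J + mset K" "iter_partial J (c k) 0 \<noteq> 0"
        "iter_partial (K @ [k]) f 0 \<noteq> 0" by (auto simp: iter_partial_append)
    from arg_cong[OF JK(1), of "\<lambda>M. sum_mset (image_mset w M)"]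
    have wI: "wt w I = wt w J + wt w K" by (simp flip: sum_mset_sum_list mset_map)
    from arg_cong[OF JK(1), of size] have lI: "length I = length J + length K" by simp
    have "J \<noteq> []" using JK(2) by (auto simp: c_def B_zero)
    then obtain i J' where J: "J = i # J'" by (cases J) auto
    then have "length I = Suc (length J') + length K" using lI by simp
    moreover have "int (w k) - int (w j) \<le> int (wt w J)"
    proof (cases "k = j")
      case False
      then have "c k = (\<lambda>x. B j x $ k)" by (auto simp: c_def axis_def)
      then show ?thesis using JK(2) B_vanishes[of j k] by (auto simp: vanishes_def not_less[symmetric])
    qed simp
    ultimately have "int (wt w (K @ [k])) < m \<and> length (K @ [k]) < d" using wI lI I by auto
    then show False using bf JK(3) unfolding bivanishes_def by blast
  qed
  moreover have "iter_partial I (\<lambda>x. \<Sum>k\<in>T. c k x * partial_deriv k f x) 0 =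
      (\<Sum>k\<in>T. iter_partial I (\<lambda>x. c k x * partial_deriv k f x) 0)" for T
  proof (induction T rule: infinite_finite_induct)
    case (insert k T)
    have "iter_partial I (\<lambda>x. c k x * partial_deriv k f x + (\<Sum>k\<in>T. c k x * partial_deriv k f x)) 0 =
        iter_partial I (\<lambda>x. c k x * partial_deriv k f x) 0 +
        iter_partial I (\<lambda>x. \<Sum>k\<in>T. c k x * partial_deriv k f x) 0"
      by (intro iter_partial_add[OF open_S] smooth_on_mult smooth_on_sum open_S c p zero_in_S)
    then show ?case using insert by simp
  qed auto
  ultimately show "iter_partial I (\<lambda>x. vf_op (B j) f x - partial_deriv j f x) 0 = 0"
    unfolding eq by simp
qed

text \<open>When shorter derivatives of admissible weight vanish, replacing the innermost X_j by
  \<partial>_j leaves a remainder that a word of this length does not detect. Repeating this turns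
  the whole word into a partial derivative.\<close>

lemma vf_word_leading:
  "smooth_on S f \<Longrightarrow> bivanishes f m (length I) \<Longrightarrow> int (wt w I) < m \<Longrightarrow>
    vf_word B I f 0 = iter_partial I f 0"
proof (induction I arbitrary: f m rule: rev_induct)
  case (snoc j I)
  define g where "g = vf_op (B j) f"
  define h where "h x = vf_op (B j) f x - partial_deriv j f x" for x
  note p = smooth_on_partial[OF snoc.prems(1), of j]
  have g: "smooth_on S g" unfolding g_def by (rule vf_op_smooth[OF open_S B_smooth snoc.prems(1)])
  have h: "smooth_on S h" unfolding h_def[abs_def] using smooth_on_diff[OF open_S g p] by (simp add: g_def)
  have bh: "bivanishes h (m - int (w j)) (length (I @ [j]))"
    unfolding h_def[abs_def] by (rule bivanishes_remainder) fact+
  have split: "iter_partial J g 0 = iter_partial (J @ [j]) f 0 + iter_partial J h 0" for J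
    using iter_partial_add[OF open_S p h zero_in_S, of J] by (simp add: g_def h_def iter_partial_append)
  have "bivanishes g (m - int (w j)) (length I)"
    unfolding bivanishes_def
  proof (intro allI impI)
    fix J assume "int (wt w J) < m - int (w j) \<and> length J < length I"
    then have "iter_partial (J @ [j]) f 0 = 0" "iter_partial J h 0 = 0"
      using snoc.prems(2) bh unfolding bivanishes_def by auto
    then show "iter_partial J g 0 = 0" by (simp add: split)
  qed
  from snoc.IH[OF g this] snoc.prems(3) have "vf_word B I g 0 = iter_partial I g 0" by simp
  moreover have "iter_partial I h 0 = 0" using bh snoc.prems(3) by (auto simp: bivanishes_def)
  ultimately show ?case by (simp add: split vf_word_append g_def[symmetric])
qed simp

text \<open>Converse of \<open>vf_word_at_zero\<close>: at the first length not yet treated, the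
  derivative equals the word in the frame with the same letters.\<close>

lemma vanishes_of_vf_words:
  assumes "smooth_on S f" "\<And>I. int (wt w I) < m \<Longrightarrow> vf_word B I f 0 = 0"
  shows "vanishes w f m"
proof -
  have "bivanishes f m d" for d
  proof (induction d)
    case (Suc d)
    show ?case unfolding bivanishes_def
    proof (intro allI impI)
      fix I assume I: "int (wt w I) < m \<and> length I < Suc d"
      show "iter_partial I f 0 = 0"
      proof (cases "length I < d")
        case False
        then have "length I = d" using I by simp
        then show ?thesis using vf_word_leading[OF assms(1), of m I] Suc assms(2) I by simp
      qed (use Suc I in \<open>auto simp: bivanishes_def\<close>)
    qed
  qed (simp add: bivanishes_def)
  then show ?thesis unfolding vanishes_def bivanishes_def by (meson lessI)
qed

end

section \<open>Weighted estimates for composition and for small displacements\<close>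

context weights
begin

lemma rho_bigo:
  fixes g :: "real^'n \<Rightarrow> real^'n"
  assumes "\<And>k. (\<lambda>x. g x $ k) \<in> O[nhds 0](\<lambda>x. rho w x ^ w k)"
  obtains L \<delta> where "0 < L" "0 < \<delta>" "\<And>x. rho w x < \<delta> \<Longrightarrow> rho w (g x) \<le> L * rho w x"
proof -
  obtain C \<delta> where C: "0 < C" "0 < \<delta>"
    "\<And>k x. rho w x < \<delta> \<Longrightarrow> \<bar>g x $ k\<bar> \<le> C * rho w x ^ w k"
    using bigo_rho_uniform[of "\<lambda>k x. g x $ k" w, OF assms] by blast
  have "rho w (g x) \<le> (CARD('n) * (1 + C)) * rho w x" if "rho w x < \<delta>" for x
  proof -
    \<comment> \<open>Enlarging \<open>C\<close> to \<open>1 + C\<close>, which is at least 1,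
      allows the constant to be moved inside the power.\<close>
    have "\<bar>g x $ k\<bar> \<le> ((1 + C) * rho w x) ^ w k" for k
    proof -
      have "\<bar>g x $ k\<bar> \<le> C * rho w x ^ w k" by (rule C(3)[OF that])
      also have "C \<le> (1 + C) ^ w k"
        using C weight_pos[of k] power_increasing[of 1 "w k" "1 + C"] by simp
      finally show ?thesis using rho_nonneg by (simp add: power_mult_distrib mult_right_mono)
    qed
    then show ?thesis using rho_le[of "(1 + C) * rho w x" "g x"] C rho_nonneg by (simp add: mult.assoc)
  qed
  then show ?thesis using that[of "CARD('n) * (1 + C)" \<delta>] C by simp
qed

lemma bigo_compose:
  assumes "f \<in> O[nhds 0](\<lambda>x. rho w x ^ p)"
    and "0 < L" "0 < \<delta>" "\<And>x. rho w x < \<delta> \<Longrightarrow> rho w (g x) \<le> L * rho w x"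
  shows "(\<lambda>x. f (g x)) \<in> O[nhds 0](\<lambda>x. rho w x ^ p)"
proof -
  obtain C \<epsilon> where C: "0 < C" "0 < \<epsilon>" "\<And>x. rho w x < \<epsilon> \<Longrightarrow> \<bar>f x\<bar> \<le> C * rho w x ^ p"
    using assms(1) unfolding bigo_rho_iff by blast
  have "\<bar>f (g x)\<bar> \<le> (C * L ^ p) * rho w x ^ p" if x: "rho w x < min \<delta> (\<epsilon> / L)" for x
  proof -
    have g: "rho w (g x) \<le> L * rho w x" using x by (intro assms) auto
    also have "\<dots> < \<epsilon>" using x assms by (simp add: field_simps)
    finally have "\<bar>f (g x)\<bar> \<le> C * rho w (g x) ^ p" by (rule C)
    also have "\<dots> \<le> C * (L * rho w x) ^ p" using g C rho_nonneg by (intro mult_left_mono power_mono) auto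
    finally show ?thesis by (simp add: power_mult_distrib)
  qed
  moreover have "0 < C * L ^ p" "0 < min \<delta> (\<epsilon> / L)" using C assms by auto
  ultimately show ?thesis unfolding bigo_rho_iff by blast
qed

lemma bigo_rho_mono:
  assumes "f \<in> O[nhds 0](\<lambda>x. rho w x ^ p)" "q \<le> p"
  shows "f \<in> O[nhds 0](\<lambda>x. rho w x ^ q)"
proof -
  obtain C \<epsilon> where C: "0 < C" "0 < \<epsilon>" "\<And>x. rho w x < \<epsilon> \<Longrightarrow> \<bar>f x\<bar> \<le> C * rho w x ^ p"
    using assms(1) unfolding bigo_rho_iff by blast
  have "\<bar>f x\<bar> \<le> C * rho w x ^ q" if "rho w x < min \<epsilon> 1" for x
    using that C(1) rho_nonneg assms(2)
    by (intro order.trans[OF C(3)] mult_left_mono power_decreasing) auto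
  then show ?thesis unfolding bigo_rho_iff using C by (intro exI[of _ C] conjI exI[of _ "min \<epsilon> 1"]) auto
qed

lemma coord_bigo: "(\<lambda>x. x $ k) \<in> O[nhds 0](\<lambda>x. rho w x ^ w k)"
  by (rule bigoI[of _ 1]) (use abs_le_rho[of _ k] rho_nonneg in simp)

text \<open>The change is a sum of \<theta>_l times a derivative of order m - w_l at a nearby point.
  For w_l at most m one extra order of \<theta>_l is needed; for w_l > m its order w_l is already at
  least m + 1, and boundedness of the derivative suffices.\<close>

lemma shift_bigo:
  assumes "open S" "0 \<in> S" "smooth_on S f" "vanishes w f (int m)"
    and "\<And>l. (\<lambda>x. \<theta> x $ l) \<in> O[nhds 0](\<lambda>x. rho w x ^ w l)"
    and "\<And>l. w l \<le> m \<Longrightarrow> (\<lambda>x. \<theta> x $ l) \<in> O[nhds 0](\<lambda>x. rho w x ^ (w l + 1))"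
  shows "(\<lambda>x. f (x + \<theta> x) - f x) \<in> O[nhds 0](\<lambda>x. rho w x ^ (m + 1))"
proof -
  \<comment> \<open>Chosen so that \<open>e l + (m - w l)\<close> is at least \<open>m + 1\<close>
    in both cases, the subtraction being truncated.\<close>
  define e where "e l = (if w l \<le> m then w l + 1 else w l)" for l
  have "partial_deriv k f \<in> O[nhds 0](\<lambda>x. rho w x ^ (m - w k))" for k
    by (intro bigo_of_vanishes[OF assms(1,2)] smooth_on_partial vanishes_partial_nat assms)
  then obtain C \<delta> where C: "0 < C" "0 < \<delta>"
    "\<And>k x. rho w x < \<delta> \<Longrightarrow> \<bar>partial_deriv k f x\<bar> \<le> C * rho w x ^ (m - w k)"
    using bigo_rho_uniform[of "\<lambda>k. partial_deriv k f" "\<lambda>k. m - w k"] by blast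
  have "(\<lambda>x. \<theta> x $ l) \<in> O[nhds 0](\<lambda>x. rho w x ^ e l)" for l
    using assms(5,6) by (simp add: e_def)
  then obtain M \<epsilon> where M: "0 < M" "0 < \<epsilon>"
    "\<And>k x. rho w x < \<epsilon> \<Longrightarrow> \<bar>\<theta> x $ k\<bar> \<le> M * rho w x ^ e k"
    using bigo_rho_uniform[of "\<lambda>k x. \<theta> x $ k" e] by blast
  obtain \<delta>0 where \<delta>0: "0 < \<delta>0" "\<And>x. rho w x < \<delta>0 \<Longrightarrow> x \<in> S"
    using rho_ball_subset[OF assms(1,2)] by blast
  define L where "L = CARD('n) * (1 + M)"
  have L: "1 \<le> L" unfolding L_def using M by (intro mult_ge1_I) auto
  define \<eta> where "\<eta> = Min {\<epsilon>, 1, \<delta> / L, \<delta>0 / L}"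
  have \<eta>: "0 < \<eta>" using M C \<delta>0 L by (simp add: \<eta>_def)
  have "\<bar>f (x + \<theta> x) - f x\<bar> \<le> (CARD('n) * (M * C * L ^ m)) * rho w x ^ (m + 1)"
    if x: "rho w x < \<eta>" for x
  proof -
    define s where "s = rho w x"
    have s: "0 \<le> s" "s \<le> 1" "s < \<epsilon>" "L * s < \<delta>" "L * s < \<delta>0"
      using x rho_nonneg L by (auto simp: s_def \<eta>_def field_simps)
    have \<theta>: "\<bar>\<theta> x $ k\<bar> \<le> M * s ^ e k" for k using M(3) s by (simp add: s_def)
    have near: "rho w (x + u *\<^sub>R \<theta> x) \<le> L * s" if "0 \<le> u" "u \<le> 1" for u
    proof -
      have "\<bar>(x + u *\<^sub>R \<theta> x) $ k\<bar> \<le> ((1 + M) * s) ^ w k" for k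
      proof -
        have "\<bar>u * \<theta> x $ k\<bar> \<le> M * s ^ e k"
          unfolding abs_mult using \<theta>[of k] that by (intro order.trans[OF mult_left_le_one_le]) auto
        also have "\<dots> \<le> M * s ^ w k" using M s by (intro mult_left_mono power_decreasing) (auto simp: e_def)
        finally have "\<bar>(x + u *\<^sub>R \<theta> x) $ k\<bar> \<le> s ^ w k + M * s ^ w k"
          using abs_le_rho[of x k] by (simp add: s_def)
        also have "\<dots> = (1 + M) * s ^ w k" by (simp add: algebra_simps)
        also have "\<dots> \<le> (1 + M) ^ w k * s ^ w k"
          using M weight_pos[of k] power_increasing[of 1 "w k" "1 + M"] s by (intro mult_right_mono) auto
        finally show ?thesis by (simp add: power_mult_distrib)
      qed
      from rho_le[OF _ this] show ?thesis using M s by (simp add: L_def mult.assoc)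
    qed
    have "f differentiable at (x + u *\<^sub>R \<theta> x)" if "0 \<le> u" "u \<le> 1" for u
      using near[OF that] s by (intro smooth_on_differentiable[OF assms(3)] \<delta>0) auto
    from mvt_partials[OF this] obtain u where u: "0 < u" "u < 1"
      "f (x + \<theta> x) - f x = (\<Sum>k\<in>UNIV. \<theta> x $ k * partial_deriv k f (x + u *\<^sub>R \<theta> x))" by blast
    have "\<bar>\<theta> x $ k * partial_deriv k f (x + u *\<^sub>R \<theta> x)\<bar> \<le> M * C * L ^ m * s ^ (m + 1)" for k
    proof -
      have nu: "rho w (x + u *\<^sub>R \<theta> x) \<le> L * s" using near[of u] u by simp
      have "\<bar>partial_deriv k f (x + u *\<^sub>R \<theta> x)\<bar> \<le> C * rho w (x + u *\<^sub>R \<theta> x) ^ (m - w k)"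
        using nu s by (intro C) auto
      also have "\<dots> \<le> C * (L * s) ^ (m - w k)"
        using nu C rho_nonneg by (intro mult_left_mono power_mono) auto
      also have "\<dots> = C * (L ^ (m - w k) * s ^ (m - w k))" by (simp add: power_mult_distrib)
      also have "\<dots> \<le> C * (L ^ m * s ^ (m - w k))"
        using L C s by (intro mult_left_mono mult_right_mono power_increasing) auto
      finally have "\<bar>\<theta> x $ k * partial_deriv k f (x + u *\<^sub>R \<theta> x)\<bar> \<le>
          (M * s ^ e k) * (C * (L ^ m * s ^ (m - w k)))"
        unfolding abs_mult using M s by (intro mult_mono \<theta>) auto
      also have "\<dots> = M * C * L ^ m * s ^ (e k + (m - w k))" by (simp add: power_add mult_ac)
      also have "\<dots> \<le> M * C * L ^ m * s ^ (m + 1)"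
        using M C L s by (intro mult_left_mono power_decreasing) (auto simp: e_def)
      finally show ?thesis .
    qed
    then have "(\<Sum>k\<in>UNIV. \<bar>\<theta> x $ k * partial_deriv k f (x + u *\<^sub>R \<theta> x)\<bar>) \<le>
        CARD('n) * (M * C * L ^ m * s ^ (m + 1))"
      by (intro order.trans[OF sum_bounded_above]) auto
    then show ?thesis unfolding u(3) s_def mult.assoc by (rule order.trans[OF sum_abs])
  qed
  moreover have "0 < CARD('n) * (M * C * L ^ m)" using M C L by simp
  ultimately show ?thesis unfolding bigo_rho_iff using \<eta> by blast
qed

text \<open>If \<open>rho\<close> at x + \<theta> x were far smaller than s, its value at x, then
  every |x_k| would be at most (s / 2n)^w_k, because \<theta> x is of higher order; hence s would be
  at most s / 2. This controls the preimage of a point without expanding the inverse map.\<close>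

lemma rho_le_rho_shift:
  fixes \<theta> :: "real^'n \<Rightarrow> real^'n"
  assumes "\<And>l. (\<lambda>x. \<theta> x $ l) \<in> O[nhds 0](\<lambda>x. rho w x ^ (w l + 1))"
  obtains L \<delta> where "0 < L" "0 < \<delta>" "\<And>x. rho w x < \<delta> \<Longrightarrow> rho w x \<le> L * rho w (x + \<theta> x)"
proof -
  obtain C \<delta> where C: "0 < C" "0 < \<delta>"
    "\<And>k x. rho w x < \<delta> \<Longrightarrow> \<bar>\<theta> x $ k\<bar> \<le> C * rho w x ^ (w k + 1)"
    using bigo_rho_uniform[of "\<lambda>k x. \<theta> x $ k" "\<lambda>k. w k + 1"] assms by blast
  define n where "n = real CARD('n)"
  have n: "1 \<le> n" by (simp add: n_def Suc_leI)
  define W where "W = (\<Sum>k\<in>UNIV. w k)"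
  have W: "w k \<le> W" for k unfolding W_def by (rule member_le_sum) auto
  \<comment> \<open>The two summands x + \<theta> x and - \<theta> x of x each receive one share
    \<open>\<epsilon>\<close>, and \<open>2 * \<epsilon>\<close> is at most (1 / 2n)^w_k for all k;
    the sum \<open>W\<close> bounds all weights at once.\<close>
  define \<epsilon> where "\<epsilon> = (1 / (2 * n)) ^ W / 2"
  have \<epsilon>: "0 < \<epsilon>" "\<epsilon> \<le> 1" "2 * \<epsilon> \<le> (1 / (2 * n)) ^ w k" for k
  proof -
    show "0 < \<epsilon>" using n by (simp add: \<epsilon>_def)
    have "(1 / (2 * n)) ^ W \<le> 1" using n by (intro power_le_one) auto
    then show "\<epsilon> \<le> 1" by (simp add: \<epsilon>_def)
    show "2 * \<epsilon> \<le> (1 / (2 * n)) ^ w k"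
    proof -
      have "2 * \<epsilon> = (1 / (2 * n)) ^ W" by (simp add: \<epsilon>_def)
      also have "\<dots> \<le> (1 / (2 * n)) ^ w k" using n W by (intro power_decreasing) auto
      finally show ?thesis .
    qed
  qed
  have "rho w x \<le> 1 / \<epsilon> * rho w (x + \<theta> x)" if x: "rho w x < min \<delta> (\<epsilon> / C)" for x
  proof (rule ccontr)
    assume contr: "\<not> ?thesis"
    define s where "s = rho w x"
    have s: "rho w (x + \<theta> x) < \<epsilon> * s" "C * s \<le> \<epsilon>"
      using contr x C \<epsilon>(1) by (auto simp: s_def field_simps)
    have s0: "0 < s" using s(1) rho_nonneg[of "x + \<theta> x"] \<epsilon>(1)
      by (meson le_less_trans zero_less_mult_pos)
    have "\<bar>x $ k\<bar> \<le> (s / (2 * n)) ^ w k" for k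
    proof -
      have "\<bar>x $ k\<bar> \<le> \<bar>(x + \<theta> x) $ k\<bar> + \<bar>\<theta> x $ k\<bar>" by simp
      also have "\<bar>(x + \<theta> x) $ k\<bar> \<le> (\<epsilon> * s) ^ w k"
        using s rho_nonneg by (intro order.trans[OF abs_le_rho] power_mono) auto
      also have "(\<epsilon> * s) ^ w k \<le> \<epsilon> * s ^ w k"
        using \<epsilon>(1,2) weight_pos[of k] power_decreasing[of 1 "w k" \<epsilon>] s0
        by (simp add: power_mult_distrib mult_right_mono)
      also have "\<bar>\<theta> x $ k\<bar> \<le> C * s ^ (w k + 1)" using C(3) x by (simp add: s_def)
      also have "C * s ^ (w k + 1) = (C * s) * s ^ w k" by simp
      also have "\<dots> \<le> \<epsilon> * s ^ w k" using s s0 by (intro mult_right_mono) auto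
      finally have "\<bar>x $ k\<bar> \<le> (2 * \<epsilon>) * s ^ w k" by simp
      also have "\<dots> \<le> (1 / (2 * n)) ^ w k * s ^ w k" using s0 by (intro mult_right_mono \<epsilon>) auto
      finally show ?thesis by (simp add: power_divide)
    qed
    from rho_le[OF _ this] have "s \<le> n * (s / (2 * n))" using s0 n by (simp add: s_def n_def)
    then show False using s0 n by simp
  qed
  then show ?thesis using that[of "1 / \<epsilon>" "min \<delta> (\<epsilon> / C)"] \<epsilon>(1) C by simp
qed

end

section \<open>Model fields\<close>

lemma continuous_on_dilation: "continuous_on T (dilation w t)"
  unfolding dilation_def by (intro continuous_intros)

lemma open_dilation_preimage: "open S \<Longrightarrow> open (dilation w t -` S)"
  by (rule open_vimage[OF _ continuous_on_dilation])

lemma smooth_on_dilation: "smooth_on T (dilation w t)"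
proof -
  have "smooth_on UNIV (dilation w t)"
    by (rule smooth_on_vec[OF open_UNIV])
      (simp add: dilation_def smooth_on_mult smooth_on_const smooth_on_coord)
  then show ?thesis using smooth_on_subset by blast
qed

lemma smooth_on_compose_dilation:
  assumes "open S" "smooth_on S g"
  shows "smooth_on (dilation w t -` S) (\<lambda>y. g (dilation w t y))"
  by (rule smooth_on_compose[OF open_dilation_preimage[OF assms(1)] assms(1) _ assms(2) smooth_on_dilation])
    auto

text \<open>A dilation is diagonal, so only one direction survives in the chain rule and each letter
  i contributes the factor t^w_i.\<close>

lemma iter_partial_dilation:
  fixes g :: "real^'n \<Rightarrow> real"
  assumes "open S" "smooth_on S g" "dilation w t x \<in> S"
  shows "iter_partial I (\<lambda>y. g (dilation w t y)) x = t ^ wt w I * iter_partial I g (dilation w t x)"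
  using assms(3)
proof (induction I arbitrary: x)
  case (Cons i I)
  let ?T = "dilation w t -` S" and ?h = "iter_partial I g"
  note T = open_dilation_preimage[OF assms(1), of w t]
  have x: "x \<in> ?T" using Cons.prems by simp
  have h: "smooth_on S ?h" by (rule smooth_on_iter_partial[OF assms(2)])
  have hd: "smooth_on ?T (\<lambda>y. ?h (dilation w t y))" by (rule smooth_on_compose_dilation[OF assms(1) h])
  have "iter_partial (i # I) (\<lambda>y. g (dilation w t y)) x =
      partial_deriv i (\<lambda>y. t ^ wt w I * ?h (dilation w t y)) x"
    unfolding iter_partial.simps by (rule partial_deriv_cong[OF T x]) (use Cons.IH in simp)
  also have "\<dots> = t ^ wt w I * partial_deriv i (\<lambda>y. ?h (dilation w t y)) x"
    by (rule partial_deriv_bounded_linear[OF bounded_linear_mult_right smooth_on_differentiable[OF hd x]])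
  also have "partial_deriv i (\<lambda>y. ?h (dilation w t y)) x =
      (\<Sum>k\<in>UNIV. partial_deriv i (\<lambda>y. dilation w t y $ k) x * partial_deriv k ?h (dilation w t x))"
    using partial_deriv_compose[of ?h "dilation w t" x i] smooth_on_differentiable[OF h Cons.prems]
      smooth_on_differentiable[OF smooth_on_dilation UNIV_I, of w t x] by simp
  also have "\<dots> = (\<Sum>k\<in>UNIV. if k = i then t ^ w k * partial_deriv k ?h (dilation w t x) else 0)"
  proof (rule sum.cong[OF refl])
    fix k
    have "partial_deriv i (\<lambda>y. t ^ w k * y $ k) x = t ^ w k * partial_deriv i (\<lambda>y. y $ k) x"
      by (intro partial_deriv_bounded_linear[OF bounded_linear_mult_right]
          smooth_on_differentiable[OF smooth_on_coord[of UNIV]]) auto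
    then show "partial_deriv i (\<lambda>y. dilation w t y $ k) x * partial_deriv k ?h (dilation w t x) =
        (if k = i then t ^ w k * partial_deriv k ?h (dilation w t x) else 0)"
      by (simp add: dilation_def partial_deriv_coord)
  qed
  also have "\<dots> = t ^ w i * partial_deriv i ?h (dilation w t x)" by simp
  finally show ?case by (simp add: power_add mult_ac)
qed simp

lemma iter_partial_scaled_pullback:
  assumes "open S" "smooth_on S B" "dilation w t x \<in> S"
  shows "iter_partial I (\<lambda>x. t ^ p *\<^sub>R dilation_pullback w t B x) x $ k =
    t ^ p * inverse (t ^ w k) * t ^ wt w I * iter_partial I (\<lambda>y. B y $ k) (dilation w t x)"
proof -
  let ?T = "dilation w t -` S" and ?F = "\<lambda>x. t ^ p *\<^sub>R dilation_pullback w t B x"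
  note T = open_dilation_preimage[OF assms(1), of w t]
  have x: "x \<in> ?T" using assms(3) by simp
  note Bk = smooth_on_component[OF assms(1,2)]
  have comp: "?F x $ j = t ^ p * inverse (t ^ w j) * B (dilation w t x) $ j" for x j
    by (simp add: dilation_pullback_def)
  have "smooth_on ?T ?F"
  proof (rule smooth_on_vec[OF T])
    fix j show "smooth_on ?T (\<lambda>x. ?F x $ j)"
      unfolding comp by (intro smooth_on_mult[OF T] smooth_on_const smooth_on_compose_dilation[OF assms(1) Bk])
  qed
  from iter_partial_component[OF T this x]
  have "iter_partial I ?F x $ k = iter_partial I (\<lambda>x. ?F x $ k) x" by metis
  also have "\<dots> = t ^ p * inverse (t ^ w k) * iter_partial I (\<lambda>x. B (dilation w t x) $ k) x"
    unfolding comp by (rule iter_partial_const_mult[OF T smooth_on_compose_dilation[OF assms(1) Bk] x])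
  finally show ?thesis by (simp add: iter_partial_dilation[OF assms(1) Bk assms(3)])
qed

text \<open>Multiplication by \<open>t ^ (q - p)\<close> leaves the constant \<open>c\<close>. The
  convention 0^0 = 1 joins two conclusions: \<open>c = 0\<close> for a genuinely negative power of
  t, and \<open>c = l\<close> when the powers cancel.\<close>

lemma monomial_limit_coeff:
  fixes c l :: real
  assumes "((\<lambda>t. t ^ p * inverse (t ^ q) * c) \<longlongrightarrow> l) (at 0)" "p \<le> q"
  shows "c = 0 ^ (q - p) * l"
proof -
  have "((\<lambda>t. t ^ (q - p) * (t ^ p * inverse (t ^ q) * c)) \<longlongrightarrow> 0 ^ (q - p) * l) (at 0)"
    by (intro tendsto_intros assms)
  moreover have "eventually (\<lambda>t::real. t ^ (q - p) * (t ^ p * inverse (t ^ q) * c) = c) (at 0)"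
    unfolding eventually_at_filter
  proof (intro always_eventually allI impI)
    fix t :: real assume t: "t \<noteq> 0"
    have "t ^ (q - p) * (t ^ p * inverse (t ^ q) * c) = (t ^ (q - p) * t ^ p) * inverse (t ^ q) * c"
      by (simp add: mult_ac)
    then show "t ^ (q - p) * (t ^ p * inverse (t ^ q) * c) = c"
      using t assms(2) by (simp flip: power_add)
  qed
  ultimately have "((\<lambda>t::real. c) \<longlongrightarrow> 0 ^ (q - p) * l) (at 0)"
    by (rule Lim_transform_eventually)
  then show ?thesis by (simp add: tendsto_const_iff)
qed

definition model_limit :: "('n::finite \<Rightarrow> nat) \<Rightarrow> nat \<Rightarrow> (real^'n \<Rightarrow> real^'n) \<Rightarrow> (real^'n \<Rightarrow> real^'n) \<Rightarrow> bool"
  where "model_limit w p B V \<longleftrightarrow>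
    smooth_convergence (\<lambda>t x. t ^ p *\<^sub>R dilation_pullback w t B x) V (at 0)"

section \<open>Taylor coefficients and the model limit\<close>

context weights
begin

lemma dilation_0 [simp]: "dilation w t 0 = 0"
  by (simp add: dilation_def vec_eq_iff)

lemma model_limit_at_zero:
  assumes "open S" "0 \<in> S" "smooth_on S B" "model_limit w p B V"
  shows "((\<lambda>t. t ^ (p + wt w I) * inverse (t ^ w k) * iter_partial I (\<lambda>y. B y $ k) 0)
    \<longlongrightarrow> iter_partial I V 0 $ k) (at 0)"
proof -
  have "uniform_limit {0} (\<lambda>t. iter_partial I (\<lambda>x. t ^ p *\<^sub>R dilation_pullback w t B x))
      (iter_partial I V) (at 0)"
    using assms(4) compact_sing[of 0] unfolding model_limit_def smooth_convergence_def by blast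
  from tendsto_vec_nth[OF tendsto_uniform_limitI[OF this, of 0]]
  show ?thesis
    using iter_partial_scaled_pullback[OF assms(1,3), of w _ 0] assms(2)
    by (simp add: power_add mult_ac)
qed

text \<open>For weights below \<open>w k - p\<close> the power of t at the origin is negative, and
  convergence leaves only the coefficient 0.\<close>

lemma vanishes_of_model_limit:
  assumes "open S" "0 \<in> S" "smooth_on S B" "model_limit w p B V"
  shows "vanishes w (\<lambda>x. B x $ k) (int (w k) - int p)"
  unfolding vanishes_def
proof (intro allI impI)
  fix I assume I: "int (wt w I) < int (w k) - int p"
  then have "w k - (p + wt w I) \<noteq> 0" "p + wt w I \<le> w k" by auto
  with monomial_limit_coeff[OF model_limit_at_zero[OF assms]]
  show "iter_partial I (\<lambda>x. B x $ k) 0 = 0" by (simp add: power_0_left)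
qed

text \<open>The difference tends to 0, which also removes the coefficients whose power of t is
  exactly 0; hence the extra unit.\<close>

lemma vanishes_of_same_model_limit:
  assumes "open S" "0 \<in> S" "smooth_on S B" "smooth_on S B'"
    and "model_limit w p B V" "model_limit w p B' V"
  shows "vanishes w (\<lambda>x. B' x $ k - B x $ k) (int (w k) - int p + 1)"
  unfolding vanishes_def
proof (intro allI impI)
  fix I assume I: "int (wt w I) < int (w k) - int p + 1"
  let ?a = "\<lambda>B. iter_partial I (\<lambda>x. B x $ k) 0"
  have "((\<lambda>t. t ^ (p + wt w I) * inverse (t ^ w k) * ?a B' - t ^ (p + wt w I) * inverse (t ^ w k) * ?a B)
      \<longlongrightarrow> iter_partial I V 0 $ k - iter_partial I V 0 $ k) (at 0)"
    by (intro tendsto_diff model_limit_at_zero[of S]) fact+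
  then have "((\<lambda>t. t ^ (p + wt w I) * inverse (t ^ w k) * (?a B' - ?a B)) \<longlongrightarrow> 0) (at 0)"
    by (simp add: right_diff_distrib)
  from monomial_limit_coeff[OF this] I have "?a B' - ?a B = 0" by simp
  moreover have "iter_partial I (\<lambda>x. B' x $ k - B x $ k) 0 = ?a B' - ?a B"
    by (rule iter_partial_diff[OF assms(1) _ _ assms(2)]; rule smooth_on_component; fact)
  ultimately show "iter_partial I (\<lambda>x. B' x $ k - B x $ k) 0 = 0" by simp
qed

text \<open>The rescaling divides by t to the power w_k - p - wt I, and the derivative of the
  difference supplies one power more. A factor |t| remains, uniformly on K because small dilations
  bring K close to 0.\<close>

lemma model_limit_perturb:
  assumes "open S" "0 \<in> S" "smooth_on S B" "smooth_on S B'" "model_limit w p B V"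
    and "\<And>k. vanishes w (\<lambda>x. B' x $ k - B x $ k) (int (w k) - int p + 1)"
  shows "model_limit w p B' V"
  unfolding model_limit_def smooth_convergence_def
proof (intro conjI allI impI)
  show "smooth_on UNIV V" using assms(5) by (simp add: model_limit_def smooth_convergence_def)
  fix K :: "(real^'n) set" and I assume K: "compact K"
  define F where "F B t = iter_partial I (\<lambda>x. t ^ p *\<^sub>R dilation_pullback w t B x)" for B t
  define g where "g k = iter_partial I (\<lambda>x. B' x $ k - B x $ k)" for k
  \<comment> \<open>If the required order is negative, \<open>nat\<close> replaces it by 0 and the
    estimate uses mere boundedness of the derivative.\<close>
  define e where "e k = nat (int (w k) - int p + 1 - int (wt w I))" for k
  note comp = smooth_on_component[OF assms(1,3)] smooth_on_component[OF assms(1,4)]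
  have gs: "smooth_on S (g k)" for k
    unfolding g_def by (intro smooth_on_iter_partial smooth_on_diff assms(1) comp)
  have gv: "vanishes w (g k) (int (e k))" for k
  proof -
    have "vanishes w (g k) (int (w k) - int p + 1 - int (wt w I))"
      unfolding vanishes_def
    proof (intro allI impI)
      fix J assume "int (wt w J) < int (w k) - int p + 1 - int (wt w I)"
      then have "iter_partial (J @ I) (\<lambda>x. B' x $ k - B x $ k) 0 = 0"
        using assms(6)[of k] unfolding vanishes_def by simp
      then show "iter_partial J (g k) 0 = 0" by (simp add: iter_partial_append g_def)
    qed
    then show ?thesis unfolding e_def by (rule vanishes_nat)
  qed
  obtain C \<delta> where C: "0 < C" "0 < \<delta>" "\<And>k x. rho w x < \<delta> \<Longrightarrow> \<bar>g k x\<bar> \<le> C * rho w x ^ e k"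
    using bigo_rho_uniform[of g e, OF bigo_of_vanishes[OF assms(1,2) gs gv]] by blast
  obtain \<delta>0 where \<delta>0: "0 < \<delta>0" "\<And>x. rho w x < \<delta>0 \<Longrightarrow> x \<in> S"
    using rho_ball_subset[OF assms(1,2)] by blast
  have "compact (rho w ` K)" using K continuous_on_rho by (rule compact_continuous_image[rotated])
  then obtain R0 where R0: "\<And>x. x \<in> K \<Longrightarrow> \<bar>rho w x\<bar> \<le> R0"
    using compact_imp_bounded bounded_real by (metis imageI)
  define R where "R = max 1 R0"
  have R: "1 \<le> R" "\<And>x. x \<in> K \<Longrightarrow> rho w x \<le> R" using R0 rho_nonneg by (force simp: R_def)+
  define Q where "Q = (\<Sum>k\<in>UNIV. C * R ^ e k)"
  have diff: "norm (F B' t x - F B t x) \<le> Q * \<bar>t\<bar>"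
    if t: "t \<noteq> 0" "\<bar>t\<bar> < 1" "\<bar>t\<bar> * R < \<delta>" "\<bar>t\<bar> * R < \<delta>0" and x: "x \<in> K" for t x
  proof -
    have r: "rho w (dilation w t x) \<le> \<bar>t\<bar> * R"
      unfolding rho_dilation using R(2)[OF x] by (intro mult_left_mono) auto
    have inS: "dilation w t x \<in> S" by (intro \<delta>0) (use r t in linarith)
    have "\<bar>(F B' t x - F B t x) $ k\<bar> \<le> C * R ^ e k * \<bar>t\<bar>" for k
    proof -
      have d: "g k (dilation w t x) = iter_partial I (\<lambda>x. B' x $ k) (dilation w t x) -
          iter_partial I (\<lambda>x. B x $ k) (dilation w t x)"
        unfolding g_def by (rule iter_partial_diff[OF assms(1) comp(2) comp(1) inS])
      have "(F B' t x - F B t x) $ k = t ^ (p + wt w I) * inverse (t ^ w k) * g k (dilation w t x)"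
        by (simp add: d F_def iter_partial_scaled_pullback[OF assms(1,3) inS]
            iter_partial_scaled_pullback[OF assms(1,4) inS] power_add algebra_simps)
      also have "\<bar>\<dots>\<bar> \<le> \<bar>t\<bar> ^ (p + wt w I) * inverse (\<bar>t\<bar> ^ w k) * (C * (\<bar>t\<bar> * R) ^ e k)"
      proof -
        have "\<bar>g k (dilation w t x)\<bar> \<le> C * rho w (dilation w t x) ^ e k"
          by (intro C) (use r t in linarith)
        also have "\<dots> \<le> C * (\<bar>t\<bar> * R) ^ e k"
          using r C rho_nonneg by (intro mult_left_mono power_mono) auto
        finally show ?thesis by (simp add: abs_mult power_abs mult_left_mono)
      qed
      also have "\<dots> = C * R ^ e k * inverse (\<bar>t\<bar> ^ w k) * \<bar>t\<bar> ^ (p + wt w I + e k)"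
        by (simp add: power_add power_mult_distrib mult_ac)
      \<comment> \<open>\<open>p + wt w I + e k\<close> is at least \<open>w k + 1\<close> also in
        the truncated case, and |t| < 1.\<close>
      also have "\<dots> \<le> C * R ^ e k * inverse (\<bar>t\<bar> ^ w k) * \<bar>t\<bar> ^ (w k + 1)"
        using C R t by (intro mult_left_mono power_decreasing) (auto simp: e_def)
      also have "\<dots> = C * R ^ e k * \<bar>t\<bar>" using t by simp
      finally show ?thesis .
    qed
    then show ?thesis unfolding Q_def sum_distrib_right
      by (intro order.trans[OF norm_le_l1_cart] sum_mono)
  qed
  have "0 \<le> Q" unfolding Q_def using C R by (intro sum_nonneg) auto
  have "uniform_limit K (\<lambda>t x. F B' t x - F B t x) (\<lambda>x. 0) (at 0)"
  proof (rule uniform_limitI)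
    fix \<epsilon> :: real assume \<epsilon>: "0 < \<epsilon>"
    define d where "d = Min {1, \<delta> / R, \<delta>0 / R, \<epsilon> / (Q + 1)}"
    have d: "0 < d" using C \<delta>0 R \<epsilon> \<open>0 \<le> Q\<close> by (simp add: d_def)
    show "eventually (\<lambda>t. \<forall>x\<in>K. dist (F B' t x - F B t x) 0 < \<epsilon>) (at 0)"
      unfolding eventually_at
    proof (intro exI[of _ d] conjI d ballI impI)
      fix t :: real and x assume t: "t \<noteq> 0 \<and> dist t 0 < d" and x: "x \<in> K"
      have "norm (F B' t x - F B t x) \<le> Q * \<bar>t\<bar>"
        using t x R by (intro diff) (auto simp: d_def field_simps)
      also have "\<dots> \<le> (Q + 1) * \<bar>t\<bar>" by (intro mult_right_mono) auto
      also have "\<dots> < \<epsilon>" using t \<open>0 \<le> Q\<close> by (auto simp: d_def field_simps)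
      finally show "dist (F B' t x - F B t x) 0 < \<epsilon>" by simp
    qed
  qed
  moreover have "uniform_limit K (F B) (iter_partial I V) (at 0)"
    using assms(5) K unfolding model_limit_def smooth_convergence_def F_def by blast
  ultimately have "uniform_limit K (\<lambda>t x. (F B' t x - F B t x) + F B t x) (\<lambda>x. 0 + iter_partial I V x) (at 0)"
    by (rule uniform_limit_add)
  then show "uniform_limit K (\<lambda>t. iter_partial I (\<lambda>x. t ^ p *\<^sub>R dilation_pullback w t B' x)) (iter_partial I V) (at 0)"
    by (simp add: F_def)
qed

end

section \<open>Change of coordinates\<close>

lemma vf_op_coord: "vf_op V (\<lambda>x. x $ k) x = V x $ k"
  by (simp add: vf_op_def partial_deriv_coord if_distrib[of "\<lambda>z. _ * z"] cong: if_cong)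

lemma vf_op_diff:
  assumes "f differentiable (at x)" "g differentiable (at x)"
  shows "vf_op V (\<lambda>x. f x - g x) x = vf_op V f x - vf_op V g x"
proof -
  have "(\<lambda>x. - g x) differentiable (at x)" using assms(2) by simp
  moreover have "partial_deriv k (\<lambda>x. - g x) x = - partial_deriv k g x" for k
    using partial_deriv_bounded_linear[OF bounded_linear_minus[OF bounded_linear_ident] assms(2)] .
  ultimately have "partial_deriv k (\<lambda>x. f x - g x) x = partial_deriv k f x - partial_deriv k g x" for k
    using partial_deriv_add[OF assms(1), of "\<lambda>x. - g x" k] by simp
  then show ?thesis by (simp add: vf_op_def right_diff_distrib sum_subtractf)
qed

text \<open>\<open>B'\<close> holds the coefficients of the same fields in the coordinates \<phi>,
  and \<open>B'_phi\<close> is their transformation law. Continuity of \<psi> at 0 serves to pull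
  neighbourhoods of 0 back to the image side.\<close>

locale frame_change = adapted_frame w S B for w :: "'n::finite \<Rightarrow> nat" and S B +
  fixes \<phi> \<psi> :: "real^'n \<Rightarrow> real^'n" and B' :: "'n \<Rightarrow> real^'n \<Rightarrow> real^'n"
  assumes phi_smooth: "smooth_on S \<phi>"
    and open_image: "open (\<phi> ` S)"
    and psi_phi: "x \<in> S \<Longrightarrow> \<psi> (\<phi> x) = x"
    and psi_cont: "isCont \<psi> 0"
    and phi_0: "\<phi> 0 = 0"
    and B'_smooth: "smooth_on (\<phi> ` S) (B' j)"
    and B'_phi: "x \<in> S \<Longrightarrow> B' j (\<phi> x) $ k = vf_op (B j) (\<lambda>x. \<phi> x $ k) x"
begin

definition \<theta> where "\<theta> x = \<phi> x - x"

lemma phi_component_smooth: "smooth_on S (\<lambda>x. \<phi> x $ k)"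
  by (rule smooth_on_component[OF open_S phi_smooth])

lemma theta_smooth: "smooth_on S (\<lambda>x. \<theta> x $ k)"
  unfolding \<theta>_def vector_minus_component
  by (intro smooth_on_diff open_S phi_component_smooth smooth_on_coord)

lemma vf_op_theta: "x \<in> S \<Longrightarrow> vf_op (B j) (\<lambda>x. \<theta> x $ k) x = B' j (\<phi> x) $ k - B j x $ k"
  unfolding \<theta>_def vector_minus_component
  using vf_op_diff[of "\<lambda>x. \<phi> x $ k" x "\<lambda>x. x $ k" "B j"]
  by (simp add: smooth_on_differentiable[OF phi_component_smooth]
      smooth_on_differentiable[OF smooth_on_coord UNIV_I] vf_op_coord B'_phi)

lemma coord_vanishes: "vanishes w (\<lambda>x. x $ k) (int (w k))"
  by (rule vanishes_of_bigo[OF open_UNIV UNIV_I smooth_on_coord coord_bigo])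

lemma B_vanishes_nat: "w j \<le> w k \<Longrightarrow> vanishes w (\<lambda>x. B j x $ k) (int (w k - w j))"
  using B_vanishes[of j k] by (simp add: of_nat_diff)

text \<open>\<open>B\<close> lives on \<open>S\<close> and \<open>B'\<close> on its image, but the
  model fields compare them as functions of one and the same variable.\<close>

lemma common_domain: "open (S \<inter> \<phi> ` S)" "0 \<in> S \<inter> \<phi> ` S"
  using open_S zero_in_S open_image phi_0 by (auto intro: image_eqI[of 0 \<phi> 0])

lemma difference_smooth: "smooth_on (S \<inter> \<phi> ` S) (\<lambda>x. B' j x $ k - B j x $ k)"
  by (intro smooth_on_diff common_domain smooth_on_component)
    (rule smooth_on_subset[OF B'_smooth] smooth_on_subset[OF B_smooth], blast)+

text \<open>Induction on the weight: \<open>X\<^sub>j \<theta>\<^sub>k = (B' - B)\<^sub>j\<^sub>k \<circ> \<phi> + (B\<^sub>j\<^sub>k \<circ> \<phi> - B\<^sub>j\<^sub>k)\<close>, and up to higher order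
  \<open>B\<^sub>j\<^sub>k\<close> only involves coordinates of weight at most \<open>w\<^sub>k - w\<^sub>j < w\<^sub>k\<close>.\<close>

lemma theta_vanishes:
  assumes words: "\<And>I k. wt w I < w k \<Longrightarrow> vf_word B I (\<lambda>x. \<phi> x $ k) 0 = 0"
    and models: "\<And>j. model_limit w (w j) (B j) (V j)" "\<And>j. model_limit w (w j) (B' j) (V j)"
  shows "vanishes w (\<lambda>x. \<theta> x $ k) (int (w k) + 1)"
proof (induction "w k" arbitrary: k rule: less_induct)
  case less
  have phi_v: "vanishes w (\<lambda>x. \<phi> x $ l) (int (w l))" for l
    by (rule vanishes_of_vf_words[OF phi_component_smooth]) (simp add: words)
  have theta_v: "vanishes w (\<lambda>x. \<theta> x $ l) (int (w l))" for l
    unfolding vanishes_def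
  proof (intro allI impI)
    fix I assume "int (wt w I) < int (w l)"
    then show "iter_partial I (\<lambda>x. \<theta> x $ l) 0 = 0"
      unfolding \<theta>_def vector_minus_component
      using phi_v[of l] coord_vanishes[of l]
        iter_partial_diff[OF open_S phi_component_smooth smooth_on_coord zero_in_S, of I l l]
      by (simp add: vanishes_def)
  qed
  have theta_O: "(\<lambda>x. \<theta> x $ l) \<in> O[nhds 0](\<lambda>x. rho w x ^ w l)" for l
    by (rule bigo_of_vanishes[OF open_S zero_in_S theta_smooth theta_v])
  have phi_O: "(\<lambda>x. \<phi> x $ l) \<in> O[nhds 0](\<lambda>x. rho w x ^ w l)" for l
    by (rule bigo_of_vanishes[OF open_S zero_in_S phi_component_smooth phi_v])
  obtain L \<delta> where L: "0 < L" "0 < \<delta>" "\<And>x. rho w x < \<delta> \<Longrightarrow> rho w (\<phi> x) \<le> L * rho w x"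
    using rho_bigo[OF phi_O] by blast
  show ?case
  proof (rule vanishes_of_vf_words[OF theta_smooth])
    fix I assume I: "int (wt w I) < int (w k) + 1"
    show "vf_word B I (\<lambda>x. \<theta> x $ k) 0 = 0"
    proof (cases I rule: rev_cases)
      case Nil then show ?thesis by (simp add: \<theta>_def phi_0)
    next
      case (snoc J j)
      \<comment> \<open>The innermost field is split off: once \<open>g\<close>, which is X_j
        \<theta>_k, is seen to have order \<open>m + 1\<close>, the remaining word \<open>J\<close>
        of weight at most \<open>m\<close> annihilates it at 0.\<close>
      define m where "m = w k - w j"
      have wj: "w j \<le> w k" "wt w J < m + 1" "m < w k" "int (w k) - int (w j) = int m"
        using I snoc weight_pos[of j] by (auto simp: m_def)
      define g where "g = vf_op (B j) (\<lambda>x. \<theta> x $ k)"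
      have gs: "smooth_on S g" unfolding g_def by (rule vf_op_smooth[OF open_S B_smooth theta_smooth])
      have "(\<lambda>x. B' j x $ k - B j x $ k) \<in> O[nhds 0](\<lambda>x. rho w x ^ (m + 1))"
      proof (rule bigo_of_vanishes[OF common_domain difference_smooth])
        have "vanishes w (\<lambda>x. B' j x $ k - B j x $ k) (int (w k) - int (w j) + 1)"
          by (rule vanishes_of_same_model_limit[OF common_domain _ _ models])
            (rule smooth_on_subset[OF B'_smooth] smooth_on_subset[OF B_smooth], blast)+
        then show "vanishes w (\<lambda>x. B' j x $ k - B j x $ k) (int (m + 1))" by (simp add: wj(4) add.commute)
      qed
      from bigo_compose[OF this L]
      have 1: "(\<lambda>x. B' j (\<phi> x) $ k - B j (\<phi> x) $ k) \<in> O[nhds 0](\<lambda>x. rho w x ^ (m + 1))" .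
      have "(\<lambda>x. B j (x + \<theta> x) $ k - B j x $ k) \<in> O[nhds 0](\<lambda>x. rho w x ^ (m + 1))"
      proof (rule shift_bigo[OF open_S zero_in_S smooth_on_component[OF open_S B_smooth]])
        show "vanishes w (\<lambda>x. B j x $ k) (int m)" unfolding m_def by (rule B_vanishes_nat[OF wj(1)])
        \<comment> \<open>Since w_j is positive, \<open>m < w k\<close>, so the induction hypothesis
          covers this component.\<close>
        fix l assume "w l \<le> m"
        then have "vanishes w (\<lambda>x. \<theta> x $ l) (int (w l + 1))" using less[of l] wj(3) by (simp add: add.commute)
        then show "(\<lambda>x. \<theta> x $ l) \<in> O[nhds 0](\<lambda>x. rho w x ^ (w l + 1))"
          by (rule bigo_of_vanishes[OF open_S zero_in_S theta_smooth])
      qed (rule theta_O)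
      from sum_in_bigo(1)[OF 1 this]
      have "(\<lambda>x. B' j (\<phi> x) $ k - B j x $ k) \<in> O[nhds 0](\<lambda>x. rho w x ^ (m + 1))"
        by (simp add: \<theta>_def)
      moreover have "eventually (\<lambda>x. g x = B' j (\<phi> x) $ k - B j x $ k) (nhds 0)"
        using eventually_nhds_in_open[OF open_S zero_in_S]
        by eventually_elim (simp add: g_def vf_op_theta)
      ultimately have "g \<in> O[nhds 0](\<lambda>x. rho w x ^ (m + 1))"
        by (simp add: landau_o.big.in_cong)
      from vanishes_of_bigo[OF open_S zero_in_S gs this] wj(2)
      have "vf_word B J g 0 = 0" by (intro vf_word_at_zero[OF gs]) auto
      then show ?thesis by (simp add: snoc vf_word_append g_def)
    qed
  qed
qed

section \<open>From the weighted bound to the orders of the coordinates and the model fields\<close>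

context
  assumes theta_O: "\<And>k. (\<lambda>x. \<theta> x $ k) \<in> O[nhds 0](\<lambda>x. rho w x ^ (w k + 1))"
begin

lemma theta_vanishes': "vanishes w (\<lambda>x. \<theta> x $ k) (int (w k) + 1)"
  using vanishes_of_bigo[OF open_S zero_in_S theta_smooth theta_O, of k] by (simp add: add.commute)

lemma phi_words_vanish:
  assumes "wt w I < w k"
  shows "vf_word B I (\<lambda>x. \<phi> x $ k) 0 = 0"
proof (rule vf_word_at_zero[OF phi_component_smooth])
  have "vanishes w (\<lambda>x. x $ k + \<theta> x $ k) (int (w k))"
    by (intro vanishes_add[OF open_S zero_in_S] smooth_on_coord theta_smooth coord_vanishes
        vanishes_mono[OF theta_vanishes']) simp
  then show "vanishes w (\<lambda>x. \<phi> x $ k) (int (w k))" by (simp add: \<theta>_def)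
qed (use assms in simp)

text \<open>Both X_j \<theta>_k and the shift of \<open>B\<close> have order m + 1, which bounds B'
  - B at the point \<open>\<phi> x\<close> in terms of \<open>rho\<close> at x. The bound is carried
  over to y = \<open>\<phi> x\<close> through \<psi>, where \<open>rho_le_rho_shift\<close> compares
  \<open>rho\<close> at \<psi> y with \<open>rho\<close> at y.\<close>

lemma same_model_limit:
  assumes "model_limit w (w j) (B j) V"
  shows "model_limit w (w j) (B' j) V"
proof (rule model_limit_perturb[OF common_domain _ _ assms])
  show "smooth_on (S \<inter> \<phi> ` S) (B j)" "smooth_on (S \<inter> \<phi> ` S) (B' j)"
    by (rule smooth_on_subset[OF B'_smooth] smooth_on_subset[OF B_smooth], blast)+
  fix k
  show "vanishes w (\<lambda>x. B' j x $ k - B j x $ k) (int (w k) - int (w j) + 1)"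
  proof (cases "w j \<le> w k")
    \<comment> \<open>Here \<open>w k - w j + 1\<close> is at most 0 and nothing is claimed.\<close>
    case False then show ?thesis by (simp add: vanishes_def)
  next
    case True
    define m where "m = w k - w j"
    have m: "int (w k) - int (w j) = int m" using True by (simp add: m_def)
    define h where "h x = B' j (\<phi> x) $ k - B j (\<phi> x) $ k" for x
    define g where "g = vf_op (B j) (\<lambda>x. \<theta> x $ k)"
    have gs: "smooth_on S g" unfolding g_def by (rule vf_op_smooth[OF open_S B_smooth theta_smooth])
    have "vanishes w g (int (w k) + 1 - int (w j))"
      unfolding g_def by (rule vanishes_vf_op[OF theta_smooth theta_vanishes'])
    then have "vanishes w g (int (m + 1))" using m by (simp add: algebra_simps)
    from bigo_of_vanishes[OF open_S zero_in_S gs this]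
    have 1: "g \<in> O[nhds 0](\<lambda>x. rho w x ^ (m + 1))" .
    have "(\<lambda>x. B j (x + \<theta> x) $ k - B j x $ k) \<in> O[nhds 0](\<lambda>x. rho w x ^ (m + 1))"
    proof (rule shift_bigo[OF open_S zero_in_S smooth_on_component[OF open_S B_smooth]])
      show "vanishes w (\<lambda>x. B j x $ k) (int m)" unfolding m_def by (rule B_vanishes_nat[OF True])
      show "(\<lambda>x. \<theta> x $ l) \<in> O[nhds 0](\<lambda>x. rho w x ^ w l)" for l
        by (rule bigo_rho_mono[OF theta_O]) simp
    qed (rule theta_O)
    from sum_in_bigo(2)[OF 1 this]
    have "(\<lambda>x. g x - (B j (\<phi> x) $ k - B j x $ k)) \<in> O[nhds 0](\<lambda>x. rho w x ^ (m + 1))"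
      by (simp add: \<theta>_def)
    moreover have "eventually (\<lambda>x. h x = g x - (B j (\<phi> x) $ k - B j x $ k)) (nhds 0)"
      using eventually_nhds_in_open[OF open_S zero_in_S]
      by eventually_elim (simp add: g_def h_def vf_op_theta)
    ultimately have h: "h \<in> O[nhds 0](\<lambda>x. rho w x ^ (m + 1))"
      by (simp add: landau_o.big.in_cong)
    obtain L \<delta> where L: "0 < L" "0 < \<delta>" "\<And>x. rho w x < \<delta> \<Longrightarrow> rho w x \<le> L * rho w (x + \<theta> x)"
      using rho_le_rho_shift[OF theta_O] by blast
    have right_inverse: "eventually (\<lambda>y. \<phi> (\<psi> y) = y) (nhds 0)"
      using eventually_nhds_in_open[OF open_image, of 0] common_domain(2)
      by (auto elim!: eventually_mono simp: psi_phi)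
    have "(\<psi> \<longlongrightarrow> \<psi> 0) (nhds 0)"
      using psi_cont tendsto_at_iff_tendsto_nhds[of \<psi> 0] by (simp add: isCont_def)
    then have lim: "(\<psi> \<longlongrightarrow> 0) (nhds 0)" using psi_phi[OF zero_in_S] by (simp add: phi_0)
    have "eventually (\<lambda>x. rho w x < \<delta>) (nhds 0)" using L unfolding eventually_nhds_rho by blast
    from eventually_compose_filterlim[OF this lim]
    have "eventually (\<lambda>y. rho w (\<psi> y) < \<delta>) (nhds 0)" .
    with right_inverse have "eventually (\<lambda>y. rho w (\<psi> y) \<le> L * rho w y) (nhds 0)"
    proof eventually_elim
      case (elim y)
      then show ?case using L(3)[of "\<psi> y"] by (simp add: \<theta>_def)
    qed
    then obtain \<delta>' where "0 < \<delta>'" "\<And>y. rho w y < \<delta>' \<Longrightarrow> rho w (\<psi> y) \<le> L * rho w y"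
      unfolding eventually_nhds_rho by blast
    from bigo_compose[OF h L(1) this]
    have "(\<lambda>y. h (\<psi> y)) \<in> O[nhds 0](\<lambda>x. rho w x ^ (m + 1))" .
    moreover have "eventually (\<lambda>y. B' j y $ k - B j y $ k = h (\<psi> y)) (nhds 0)"
      using right_inverse by eventually_elim (simp add: h_def)
    ultimately have "(\<lambda>y. B' j y $ k - B j y $ k) \<in> O[nhds 0](\<lambda>x. rho w x ^ (m + 1))"
      by (simp add: landau_o.big.in_cong)
    from vanishes_of_bigo[OF common_domain difference_smooth this] show ?thesis
      by (simp add: m add.commute)
  qed
qed

end

end

section \<open>Left-invariant fields of the tangent group\<close>

text \<open>The innermost bracket has both entries in {x, 0} and is 0; every outer one is then a
  bracket with 0.\<close>

lemma nested_bracket_degenerate: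
  assumes "b 0 0 = 0" "b x 0 = 0" "b 0 x = 0" "b x x = 0"
  shows "set zs \<subseteq> {x, 0} \<Longrightarrow> 2 \<le> length zs \<Longrightarrow> nested_bracket b zs = 0"
proof (induction zs)
  case (Cons z zs)
  then obtain z' zs' where zs: "zs = z' # zs'" by (cases zs) auto
  show ?case
  proof (cases "zs' = []")
    case False
    then have "nested_bracket b zs = 0" using Cons zs by (cases zs') auto
    then show ?thesis using Cons.prems zs assms by auto
  qed (use Cons.prems zs assms in auto)
qed simp

text \<open>Indices of degree at least 2 give degenerate brackets, and in degree 1 the pair (0, 1)
  gives the second argument, which is 0. The single index left contributes x, and it is admissible
  because the step is at least 1.\<close>

lemma dynkin_product_0_right:
  fixes b :: "'v::real_vector \<Rightarrow> 'v \<Rightarrow> 'v"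
  assumes "b 0 0 = 0" "b x 0 = 0" "b 0 x = 0" "b x x = 0" and r: "1 \<le> r"
  shows "dynkin_product r b x 0 = x"
proof -
  define F where "F ps = ((-1) ^ (length ps - 1) / (real (length ps) * real (dynkin_degree ps) *
        prod_list (map (\<lambda>(p, q). fact p * fact q) ps))) *\<^sub>R
      nested_bracket b (concat (map (\<lambda>(p, q). replicate p x @ replicate q 0) ps))" for ps
  have len: "length (concat (map (\<lambda>(p, q). replicate p x @ replicate q (0::'v)) ps)) = dynkin_degree ps"
    for ps by (induction ps) (auto simp: dynkin_degree_def)
  have "F ps = 0" if ps: "ps \<in> dynkin_indices r" "ps \<noteq> [(1, 0)]" for ps
  proof (cases "2 \<le> dynkin_degree ps")
    case True
    moreover have "set (concat (map (\<lambda>(p, q). replicate p x @ replicate q 0) ps)) \<subseteq> {x, 0}"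
      by (simp add: split_beta UN_subset_iff set_replicate_conv_if)
    ultimately have "nested_bracket b (concat (map (\<lambda>(p, q). replicate p x @ replicate q 0) ps)) = 0"
      using nested_bracket_degenerate[OF assms(1-4)] len by metis
    then show ?thesis by (simp add: F_def)
  next
    case False
    from ps obtain p q ps' where [simp]: "ps = (p, q) # ps'" and pos: "0 < p + q" "\<forall>(p, q)\<in>set ps'. 0 < p + q"
      by (cases ps) (auto simp: dynkin_indices_def)
    have "ps' = []" using False pos by (cases ps') (auto simp: dynkin_degree_def)
    then have "p = 0" "q = 1" using False pos ps(2) by (auto simp: dynkin_degree_def)
    then show ?thesis using \<open>ps' = []\<close> by (simp add: F_def)
  qed
  then have "(\<Sum>ps\<in>dynkin_indices r. F ps) = (\<Sum>ps\<in>{[(1, 0)]}. F ps)"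
    using r by (intro sum.mono_neutral_right finite_dynkin_indices)
      (auto simp: dynkin_indices_def dynkin_degree_def)
  then show ?thesis by (simp add: dynkin_product_def F_def dynkin_degree_def)
qed

lemma graded_bracket_0: "graded_bracket w L 0 v = 0" "graded_bracket w L u 0 = 0"
  by (simp_all add: graded_bracket_def vec_eq_iff cong: if_cong)

text \<open>Exchanging the two summation indices changes the sign. Antisymmetry is asked for exactly
  at the entries that the graded bracket reads.\<close>

lemma graded_bracket_self:
  assumes "\<And>i j k. w k = w i + w j \<Longrightarrow> L j i $ k = - L i j $ k"
  shows "graded_bracket w L u u = 0"
proof -
  have "graded_bracket w L u u $ k = 0" for k
  proof -
    let ?t = "\<lambda>i j. if w k = w i + w j then u $ i * u $ j * L i j $ k else 0"
    have "(\<Sum>i\<in>UNIV. \<Sum>j\<in>UNIV. ?t i j) = (\<Sum>j\<in>UNIV. \<Sum>i\<in>UNIV. ?t i j)" by (rule sum.swap)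
    also have "\<dots> = (\<Sum>j\<in>UNIV. \<Sum>i\<in>UNIV. - ?t j i)"
    proof (intro sum.cong refl)
      fix i j
      show "?t i j = - ?t j i"
      proof (cases "w k = w i + w j")
        case True
        moreover have "w k = w j + w i" using True by simp
        ultimately show ?thesis using assms[OF True] by simp
      qed (auto simp: add.commute)
    qed
    also have "\<dots> = - (\<Sum>i\<in>UNIV. \<Sum>j\<in>UNIV. ?t i j)" by (simp add: sum_negf)
    finally show ?thesis by (simp add: graded_bracket_def)
  qed
  then show ?thesis by (simp add: vec_eq_iff)
qed

lemma left_invariant_unique:
  assumes "left_invariant pr V" "left_invariant pr V'" "V 0 = V' 0" "\<And>x. pr x 0 = x"
  shows "V = V'"
proof
  fix x
  show "V x = V' x" using assms unfolding left_invariant_def by metis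
qed

section \<open>Charts and tangent vectors\<close>

lemma chart_open: "is_chart (U, x) \<Longrightarrow> open U"
  and chart_open_image: "is_chart (U, x) \<Longrightarrow> open (x ` U)"
  by (auto simp: is_chart_def)

lemma chart_inv:
  assumes "is_chart (U, x)"
  shows "p \<in> U \<Longrightarrow> inv_into U x (x p) = p"
    and "continuous_on U x" and "continuous_on (x ` U) (inv_into U x)"
  using assms by (auto simp: is_chart_def homeomorphism_def)

lemma chart_image_open:
  assumes "is_chart (U, x)" "open V"
  shows "open (x ` (U \<inter> V))"
proof -
  have "x ` (U \<inter> V) = x ` U \<inter> inv_into U x -` V" using chart_inv(1)[OF assms(1)] by force
  then show ?thesis
    using continuous_open_preimage[OF chart_inv(3) chart_open_image assms(2)] assms(1) by simp
qed

lemma local_coords_smooth_transition: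
  assumes "local_coords A (U, x)" "(W, z) \<in> A"
  shows "smooth_on (x ` (U \<inter> W)) (z \<circ> inv_into U x)" "smooth_on (z ` (W \<inter> U)) (x \<circ> inv_into W z)"
  using assms by (auto simp: local_coords_def smooth_transition_def)

lemma smooth_fun_subset:
  assumes "smooth_fun A V f" "V' \<subseteq> V"
  shows "smooth_fun A V' f"
  unfolding smooth_fun_def
proof (intro ballI, clarify)
  fix W z assume "(W, z) \<in> A"
  then have "smooth_on (z ` (W \<inter> V)) (f \<circ> inv_into W z)"
    using assms(1) by (auto simp: smooth_fun_def)
  then show "smooth_on (z ` (W \<inter> V')) (f \<circ> inv_into W z)"
    by (rule smooth_on_subset) (use assms(2) in blast)
qed

text \<open>The chart is compatible with the atlas but may lie outside it: functions and tangent
  vectors are defined through atlas charts, while both the given coordinates and the new ones are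
  arbitrary local coordinates.\<close>

locale chart_at =
  fixes A :: "('m::{t2_space,second_countable_topology}, 'n::finite) chart set"
    and U :: "'m set" and x :: "'m \<Rightarrow> real^'n"
  assumes atlas: "smooth_atlas A" and coords: "local_coords A (U, x)"
begin

lemma chart: "is_chart (U, x)"
  using coords by (simp add: local_coords_def)

lemma atlas_chart: "(W, z) \<in> A \<Longrightarrow> is_chart (W, z)"
  using atlas by (auto simp: smooth_atlas_def)

lemma in_atlas_chart:
  assumes "p \<in> U"
  obtains W z where "(W, z) \<in> A" "p \<in> W"
  using coords assms unfolding local_coords_def manifold_of_def by fastforce

lemma inv_x [simp]: "p \<in> U \<Longrightarrow> inv_into U x (x p) = p"
  by (rule chart_inv(1)[OF chart])

lemma image_open: "open V \<Longrightarrow> open (x ` (U \<inter> V))"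
  by (rule chart_image_open[OF chart])

text \<open>\<open>smooth_fun\<close> tests atlas charts only, so near each point the expression is
  routed through an atlas chart and a transition map; smoothness is local.\<close>

lemma smooth_on_of_smooth_fun:
  assumes "open V" "smooth_fun A V f"
  shows "smooth_on (x ` (U \<inter> V)) (f \<circ> inv_into U x)"
proof (rule smooth_on_local)
  fix y assume "y \<in> x ` (U \<inter> V)"
  then obtain p where p: "y = x p" "p \<in> U" "p \<in> V" by blast
  obtain W z where W: "(W, z) \<in> A" "p \<in> W" using in_atlas_chart p by blast
  note cW = atlas_chart[OF W(1)]
  let ?T = "x ` (U \<inter> (V \<inter> W))"
  have T: "open ?T" using assms(1) chart_open[OF cW] by (intro image_open) auto
  have "smooth_on ?T (\<lambda>y. (f \<circ> inv_into W z) ((z \<circ> inv_into U x) y))"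
  proof (rule smooth_on_compose[OF T chart_image_open[OF cW assms(1)]])
    show "(z \<circ> inv_into U x) ` ?T \<subseteq> z ` (W \<inter> V)" by auto
    show "smooth_on (z ` (W \<inter> V)) (f \<circ> inv_into W z)"
      using assms(2) W by (auto simp: smooth_fun_def)
    show "smooth_on ?T (z \<circ> inv_into U x)"
      by (rule smooth_on_subset[OF local_coords_smooth_transition(1)[OF coords W(1)]]) auto
  qed
  then have "smooth_on ?T (f \<circ> inv_into U x)"
    by (rule smooth_on_cong[OF T, rotated]) (auto simp: chart_inv(1)[OF cW])
  moreover have "y \<in> ?T" using p W by blast
  ultimately show "\<exists>T. y \<in> T \<and> smooth_on T (f \<circ> inv_into U x)" by (intro exI[of _ ?T] conjI)
qed

lemma smooth_fun_of_smooth_on: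
  assumes "open V" "V \<subseteq> U" "smooth_on (x ` V) (f \<circ> inv_into U x)"
  shows "smooth_fun A V f"
  unfolding smooth_fun_def
proof (intro ballI, clarify)
  fix W z assume W: "(W, z) \<in> A"
  note cW = atlas_chart[OF W]
  have T: "open (z ` (W \<inter> V))" by (rule chart_image_open[OF cW assms(1)])
  have "smooth_on (z ` (W \<inter> V)) (\<lambda>y. (f \<circ> inv_into U x) ((x \<circ> inv_into W z) y))"
  proof (rule smooth_on_compose[OF T _ _ assms(3)])
    show "open (x ` V)" using image_open[OF assms(1)] assms(2) by (simp add: Int_absorb1)
    show "(x \<circ> inv_into W z) ` z ` (W \<inter> V) \<subseteq> x ` V" by (auto simp: chart_inv(1)[OF cW])
    show "smooth_on (z ` (W \<inter> V)) (x \<circ> inv_into W z)"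
      by (rule smooth_on_subset[OF local_coords_smooth_transition(2)[OF coords W]]) (use assms in auto)
  qed
  then show "smooth_on (z ` (W \<inter> V)) (f \<circ> inv_into W z)"
  proof (rule smooth_on_cong[OF T, rotated])
    fix y assume "y \<in> z ` (W \<inter> V)"
    then obtain q where "q \<in> W" "q \<in> U" "y = z q" using assms(2) by blast
    then show "(f \<circ> inv_into U x) ((x \<circ> inv_into W z) y) = (f \<circ> inv_into W z) y"
      by (simp add: chart_inv(1)[OF cW])
  qed
qed

lemma coord_smooth_fun: "smooth_fun A U (\<lambda>p. x p $ k)"
proof (rule smooth_fun_of_smooth_on)
  show "open U" by (rule chart_open[OF chart])
  show "smooth_on (x ` U) ((\<lambda>p. x p $ k) \<circ> inv_into U x)"
    by (rule smooth_on_cong[OF chart_open_image[OF chart] _ smooth_on_coord]) auto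
qed simp

lemma coord_smooth_near: "p \<in> U \<Longrightarrow> smooth_near A p (\<lambda>p. x p $ k)"
  unfolding smooth_near_def using coord_smooth_fun chart_open[OF chart] by blast

lemma smooth_near_differentiable:
  assumes "p \<in> U" "smooth_near A p f"
  shows "(f \<circ> inv_into U x) differentiable (at (x p))"
proof -
  obtain V where "open V" "p \<in> V" "smooth_fun A V f" using assms(2) by (auto simp: smooth_near_def)
  from smooth_on_of_smooth_fun[OF this(1,3)] show ?thesis
    by (rule smooth_on_differentiable) (use assms \<open>p \<in> V\<close> in blast)
qed

lemma coord_vec_coord:
  assumes "p \<in> U"
  shows "coord_vec A (U, x) p c (\<lambda>q. x q $ k) = c $ k"
proof -
  have "((\<lambda>q. x q $ k) \<circ> inv_into U x has_derivative (\<lambda>v. v $ k)) (at (x p))"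
    by (rule has_derivative_transform_within_open[OF
          bounded_linear_imp_has_derivative[OF bounded_linear_vec_nth] chart_open_image[OF chart]])
      (use assms in auto)
  from frechet_derivative_at[OF this, symmetric] coord_smooth_near[OF assms] show ?thesis
    by (simp add: coord_vec_def)
qed

lemma frechet_derivative_change_chart:
  assumes "is_chart (W, z)" "smooth_on (z ` (W \<inter> U)) (x \<circ> inv_into W z)"
    and "p \<in> U" "p \<in> W" "smooth_near A p f"
  shows "frechet_derivative (f \<circ> inv_into W z) (at (z p)) c =
    frechet_derivative (f \<circ> inv_into U x) (at (x p))
      (frechet_derivative (x \<circ> inv_into W z) (at (z p)) c)"
proof -
  let ?\<tau> = "x \<circ> inv_into W z" and ?F = "f \<circ> inv_into U x"
  have T: "open (z ` (W \<inter> U))" by (rule chart_image_open[OF assms(1) chart_open[OF chart]])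
  have zp: "z p \<in> z ` (W \<inter> U)" using assms by blast
  have tp: "?\<tau> (z p) = x p" using assms by (simp add: chart_inv(1)[OF assms(1)])
  have d\<tau>: "(?\<tau> has_derivative frechet_derivative ?\<tau> (at (z p))) (at (z p))"
    using smooth_on_differentiable[OF assms(2) zp] frechet_derivative_works by blast
  have dF: "(?F has_derivative frechet_derivative ?F (at (x p))) (at (?\<tau> (z p)))"
    unfolding tp using smooth_near_differentiable[OF assms(3,5)] frechet_derivative_works by blast
  have "((\<lambda>y. ?F (?\<tau> y)) has_derivative
      (\<lambda>v. frechet_derivative ?F (at (x p)) (frechet_derivative ?\<tau> (at (z p)) v))) (at (z p))"
    by (rule has_derivative_compose[OF d\<tau> dF])
  then have "(f \<circ> inv_into W z has_derivative
      (\<lambda>v. frechet_derivative ?F (at (x p)) (frechet_derivative ?\<tau> (at (z p)) v))) (at (z p))"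
    by (rule has_derivative_transform_within_open[OF _ T zp]) (auto simp: chart_inv(1)[OF assms(1)])
  from frechet_derivative_at[OF this] show ?thesis by metis
qed

lemma tangent_not_smooth: "X \<in> tangent_space A p \<Longrightarrow> \<not> smooth_near A p f \<Longrightarrow> X f = 0"
  by (auto simp: tangent_space_def coord_vec_def)

text \<open>Pushing the coefficients from an atlas chart forward by the derivative of the transition
  map gives coefficients in x; testing on the coordinate functions identifies them.\<close>

lemma tangent_coords:
  assumes "p \<in> U" "X \<in> tangent_space A p" "smooth_near A p f"
  shows "X f = (\<Sum>k\<in>UNIV. X (\<lambda>q. x q $ k) * partial_deriv k (f \<circ> inv_into U x) (x p))"
proof -
  obtain W z c where W: "(W, z) \<in> A" "p \<in> W" "X = coord_vec A (W, z) p c"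
    using assms(2) by (auto simp: tangent_space_def)
  let ?v = "frechet_derivative (x \<circ> inv_into W z) (at (z p)) c"
  have *: "X g = frechet_derivative (g \<circ> inv_into U x) (at (x p)) ?v" if "smooth_near A p g" for g
    using frechet_derivative_change_chart[OF atlas_chart[OF W(1)]
        local_coords_smooth_transition(2)[OF coords W(1)] assms(1) W(2) that] that
    by (simp add: W(3) coord_vec_def)
  have "X (\<lambda>q. x q $ k) = ?v $ k" for k
    using *[OF coord_smooth_near[OF assms(1)]] coord_vec_coord[OF assms(1), of ?v k]
      coord_smooth_near[OF assms(1)] by (simp add: coord_vec_def)
  then show ?thesis
    using *[OF assms(3)] frechet_derivative_partials[OF smooth_near_differentiable[OF assms(1,3)]]
    by simp
qed

lemma tangent_eqI:
  assumes "p \<in> U" "X \<in> tangent_space A p" "Y \<in> tangent_space A p"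
    and "\<And>k. X (\<lambda>q. x q $ k) = Y (\<lambda>q. x q $ k)"
  shows "X = Y"
proof
  fix f show "X f = Y f"
  proof (cases "smooth_near A p f")
    case True
    then show ?thesis
      using tangent_coords[OF assms(1,2) True] tangent_coords[OF assms(1,3) True] assms(4) by simp
  \<comment> \<open>On functions not smooth near p both operators take the default value 0.\<close>
  qed (use tangent_not_smooth[OF assms(2)] tangent_not_smooth[OF assms(3)] in simp)
qed

lemma coord_vec_in_tangent_space:
  assumes "p \<in> U"
  shows "coord_vec A (U, x) p c \<in> tangent_space A p"
proof -
  obtain W z where W: "(W, z) \<in> A" "p \<in> W" using in_atlas_chart assms by blast
  have lW: "local_coords A (W, z)"
    using atlas W(1) by (auto simp: local_coords_def smooth_atlas_def manifold_of_def)
  \<comment> \<open>The change of chart is now used in the opposite direction, with the atlas chart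
    as the target.\<close>
  interpret W: chart_at A W z by unfold_locales (rule atlas lW)+
  have "coord_vec A (U, x) p c =
      coord_vec A (W, z) p (frechet_derivative (z \<circ> inv_into U x) (at (x p)) c)"
    using W.frechet_derivative_change_chart[OF chart local_coords_smooth_transition(1)[OF coords W(1)] W(2) assms]
    by (auto simp: coord_vec_def)
  then show ?thesis using W by (auto simp: tangent_space_def)
qed

lemma zero_in_tangent_space:
  assumes "p \<in> U"
  shows "(\<lambda>f. 0) \<in> tangent_space A p"
proof -
  have "coord_vec A (U, x) p 0 = (\<lambda>f. 0)"
    using linear_0[OF linear_frechet_derivative[OF smooth_near_differentiable[OF assms]]]
    by (auto simp: coord_vec_def)
  then show ?thesis using coord_vec_in_tangent_space[OF assms, of 0] by simp
qed

lemma coord_expr_smooth: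
  assumes "open W" "smooth_vfield A W X"
  shows "smooth_on (x ` (U \<inter> W)) (coord_expr (U, x) X)"
proof (rule smooth_on_vec)
  show T: "open (x ` (U \<inter> W))" by (rule image_open[OF assms(1)])
  fix k
  have V: "open (U \<inter> W)" using chart_open[OF chart] assms(1) by blast
  have "smooth_fun A (U \<inter> W) (\<lambda>p. X p (\<lambda>q. x q $ k))"
    using assms(2) V smooth_fun_subset[OF coord_smooth_fun] unfolding smooth_vfield_def by blast
  from smooth_on_of_smooth_fun[OF V this]
  show "smooth_on (x ` (U \<inter> W)) (\<lambda>y. coord_expr (U, x) X y $ k)"
    by (simp add: coord_expr_def o_def Int_absorb1)
qed

text \<open>Smoothness and the formula are proved together: writing X_i in coordinates requires the
  inner word to be smooth near p, and the formula on all of V allows it to be replaced under a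
  derivative.\<close>

lemma frame_word_coords:
  fixes X :: "'n \<Rightarrow> 'm vfield"
  assumes "open V" "V \<subseteq> U" "\<And>j. smooth_vfield A V (X j)" "smooth_fun A V f"
  shows "smooth_fun A V (frame_word X I f) \<and> (\<forall>p\<in>V. frame_word X I f p =
    vf_word (\<lambda>j. coord_expr (U, x) (X j)) I (f \<circ> inv_into U x) (x p))"
proof (induction I)
  case Nil then show ?case using assms by (auto simp: subset_iff)
next
  case (Cons i I)
  let ?g = "frame_word X I f" and ?B = "\<lambda>j. coord_expr (U, x) (X j)"
  have "smooth_fun A V (\<lambda>p. X i p ?g)"
    using assms(1,3) Cons unfolding smooth_vfield_def by blast
  moreover have "X i p ?g = vf_op (?B i) (vf_word ?B I (f \<circ> inv_into U x)) (x p)" if p: "p \<in> V" for p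
  proof -
    have "open (x ` V)" using image_open[OF assms(1)] assms(2) by (simp add: Int_absorb1)
    then have pd: "partial_deriv k (?g \<circ> inv_into U x) (x p) =
        partial_deriv k (vf_word ?B I (f \<circ> inv_into U x)) (x p)" for k
    proof (rule partial_deriv_cong)
      fix y assume "y \<in> x ` V"
      then obtain q where "q \<in> V" "y = x q" by blast
      then show "(?g \<circ> inv_into U x) y = vf_word ?B I (f \<circ> inv_into U x) y"
        using conjunct2[OF Cons] assms(2) by (metis comp_apply inv_x subsetD)
    qed (use p in blast)
    have "X i p \<in> tangent_space A p" using assms(3) p by (auto simp: smooth_vfield_def)
    moreover have "smooth_near A p ?g" using Cons assms(1) p by (auto simp: smooth_near_def)
    ultimately show ?thesis
      using tangent_coords[of p "X i p" ?g] p assms(2) by (auto simp: pd vf_op_def coord_expr_def)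
  qed
  ultimately show ?case unfolding frame_word.simps vf_word.simps by blast
qed

end

section \<open>Composition of a chart with a diffeomorphism\<close>

lemma local_coords_compose:
  assumes "smooth_atlas A" "local_coords A (U, x)" "D \<subseteq> x ` U" "diffeo_on D \<phi>"
  shows "local_coords A ({p \<in> U. x p \<in> D}, \<phi> \<circ> x)"
    and "y \<in> D \<Longrightarrow> inv_into {p \<in> U. x p \<in> D} (\<phi> \<circ> x) (\<phi> y) = inv_into U x y"
proof -
  interpret chart_at A U x by unfold_locales fact+
  let ?U = "{p \<in> U. x p \<in> D}" and ?z = "\<phi> \<circ> x" and ?\<psi> = "inv_into D \<phi>"
  have D: "open D" "open (\<phi> ` D)" "inj_on \<phi> D" "smooth_on D \<phi>" "smooth_on (\<phi> ` D) ?\<psi>"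
    using assms(4) by (auto simp: diffeo_on_def)
  have xU: "x ` ?U = D" using assms(3) by auto
  have image: "?z ` ?U = \<phi> ` D" unfolding image_comp[symmetric] xU ..
  have inj: "inj_on ?z ?U"
  proof (rule comp_inj_on)
    show "inj_on x ?U" using inv_x by (intro inj_on_inverseI[of _ "inv_into U x"]) auto
    show "inj_on \<phi> (x ` ?U)" using D xU by simp
  qed
  have inv: "inv_into ?U ?z (\<phi> y) = inv_into U x y" if y: "y \<in> D" for y
  proof -
    obtain p where p: "p \<in> U" "y = x p" using assms(3) y by blast
    then have "inv_into ?U ?z (?z p) = p" using y by (intro inv_into_f_f[OF inj]) auto
    then show ?thesis using p by simp
  qed
  then show "y \<in> D \<Longrightarrow> inv_into ?U ?z (\<phi> y) = inv_into U x y" .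
  have inv': "inv_into ?U ?z y = inv_into U x (?\<psi> y)" if "y \<in> \<phi> ` D" for y
    using that inv D(3) by auto
  have psi: "?\<psi> (\<phi> y) = y" if "y \<in> D" for y using D(3) that by simp
  have oU: "open ?U"
  proof -
    have "?U = U \<inter> x -` D" by auto
    then show ?thesis
      using continuous_open_preimage[OF chart_inv(2)[OF chart] chart_open[OF chart] D(1)] by simp
  qed
  have chart': "is_chart (?U, ?z)"
  proof -
    have "homeomorphism ?U (\<phi> ` D) ?z (inv_into ?U ?z)"
    proof (rule homeomorphismI)
      show "continuous_on ?U ?z"
        using D xU by (intro continuous_on_compose continuous_on_subset[OF chart_inv(2)[OF chart]])
          (auto simp: smooth_on_continuous)
      have "continuous_on (\<phi> ` D) (inv_into U x \<circ> ?\<psi>)"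
        by (intro continuous_on_compose smooth_on_continuous[OF D(5)]
            continuous_on_subset[OF chart_inv(3)[OF chart]]) (use assms(3) psi in auto)
      then show "continuous_on (\<phi> ` D) (inv_into ?U ?z)"
        by (rule continuous_on_eq) (simp add: inv')
      show "?z ` ?U \<subseteq> \<phi> ` D" using image by simp
      show "inv_into ?U ?z ` \<phi> ` D \<subseteq> ?U" using inv_into_into[of _ ?z ?U] image by blast
      show "inv_into ?U ?z (?z p) = p" if "p \<in> ?U" for p using inv_into_f_f[OF inj that] .
      show "?z (inv_into ?U ?z y) = y" if "y \<in> \<phi> ` D" for y using f_inv_into_f[of y ?z ?U] image that by simp
    qed
    then show ?thesis using oU D(2) image by (simp add: is_chart_def)
  qed
  \<comment> \<open>Each transition is one of the old chart, preceded by the inverse of \<phi> or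
    followed by \<phi>.\<close>
  have "smooth_transition (?U, ?z) C \<and> smooth_transition C (?U, ?z)" if "C \<in> A" for C
  proof -
    obtain W y where C: "C = (W, y)" by (cases C)
    then have W: "(W, y) \<in> A" using that by simp
    note cW = atlas_chart[OF W]
    have "smooth_on (?z ` (?U \<inter> W)) (y \<circ> inv_into ?U ?z)"
    proof -
      have T: "open (?z ` (?U \<inter> W))" by (rule chart_image_open[OF chart' chart_open[OF cW]])
      have "smooth_on (?z ` (?U \<inter> W)) (\<lambda>v. (y \<circ> inv_into U x) (?\<psi> v))"
        by (rule smooth_on_compose[OF T chart_image_open[OF chart chart_open[OF cW]] _
              local_coords_smooth_transition(1)[OF coords W] smooth_on_subset[OF D(5)]])
          (auto simp: psi)
      then show ?thesis by (rule smooth_on_cong[OF T, rotated]) (auto simp: inv psi)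
    qed
    moreover have "smooth_on (y ` (W \<inter> ?U)) (?z \<circ> inv_into W y)"
    proof -
      have T: "open (y ` (W \<inter> ?U))" by (rule chart_image_open[OF cW oU])
      have "smooth_on (y ` (W \<inter> ?U)) (\<lambda>v. \<phi> ((x \<circ> inv_into W y) v))"
        by (rule smooth_on_compose[OF T D(1) _ D(4)
              smooth_on_subset[OF local_coords_smooth_transition(2)[OF coords W]]])
          (auto simp: chart_inv(1)[OF cW])
      then show ?thesis by (simp add: o_def)
    qed
    ultimately show ?thesis by (simp add: C smooth_transition_def)
  qed
  moreover have "?U \<subseteq> manifold_of A" using coords by (auto simp: local_coords_def)
  ultimately show "local_coords A (?U, ?z)" using chart' by (simp add: local_coords_def)
qed

section \<open>Carnot coordinates\<close>

text \<open>The ranks are separate data, and the least w in \<open>weight\<close> is known to exist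
  only once the rank of H_r is at least n. If k < n, some non-zero c is orthogonal to the k columns
  of the coefficient matrix of the X_j(a); it gives a second expansion of the zero vector in the
  frame.\<close>

lemma card_le_rank:
  fixes X :: "'n::finite \<Rightarrow> 'm::topological_space vfield" and A :: "('m, 'n) chart set"
  assumes "is_subbundle A k K" "a \<in> manifold_of A" "K a = tangent_space A a"
    and "\<And>j. X j a \<in> tangent_space A a" "(\<lambda>f. 0) \<in> tangent_space A a"
    and "\<And>v. v \<in> tangent_space A a \<Longrightarrow> \<exists>!c :: real^'n. v = (\<lambda>f. \<Sum>j\<in>UNIV. c $ j * X j a f)"
  shows "CARD('n) \<le> k"
proof (rule ccontr)
  assume "\<not> CARD('n) \<le> k"
  then have k: "k < CARD('n)" by simp
  obtain Y :: "nat \<Rightarrow> 'm vfield" where "K a = {(\<lambda>f. \<Sum>i<k. c i * Y i a f) | c. True}"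
    using assms(1,2) unfolding is_subbundle_def by meson
  then have "\<exists>M. X j a = (\<lambda>f. \<Sum>i<k. M i * Y i a f)" for j using assms(3,4) by blast
  then obtain M where M: "\<And>j. X j a = (\<lambda>f. \<Sum>i<k. M j i * Y i a f)" by metis
  define m :: "nat \<Rightarrow> real^'n" where "m i = (\<chi> j. M j i)" for i
  have "dim (span (m ` {..<k})) < DIM(real^'n)"
  proof -
    have "dim (span (m ` {..<k})) \<le> card (m ` {..<k})" by (simp add: dim_le_card')
    also have "\<dots> \<le> k" using card_image_le[of "{..<k}" m] by simp
    finally show ?thesis using k by simp
  qed
  then obtain c where c: "c \<noteq> 0" "\<And>y. y \<in> span (span (m ` {..<k})) \<Longrightarrow> orthogonal c y"
    using orthogonal_to_subspace_exists by blast
  have cm: "(\<Sum>j\<in>UNIV. c $ j * M j i) = 0" if "i < k" for i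
  proof -
    have "orthogonal c (m i)" using that by (intro c) (simp add: span_base)
    then show ?thesis by (simp add: orthogonal_def inner_vec_def m_def)
  qed
  have "(\<Sum>j\<in>UNIV. c $ j * X j a f) = 0" for f
  proof -
    have "(\<Sum>j\<in>UNIV. c $ j * X j a f) = (\<Sum>j\<in>UNIV. \<Sum>i<k. c $ j * M j i * Y i a f)"
      by (simp add: M sum_distrib_left mult.assoc)
    also have "\<dots> = (\<Sum>i<k. \<Sum>j\<in>UNIV. c $ j * M j i * Y i a f)" by (rule sum.swap)
    also have "\<dots> = 0" by (simp add: sum_distrib_right[symmetric] cm)
    finally show ?thesis .
  qed
  then have "(\<lambda>f. 0) = (\<lambda>f. \<Sum>j\<in>UNIV. c $ j * X j a f)" by simp
  moreover have "(\<lambda>f. 0) = (\<lambda>f. \<Sum>j\<in>UNIV. (0::real^'n) $ j * X j a f)" by simp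
  ultimately show False using assms(6)[OF assms(5)] c(1) by blast
qed

lemma weight_in_range:
  fixes j :: "'n::{finite,linorder}"
  assumes "1 \<le> r" "CARD('n) \<le> rk r"
  shows "weight r rk j \<in> {1..r}"
proof -
  have "card {..j} \<le> CARD('n)" by (rule card_mono) auto
  then have "r \<in> {1..r} \<and> card {..j} \<le> rk r" using assms by simp
  from LeastI[of "\<lambda>w. w \<in> {1..r} \<and> card {..j} \<le> rk w", OF this] show ?thesis
    by (simp add: weight_def)
qed

text \<open>\<open>THE\<close> is meaningful where the expansion exists and is unique; a change of
  sign transfers this from [X_i, X_j] to [X_j, X_i].\<close>

lemma structure_coeff_antisym:
  assumes "\<exists>!c :: real^'n::finite. lie_bracket A (X i) (X j) a = (\<lambda>f. \<Sum>k\<in>UNIV. c $ k * X k a f)"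
  shows "structure_coeff A X a j i = - structure_coeff A X a i j"
proof -
  have anti: "lie_bracket A (X j) (X i) a = (\<lambda>f. - lie_bracket A (X i) (X j) a f)"
    by (auto simp: lie_bracket_def)
  have iff: "lie_bracket A (X j) (X i) a = (\<lambda>f. \<Sum>k\<in>UNIV. c $ k * X k a f) \<longleftrightarrow>
      lie_bracket A (X i) (X j) a = (\<lambda>f. \<Sum>k\<in>UNIV. (- c) $ k * X k a f)" for c :: "real^'n"
    unfolding anti fun_eq_iff by (simp add: sum_negf minus_equation_iff[of "lie_bracket _ _ _ _ _"] eq_commute)
  define c where "c = structure_coeff A X a i j"
  have c: "lie_bracket A (X i) (X j) a = (\<lambda>f. \<Sum>k\<in>UNIV. c $ k * X k a f)"
    unfolding c_def structure_coeff_def by (rule theI'[OF assms])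
  show ?thesis unfolding structure_coeff_def[of A X a j i] iff c_def[symmetric]
  proof (intro the_equality)
    fix d assume "lie_bracket A (X i) (X j) a = (\<lambda>f. \<Sum>k\<in>UNIV. (- d) $ k * X k a f)"
    with c have "- d = c" using assms by blast
    then show "d = - c" by auto
  qed (use c in simp)
qed

text \<open>The derivative condition stands beside the weighted bound because the bound admits, in
  the k-th component of \<phi> x - x, a linear term in x_j with w_j > w_k. Such a term would destroy
  linear adaptedness at a.\<close>

theorem proposition5p10:
  fixes A :: "('m::{t2_space,second_countable_topology}, 'n::{finite,linorder}) chart set"
    and H :: "nat \<Rightarrow> 'm \<Rightarrow> 'm tvec set"
    and rk :: "nat \<Rightarrow> nat"
    and r :: nat
    and w :: "'n \<Rightarrow> nat"
    and a :: 'm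
    and X :: "'n \<Rightarrow> 'm vfield"
    and U :: "'m set"
    and x :: "'m \<Rightarrow> (real, 'n) vec"
    and N :: "(real, 'n) vec \<Rightarrow> real"
    and D :: "(real, 'n) vec set"
    and \<phi> :: "(real, 'n) vec \<Rightarrow> (real, 'n) vec"
  assumes "carnot_manifold A r H rk"
    and "w = weight r rk"
    and "a \<in> manifold_of A"
    and "h_frame_near A r H rk a X"
    and "carnot_coords A r w X a (U, x)"
    and "pseudo_norm w N"
    and "0 \<in> D" and "D \<subseteq> x ` U" and "diffeo_on D \<phi>"
  shows "carnot_coords A r w X a ({p \<in> U. x p \<in> D}, \<phi> \<circ> x) \<longleftrightarrow>
    (\<phi> has_derivative (\<lambda>v. v)) (at 0) \<and> weighted_bigo w N 1 (\<lambda>y. \<phi> y - y)"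
proof -
  let ?U = "{p \<in> U. x p \<in> D}" and ?z = "\<phi> \<circ> x" and ?\<psi> = "inv_into D \<phi>"
  let ?pr = "tangent_group_mult A r w X a"
  have atlas: "smooth_atlas A" and r: "1 \<le> r"
    using assms(1) by (auto simp: carnot_manifold_def)
  have bracket: "\<forall>w w' U X Y. 1 \<le> w \<and> 1 \<le> w' \<and> w + w' \<le> r \<and> open U \<and> U \<subseteq> manifold_of A \<and>
      local_section A (H w) U X \<and> local_section A (H w') U Y \<longrightarrow>
      local_section A (H (w + w')) U (lie_bracket A X Y)"
    using assms(1) unfolding carnot_manifold_def by (elim conjE)
  have linear: "linearly_adapted A X a (U, x)"
    using assms(5) by (simp add: carnot_coords_def privileged_coords_def)
  then have coords: "local_coords A (U, x)" and aU: "a \<in> U" and xa: "x a = 0"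
    and Xa: "\<And>j. X j a = coord_vec A (U, x) a (axis j 1)"
    by (auto simp: linearly_adapted_def)
  interpret chart_at A U x by unfold_locales (rule atlas coords)+
  note coords' = local_coords_compose[OF atlas coords assms(8,9)]
  interpret C': chart_at A ?U ?z by unfold_locales (rule atlas coords')+
  have D: "open D" "inj_on \<phi> D" "smooth_on D \<phi>" "open (\<phi> ` D)" "smooth_on (\<phi> ` D) ?\<psi>"
    using assms(9) by (auto simp: diffeo_on_def)
  have aU': "a \<in> ?U" using aU xa assms(7) by simp

  obtain U0 where U0: "open U0" "a \<in> U0" "U0 \<subseteq> manifold_of A"
      "\<forall>j. local_section A (H (w j)) U0 (X j)"
    and frame: "\<forall>p\<in>U0. \<forall>v\<in>tangent_space A p.
      \<exists>!c :: (real, 'n) vec. v = (\<lambda>f. \<Sum>j\<in>UNIV. c $ j * X j p f)"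
    using assms(4) unfolding h_frame_near_def assms(2)[symmetric] by (elim exE conjE) (rule that)
  have Xs: "smooth_vfield A U0 (X j)" for j using U0(4) by (simp add: local_section_def)
  have Xt: "X j p \<in> tangent_space A p" if "p \<in> U0" for j p
    using Xs that by (auto simp: smooth_vfield_def)

  have "CARD('n) \<le> rk r"
  proof (rule card_le_rank[where X = X])
    show "is_subbundle A (rk r) (H r)" "H r a = tangent_space A a"
      using assms(1,3) r by (auto simp: carnot_manifold_def)
  qed (rule assms(3) Xt[OF U0(2)] frame[rule_format, OF U0(2)] zero_in_tangent_space[OF aU] | assumption)+
  then have w_range: "w j \<in> {1..r}" for j unfolding assms(2) by (rule weight_in_range[OF r])
  interpret weights w by unfold_locales (use w_range in \<open>simp add: Suc_le_eq\<close>)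

  have pr_0: "?pr y 0 = y" for y
  proof -
    \<comment> \<open>Equality with a weight forces \<open>w i + w j \<le> r\<close>, the range in
      which the filtration condition makes [X_i, X_j] a smooth field and hence a tangent vector at
      a.\<close>
    have "structure_coeff A X a j i = - structure_coeff A X a i j" if "w k = w i + w j" for i j k
    proof (rule structure_coeff_antisym, rule frame[rule_format, OF U0(2)])
      have "w i + w j \<le> r" "1 \<le> w i" "1 \<le> w j" using that w_range[of k] w_range[of i] w_range[of j] by auto
      then have "local_section A (H (w i + w j)) U0 (lie_bracket A (X i) (X j))"
        using bracket[rule_format, of "w i" "w j" U0 "X i" "X j"] U0(1,3,4) by simp
      then show "lie_bracket A (X i) (X j) a \<in> tangent_space A a"
        using U0(2) by (auto simp: local_section_def smooth_vfield_def)
    qed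
    then have "graded_bracket w (structure_coeff A X a) y y = 0"
      by (intro graded_bracket_self) simp
    then show ?thesis unfolding tangent_group_mult_def
      by (intro dynkin_product_0_right r) (auto simp: graded_bracket_0)
  qed

  define B where "B j = coord_expr (U, x) (X j)" for j
  define B' where "B' j = coord_expr (?U, ?z) (X j)" for j
  have model_iff: "is_model_field (U, x) w X j W \<longleftrightarrow> model_limit w (w j) (B j) W"
    "is_model_field (?U, ?z) w X j W \<longleftrightarrow> model_limit w (w j) (B' j) W" for j W
    by (simp_all add: is_model_field_def model_limit_def B_def B'_def)
  obtain V where V: "\<And>j. left_invariant ?pr (V j)" "\<And>j. V j 0 = axis j 1"
    "\<And>j. model_limit w (w j) (B j) (V j)"
    using assms(5) unfolding carnot_coords_def model_iff by metis

  \<comment> \<open>The frame and \<phi> are both available on \<open>S\<close>, and its image under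
    \<phi> is where the frame is available in the new coordinates.\<close>
  define S where "S = D \<inter> x ` (U \<inter> U0)"
  have S: "open S" "0 \<in> S" "S \<subseteq> D"
    using D(1) image_open[OF U0(1)] assms(7) aU U0(2) xa by (auto simp: S_def intro: image_eqI[of 0 x a])
  have Bs: "smooth_on S (B j)" for j
    unfolding B_def by (rule smooth_on_subset[OF coord_expr_smooth[OF U0(1) Xs]]) (auto simp: S_def)
  have B0: "B j 0 = axis j 1" for j
  proof -
    have "inv_into U x 0 = a" using inv_x[OF aU] xa by simp
    then have "B j 0 $ k = axis j 1 $ k" for k
      using coord_vec_coord[OF aU] by (simp add: B_def coord_expr_def Xa)
    then show ?thesis by (simp add: vec_eq_iff)
  qed
  interpret adapted_frame w S B
    by unfold_locales (use S Bs B0 vanishes_of_model_limit[OF S(1,2) Bs V(3)] in auto)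

  have image_S: "?z ` (?U \<inter> U0) = \<phi> ` S" by (auto simp: S_def image_iff)
  have phi_smooth: "smooth_on S \<phi>" by (rule smooth_on_subset[OF D(3) S(3)])
  have transfer: "X j p (\<lambda>q. ?z q $ k) = vf_op (B j) (\<lambda>y. \<phi> y $ k) (x p)"
    if p: "p \<in> ?U" "p \<in> U0" for j k p
  proof -
    have "partial_deriv l ((\<lambda>q. ?z q $ k) \<circ> inv_into U x) (x p) = partial_deriv l (\<lambda>y. \<phi> y $ k) (x p)" for l
      by (rule partial_deriv_cong[OF S(1)]) (use p in \<open>auto simp: S_def\<close>)
    then show ?thesis
      using tangent_coords[OF _ Xt[OF p(2)] C'.coord_smooth_near[OF p(1)], of j k] p(1)
      by (simp add: vf_op_def B_def coord_expr_def)
  qed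
  have words: "frame_word X I (\<lambda>p. ?z p $ k) a = vf_word B I (\<lambda>y. \<phi> y $ k) 0" for I k
  proof -
    let ?f = "\<lambda>p. ?z p $ k"
    have W: "open (?U \<inter> U0)" using chart_open[OF C'.chart] U0(1) by blast
    have "frame_word X I ?f a = vf_word (\<lambda>j. coord_expr (U, x) (X j)) I (?f \<circ> inv_into U x) (x a)"
    proof (rule frame_word_coords[THEN conjunct2, THEN bspec])
      show "smooth_vfield A (?U \<inter> U0) (X j)" for j
        using Xs[of j] unfolding smooth_vfield_def by blast
      show "smooth_fun A (?U \<inter> U0) ?f" by (rule smooth_fun_subset[OF C'.coord_smooth_fun]) blast
    qed (use W aU' U0(2) in auto)
    also have "\<dots> = vf_word B I (?f \<circ> inv_into U x) 0" by (simp add: xa B_def[abs_def])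
    also have "\<dots> = vf_word B I (\<lambda>y. \<phi> y $ k) 0"
      by (rule vf_word_cong[OF S(1) _ S(2)]) (auto simp: S_def)
    finally show ?thesis .
  qed
  \<comment> \<open>At 0 the field \<open>B j\<close> is \<partial>_j, so X_j(a) applied to the new
    coordinates gives the matrix of the differential of \<phi>. This links linear adaptedness with
    the derivative condition.\<close>
  have partials: "partial_deriv j (\<lambda>y. \<phi> y $ k) 0 = X j a (\<lambda>q. ?z q $ k)" for j k
  proof -
    have "vf_op (B j) (\<lambda>y. \<phi> y $ k) 0 = partial_deriv j (\<lambda>y. \<phi> y $ k) 0"
      by (simp add: vf_op_def B0 axis_def if_distrib[of "\<lambda>z. z * _"] cong: if_cong)
    then show ?thesis using transfer[OF aU' U0(2)] xa by simp
  qed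
  have dphi: "\<phi> differentiable (at 0)" by (rule smooth_on_differentiable[OF D(3) assms(7)])
  have partial_component: "partial_deriv j (\<lambda>y. \<phi> y $ k) 0 = partial_deriv j \<phi> 0 $ k" for j k
    by (rule partial_deriv_bounded_linear[OF bounded_linear_vec_nth dphi])
  \<comment> \<open>The premise is obtained differently in the two directions: from the new chart
    being centred at a, or from the weighted bound.\<close>
  have frame_change: "frame_change w S B \<phi> ?\<psi> B'" if "\<phi> 0 = 0"
  proof unfold_locales
    show "smooth_on S \<phi>" by (rule phi_smooth)
    show "open (\<phi> ` S)" using C'.image_open[OF U0(1)] by (simp only: image_S)
    show "?\<psi> (\<phi> y) = y" if "y \<in> S" for y using D(2) S(3) that by auto
    have "0 \<in> \<phi> ` D" using assms(7) that by (auto intro: image_eqI[of 0 \<phi> 0])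
    then show "isCont ?\<psi> 0"
      using smooth_on_continuous[OF D(5)] unfolding continuous_on_eq_continuous_at[OF D(4)] by blast
    show "smooth_on (\<phi> ` S) (B' j)" for j
      using C'.coord_expr_smooth[OF U0(1) Xs] by (simp only: image_S B'_def)
    show "B' j (\<phi> y) $ k = vf_op (B j) (\<lambda>x. \<phi> x $ k) y" if "y \<in> S" for y j k
    proof -
      obtain p where "p \<in> U" "p \<in> U0" "y = x p" "y \<in> D" using \<open>y \<in> S\<close> by (auto simp: S_def)
      then show ?thesis using transfer[of p j k] coords'(2)[of y] by (simp add: B'_def coord_expr_def)
    qed
  qed (rule that)

  show ?thesis
  proof
    assume carnot': "carnot_coords A r w X a (?U, ?z)"
    then have privileged: "privileged_coords A w X a (?U, ?z)" by (simp add: carnot_coords_def)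
    then have phi0: "\<phi> 0 = 0" and Xa': "\<And>j. X j a = coord_vec A (?U, ?z) a (axis j 1)"
      using xa by (auto simp: privileged_coords_def linearly_adapted_def)
    interpret frame_change w S B \<phi> ?\<psi> B' by (rule frame_change[OF phi0])
    have "partial_deriv j \<phi> 0 = axis j 1" for j
      using partials[of j] C'.coord_vec_coord[OF aU'] partial_component[of j]
      by (simp add: vec_eq_iff Xa')
    then have "frechet_derivative \<phi> (at 0) = (\<lambda>v. v)"
      using frechet_derivative_partials[OF dphi] by (simp add: fun_eq_iff axis_expansion)
    then have deriv: "(\<phi> has_derivative (\<lambda>v. v)) (at 0)"
      using dphi frechet_derivative_works by metis
    have "model_limit w (w j) (B' j) (V j)" for j
    proof -
      obtain V' where V': "left_invariant ?pr V'" "V' 0 = axis j 1" "model_limit w (w j) (B' j) V'"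
        using carnot' unfolding carnot_coords_def model_iff by blast
      \<comment> \<open>Both fields are left-invariant with value \<partial>_j at 0, so old and new
        coordinates share the model field.\<close>
      have "V' = V j" using left_invariant_unique[OF V'(1) V(1) _ pr_0] V'(2) V(2) by simp
      then show ?thesis using V'(3) by simp
    qed
    moreover have "vf_word B I (\<lambda>y. \<phi> y $ k) 0 = 0" if "wt w I < w k" for I k
      using privileged that words[of I k] by (auto simp: privileged_coords_def has_order_def)
    ultimately have "vanishes w (\<lambda>y. \<theta> y $ k) (int (w k) + 1)" for k
      using theta_vanishes V(3) by blast
    then have "(\<lambda>y. \<theta> y $ k) \<in> O[nhds 0](\<lambda>y. rho w y ^ (w k + 1))" for k
      by (intro bigo_of_vanishes[OF S(1,2) theta_smooth]) (simp add: add.commute)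
    then have "weighted_bigo w N 1 (\<lambda>y. \<phi> y - y)"
      unfolding weighted_bigo_iff[OF assms(6)] by (simp add: \<theta>_def)
    with deriv show "(\<phi> has_derivative (\<lambda>v. v)) (at 0) \<and> weighted_bigo w N 1 (\<lambda>y. \<phi> y - y)" ..
  next
    assume R: "(\<phi> has_derivative (\<lambda>v. v)) (at 0) \<and> weighted_bigo w N 1 (\<lambda>y. \<phi> y - y)"
    then have O: "(\<lambda>y. (\<phi> y - y) $ k) \<in> O[nhds 0](\<lambda>y. rho w y ^ (w k + 1))" for k
      unfolding weighted_bigo_iff[OF assms(6)] by blast
    have phi0: "\<phi> 0 = 0"
    proof -
      have "\<phi> 0 $ k = 0" for k
      proof -
        obtain C \<delta> where "0 < \<delta>" "\<And>y. rho w y < \<delta> \<Longrightarrow> \<bar>(\<phi> y - y) $ k\<bar> \<le> C * rho w y ^ (w k + 1)"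
          using O[of k] unfolding bigo_rho_iff by blast
        \<comment> \<open>The neighbourhood contains 0 itself, where \<open>rho\<close> to the
          positive power \<open>w k + 1\<close> is 0.\<close>
        from this(2)[of 0] this(1) show ?thesis by simp
      qed
      then show ?thesis by (simp add: vec_eq_iff)
    qed
    interpret frame_change w S B \<phi> ?\<psi> B' by (rule frame_change[OF phi0])
    have theta_O: "(\<lambda>y. \<theta> y $ k) \<in> O[nhds 0](\<lambda>y. rho w y ^ (w k + 1))" for k
      using O[of k] by (simp add: \<theta>_def)
    have "partial_deriv j \<phi> 0 = axis j 1" for j
      unfolding partial_deriv_def using frechet_derivative_at[OF conjunct1[OF R]] by metis
    then have Xz: "X j a (\<lambda>q. ?z q $ k) = axis j 1 $ k" for j k
      using partials[of j k] partial_component[of j k] by simp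
    have linear': "linearly_adapted A X a (?U, ?z)"
      unfolding linearly_adapted_def
    proof (intro conjI allI)
      show "X j a = coord_vec A (?U, ?z) a (axis j 1)" for j
        by (rule C'.tangent_eqI[OF aU' Xt[OF U0(2)] C'.coord_vec_in_tangent_space[OF aU']])
          (simp only: Xz C'.coord_vec_coord[OF aU'])
    qed (use coords' aU' xa phi0 in auto)
    have "has_order w X a (\<lambda>p. ?z p $ k) (w k)" for k
      unfolding has_order_def words
    \<comment> \<open>X_k applied to the k-th new coordinate has the value 1 at a, so the order is
      not larger than w_k.\<close>
    proof (intro conjI allI impI exI[of _ "[k]"])
      show "vf_word B I (\<lambda>y. \<phi> y $ k) 0 = 0" if "wt w I < w k" for I
        by (rule phi_words_vanish[OF theta_O that])
      show "vf_word B [k] (\<lambda>y. \<phi> y $ k) 0 \<noteq> 0"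
        using words[of "[k]" k] Xz[of k k] by (simp add: axis_def)
    qed simp
    then have "privileged_coords A w X a (?U, ?z)"
      using linear' by (simp add: privileged_coords_def)
    moreover have "model_limit w (w j) (B' j) (V j)" for j
      by (rule same_model_limit[OF theta_O V(3)])
    ultimately show "carnot_coords A r w X a (?U, ?z)"
      unfolding carnot_coords_def model_iff using V(1,2) by blast
  qed
qed

end
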